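(* Let $F$ be a vector subspace of $\mathcal B(S)$ satisfying conditions (i)–(vi) below and assume (H1) below. Let $f\in\mathcal B(S^3)$ such that $Pf^2$ and $Pf^4$ exist and belong to $F$, and $Pf=0$. Let $(b_n)$ be an increasing sequence of positive reals with $b_n/\sqrt n\to+\infty$ and $b_n/\sqrt{n\log n}\to0$, and set $c^{-1}(t)=\inf\{k\in\mathbb N:k/b_k\ge t\}$. If $$\limsup_{n\to\infty}\frac{n}{b_n^2}\log\Big(n\operatorname*{ess\,sup}_{1\le k\le c^{-1}(b_{n+1})}\mathbb P\big(|f(\Delta_{\pi(k)})|>b_n\mid\mathcal H_{k-1}\big)\Big)=-\infty,$$ then $\big(\frac1{b_n}M^\pi_n(f)\big)_n$ satisfies a moderate deviation principle in $\mathbb R$ with speed $\frac{b_n^2}{n}$ and rate function $I(x)=\frac{x^2}{2(\mu,Pf^2)}$; that is, for every Borel $A\subset\mathbb R$, $$-\inf_{x\in A^\circ}I(x)\le\liminf_{n}\frac{n}{b_n^2}\log\mathbb P\Big(\frac{M^\pi_n(f)}{b_n}\in A\Big)\le\limsup_n\frac{n}{b_n^2}\log\mathbb P\Big(\frac{M^\pi_n(f)}{b_n}\in A\Big)\le-\inf_{x\in\overline A}I(x).$$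
   Context: Binary tree: $\mathbb T=\mathbb N^*$, vertex $n$ having daughters $2n,2n+1$; $\mathbb G_r=\{2^r,\dots,2^{r+1}-1\}$, $\mathbb T_r=\bigcup_{q=0}^r\mathbb G_q$. $(S,\mathcal S)$ is a metric space with Borel $\sigma$-field; $\mathcal B(S^p)$ is the set of measurable real functions on $S^p$. A $\mathbb T$-transition probability $P$ is a Markov kernel from $S$ to $S^2$; $P_0(x,B)=P(x,B\times S)$, $P_1(x,B)=P(x,S\times B)$, $Q=(P_0+P_1)/2$; $Pf(x)=\int f(x,y,z)P(x,dy\,dz)$; for $g,h\in\mathcal B(S)$, $(g\otimes h)(y,z)=g(y)h(z)$, $P(g\otimes h)(x)=\int g(y)h(z)P(x,dy\,dz)$. $(X_n)_{n\in\mathbb T}$ is a bifurcating Markov chain with initial law $\nu$ and $\mathbb T$-transition probability $P$: with $\mathcal F_r=\sigma(X_i,i\in\mathbb T_r)$, $\mathcal L(X_1)=\nu$ and for every $r$ and every family $(f_n)_{n\in\mathbb G_r}$ of bounded measurable functions on $S^3$, $\mathbb E[\prod_{n\in\mathbb G_r}f_n(X_n,X_{2n},X_{2n+1})\mid\mathcal F_r]=\prod_{n\in\mathbb G_r}Pf_n(X_n)$. $(Y_r)$ is a Markov chain on $S$ with transition $Q$. $\Delta_i=(X_i,X_{2i},X_{2i+1})$. $\pi$ is a random permutation of $\mathbb N^*$ leaving each $\mathbb G_r$ invariant, drawn uniformly among such permutations, independently of $X$. $M^\pi_n(f)=\sum_{i=1}^nf(\Delta_{\pi(i)})$; $\mathcal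 H_0=\sigma(X_1)$, $\mathcal H_n=\sigma(\Delta_{\pi(i)},1\le i\le n)$. $(\mu,g)=\int gd\mu$. Conditions on $F$: (i) $F$ contains constants; (ii) $g^2\in F$ for $g\in F$; (iii) for all $x$ and $g,h\in F$, $g\otimes h\in L^1(P(x,\cdot))$ and $P(g\otimes h)\in F$; (iv) there is a probability $\mu$ on $S$ with $F\subset L^1(\mu)$ and $\lim_r\mathbb E_x[g(Y_r)]=(\mu,g)$ for all $x$, $g\in F$ (with $Y_0=x$); (v) for every $g\in F$ there is $h\in F$ with $|Q^rg|\le h$ for all $r$; (vi) $F\subset L^1(\nu)$. (H1): there is $\alpha\in(0,1)$ such that for every $g\in F$ with $(\mu,g)=0$ there is $h\in F$ with $|Q^rg(x)|\le\alpha^rh(x)$ for all $r,x$. *)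

theory Defs
  imports "HOL-Probability.Probability"
begin

definition gen :: "nat \<Rightarrow> nat set" where
  "gen r = {2^r..<2^(Suc r)}"

definition tree_upto :: "nat \<Rightarrow> nat set" where
  "tree_upto r = (\<Union>q\<le>r. gen q)"

definition Delta :: "(nat \<Rightarrow> 'b \<Rightarrow> 'a) \<Rightarrow> nat \<Rightarrow> 'b \<Rightarrow> 'a \<times> 'a \<times> 'a" where
  "Delta X i \<omega> = (X i \<omega>, X (2*i) \<omega>, X (2*i+1) \<omega>)"

abbreviation S2 :: "('a::metric_space \<times> 'a) measure" where
  "S2 \<equiv> borel \<Otimes>\<^sub>M borel"

abbreviation S3 :: "('a::metric_space \<times> 'a \<times> 'a) measure" where
  "S3 \<equiv> borel \<Otimes>\<^sub>M (borel \<Otimes>\<^sub>M borel)"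

definition Pop :: "('a \<Rightarrow> ('a \<times> 'a) measure) \<Rightarrow> ('a \<times> 'a \<times> 'a \<Rightarrow> real) \<Rightarrow> 'a \<Rightarrow> real" where
  "Pop P f x = (\<integral>yz. f (x, fst yz, snd yz) \<partial>(P x))"

definition Ptens :: "('a \<Rightarrow> ('a \<times> 'a) measure) \<Rightarrow> ('a \<Rightarrow> real) \<Rightarrow> ('a \<Rightarrow> real) \<Rightarrow> 'a \<Rightarrow> real" where
  "Ptens P g h x = (\<integral>yz. g (fst yz) * h (snd yz) \<partial>(P x))"

text \<open>Q = (P0 + P1)/2 acting on functions: Qg(x) = (\<integral> g(y) P0(x,dy) + \<integral> g(z) P1(x,dz))/2.
  Then E_x[g(Y_r)] = (Q^r g)(x).\<close>
definition Qop :: "('a \<Rightarrow> ('a \<times> 'a) measure) \<Rightarrow> ('a \<Rightarrow> real) \<Rightarrow> 'a \<Rightarrow> real" where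
  "Qop P g x = ((\<integral>yz. g (fst yz) \<partial>(P x)) + (\<integral>yz. g (snd yz) \<partial>(P x))) / 2"

definition sig_gen :: "'b measure \<Rightarrow> ('b \<Rightarrow> 'c) set \<Rightarrow> 'c measure \<Rightarrow> 'b measure" where
  "sig_gen M Ys N = sigma (space M) (\<Union>Y\<in>Ys. {Y -` B \<inter> space M | B. B \<in> sets N})"

definition ln_ereal :: "ereal \<Rightarrow> ereal" where
  "ln_ereal x = (if x \<le> 0 then -\<infinity> else if x = \<infinity> then \<infinity> else ereal (ln (real_of_ereal x)))"

definition cinv :: "(nat \<Rightarrow> real) \<Rightarrow> real \<Rightarrow> nat" where
  "cinv b t = (LEAST k::nat. t \<le> real k / b k)"

definition rate :: "real \<Rightarrow> real \<Rightarrow> ereal" where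
  "rate s2 x = (if s2 = 0 then (if x = 0 then 0 else \<infinity>) else ereal (x^2 / (2 * s2)))"

end

theory Submission
  imports Defs
begin

text \<open>
  Since \<open>b\<^sub>n\<^sup>2 / n = o(log n)\<close>, every event of polynomially small probability is negligible at speed
  \<open>b\<^sub>n\<^sup>2 / n\<close>. The fourth moments make it polynomially unlikely that one of the first \<open>n\<close> terms
  exceeds \<open>n / b\<^sub>n\<close>, so the terms may be truncated there. The geometric ergodicity (H1) makes the second
  moments of centred sums over a generation geometrically small compared with the square of its size;
  the uniform permutation transfers this to incomplete generations, so that the averages of
  \<open>g(X(\<pi>(i)))\<close>, \<open>g \<in> F\<close>, deviate from \<open>(\<mu>, g)\<close> with polynomially small probability only.
  Conditionally on the permutation and on the past generations, the triangles of one generation are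
  independent, so the exponential of the truncated sum divided by its conditional means has expectation
  exactly one. Its compensator is \<open>\<lambda>\<^sup>2 / 2 * (\<mu>, P f\<^sup>2) * b\<^sub>n\<^sup>2 / n\<close> up to a negligible event, so the
  logarithmic Laplace transform is asymptotically quadratic and the argument of Gaertner and Ellis
  gives both bounds.
\<close>

section \<open>Exponential negligibility and the Gaertner--Ellis argument\<close>

text \<open>The Markov property speaks of all triangles of a generation at once, given the earlier
  generations, whereas the sum runs along a permuted numbering that breaks off inside a generation.
  Freezing the permutation resolves this: it preserves generations, so the states at positions up to
  i lie in generations up to that of i. A second obstacle is that an event negligible under the
  original law need not be negligible under the exponentially tilted one. Two devices exclude this.
  Truncation at n / b_n bounds the exponent of each single term by |l|. Positions are moreover
  switched off once their accumulated weight is too large, where the weight dominates the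
  conditional log-Laplace transforms; the compensator is then everywhere at most a constant times
  the speed, and the tilted density has a second moment at most exponential in the speed. The switch
  may look at the state of the current position itself, because given the past only its two
  daughters are still random; hence the mean of the density stays exactly one.\<close>

definition superexp :: "(nat \<Rightarrow> real) \<Rightarrow> (nat \<Rightarrow> real) \<Rightarrow> bool" where
  "superexp s p \<longleftrightarrow> (\<forall>K. \<forall>\<^sub>F n in sequentially. p n \<le> exp (- K * s n))"

lemma superexpD: "superexp s p \<Longrightarrow> \<forall>\<^sub>F n in sequentially. p n \<le> exp (- K * s n)"
  by (simp add: superexp_def)

lemma superexp_mono:
  assumes "superexp s q" "\<forall>\<^sub>F n in sequentially. p n \<le> q n"
  shows "superexp s p"
  unfolding superexp_def
proof
  fix K
  show "\<forall>\<^sub>F n in sequentially. p n \<le> exp (- K * s n)"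
    using superexpD[OF assms(1), of K] assms(2) by eventually_elim simp
qed

text \<open>Both summands are taken at \<open>K + 1\<close>: the spare unit is a factor
  \<open>exp (s n)\<close>, which is at least 2 once \<open>s n\<close> exceeds \<open>ln 2\<close>.
  Other numerical factors below are absorbed in the same way.\<close>

lemma superexp_add:
  assumes "filterlim s at_top sequentially" "superexp s p" "superexp s q"
  shows "superexp s (\<lambda>n. p n + q n)"
  unfolding superexp_def
proof
  fix K
  have "\<forall>\<^sub>F n in sequentially. s n \<ge> ln 2"
    using assms(1) by (simp add: filterlim_at_top)
  then show "\<forall>\<^sub>F n in sequentially. p n + q n \<le> exp (- K * s n)"
    using superexpD[OF assms(2), of "K + 1"] superexpD[OF assms(3), of "K + 1"]
  proof eventually_elim
    case (elim n)
    have "2 * exp (- (K + 1) * s n) \<le> exp (s n) * exp (- (K + 1) * s n)"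
      using elim(1) by (intro mult_right_mono) (auto simp: ln_le_cancel_iff[symmetric] ln_ge_iff)
    also have "\<dots> = exp (- K * s n)" by (simp add: exp_add[symmetric] algebra_simps)
    finally show ?case using elim(2,3) by linarith
  qed
qed

section \<open>Exponential bounds and scaled logarithms\<close>

lemma ln_ereal_scaled_le:
  assumes "0 < s" "p \<le> exp (- a * s)"
  shows "ereal (1 / s) * ln_ereal (ereal p) \<le> ereal (- a)"
proof (cases "p \<le> 0")
  case True
  then show ?thesis using assms by (simp add: ln_ereal_def)
next
  case False
  then have "ln p \<le> - a * s" using assms by (metis linorder_not_le ln_exp ln_mono)
  then have "ln p / s \<le> - a" using assms by (simp add: pos_divide_le_eq)
  then show ?thesis using False by (simp add: ln_ereal_def)
qed

lemma ln_ereal_scaled_ge: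
  assumes "0 < s" "exp (- a * s) \<le> p"
  shows "ereal (- a) \<le> ereal (1 / s) * ln_ereal (ereal p)"
proof -
  have p: "0 < p" using assms(2) exp_gt_zero less_le_trans by blast
  then have "- a * s \<le> ln p" using assms by (simp add: ln_ge_iff)
  then have "- a \<le> ln p / s" using assms by (simp add: pos_le_divide_eq)
  then show ?thesis using p by (simp add: ln_ereal_def)
qed

text \<open>Expresses that (1/s) ln E exp (l Y) tends to l^2 v / 2 for each l, without forming
  logarithms of expectations. Integrability is listed separately because a Bochner integral that
  does not exist equals 0, which would make the upper bound void.\<close>

definition (in prob_space) quadratic_log_laplace :: "(nat \<Rightarrow> real) \<Rightarrow> real \<Rightarrow> (nat \<Rightarrow> 'a \<Rightarrow> real) \<Rightarrow> bool" where
  "quadratic_log_laplace s v Y \<longleftrightarrow> (\<forall>l d. d > 0 \<longrightarrow> (\<forall>\<^sub>F n in sequentially.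
    integrable M (\<lambda>\<omega>. exp (l * Y n \<omega>))
    \<and> exp ((l\<^sup>2 * v / 2 - d) * s n) \<le> expectation (\<lambda>\<omega>. exp (l * Y n \<omega>))
    \<and> expectation (\<lambda>\<omega>. exp (l * Y n \<omega>)) \<le> exp ((l\<^sup>2 * v / 2 + d) * s n)))"

text \<open>The variable \<open>exp (l * Y n \<omega> - C l n \<omega>)\<close> is a probability
  density, and E exp (l Y) is the integral of exp C against it. Where C is near its predicted value
  this gives the claim at once. That the exceptional event stays rare under the density follows from
  a second moment: the squared density at l is the density at 2 l times
  \<open>exp (C (2 * l) n \<omega> - 2 * C l n \<omega>)\<close>, and \<open>bound\<close> controls
  this factor.\<close>

lemma (in prob_space) log_laplace_asymptotics:
  fixes s :: "nat \<Rightarrow> real" and Y :: "nat \<Rightarrow> 'a \<Rightarrow> real" and C :: "real \<Rightarrow> nat \<Rightarrow> 'a \<Rightarrow> real"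
  assumes s: "filterlim s at_top sequentially"
    and Y[measurable]: "\<And>n. Y n \<in> borel_measurable M"
    and C[measurable]: "\<And>l n. C l n \<in> borel_measurable M"
    and one: "\<And>l. \<forall>\<^sub>F n in sequentially. (\<integral>\<^sup>+\<omega>. ennreal (exp (l * Y n \<omega> - C l n \<omega>)) \<partial>M) = 1"
    and bound: "\<And>l. \<exists>K. \<forall>\<^sub>F n in sequentially. \<forall>\<omega>\<in>space M. \<bar>C l n \<omega>\<bar> \<le> K * s n"
    and conc: "\<And>l d. d > 0 \<Longrightarrow>
      superexp s (\<lambda>n. prob {\<omega> \<in> space M. \<bar>C l n \<omega> - l\<^sup>2 * v / 2 * s n\<bar> > d * s n})"
  shows "quadratic_log_laplace s v Y"
  unfolding quadratic_log_laplace_def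
proof (intro allI impI)
  fix l d :: real assume d: "d > 0"
  define D where "D k n \<omega> = exp (k * Y n \<omega> - C k n \<omega>)" for k n \<omega>
  have [measurable]: "D k n \<in> borel_measurable M" for k n unfolding D_def by measurable
  have D: "\<forall>\<^sub>F n in sequentially. integrable M (D k n) \<and> expectation (D k n) = 1" for k
    using one[of k]
  proof eventually_elim
    case (elim n)
    then have e: "(\<integral>\<^sup>+\<omega>. ennreal (D k n \<omega>) \<partial>M) = ennreal 1" by (simp add: D_def)
    then have "integrable M (D k n)"
      by (intro integrableI_nonneg) (auto simp: D_def)
    moreover from e have "expectation (D k n) = 1"
      by (subst (asm) nn_integral_eq_integrable) (auto simp: D_def)
    ultimately show ?case by simp
  qed
  obtain K1 where K1: "\<forall>\<^sub>F n in sequentially. \<forall>\<omega>\<in>space M. \<bar>C l n \<omega>\<bar> \<le> K1 * s n"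
    using bound by blast
  obtain K2 where K2: "\<forall>\<^sub>F n in sequentially. \<forall>\<omega>\<in>space M. \<bar>C (2 * l) n \<omega>\<bar> \<le> K2 * s n"
    using bound by blast
  define B where "B n = {\<omega> \<in> space M. \<bar>C l n \<omega> - l\<^sup>2 * v / 2 * s n\<bar> > d / 2 * s n}" for n
  have B[measurable]: "B n \<in> sets M" for n unfolding B_def by measurable
  have PB: "superexp s (\<lambda>n. prob (B n))" using conc[of "d/2" l] d by (simp add: B_def)
  have ge: "\<forall>\<^sub>F n in sequentially. s n \<ge> c" for c
    using s by (simp add: filterlim_at_top)
  have bad: "superexp s (\<lambda>n. expectation (\<lambda>\<omega>. D l n \<omega> * indicator (B n) \<omega>))"
    unfolding superexp_def
  proof
    fix K
    \<comment> \<open>\<open>K2 + 2 * K1\<close> is the rate lost when the squared density is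
      compared with the one at \<open>2 * l\<close>. With this R both terms of the weighted
      inequality \<open>D \<le> exp (- R * s) * D\<^sup>2 + exp (R * s)\<close> end up at rate
      \<open>K + 1\<close>, the second one through the smallness of \<open>B\<close>.\<close>
    define R where "R = K + 1 + K2 + 2 * K1"
    show "\<forall>\<^sub>F n in sequentially. expectation (\<lambda>\<omega>. D l n \<omega> * indicator (B n) \<omega>) \<le> exp (- K * s n)"
      using D[of l] D[of "2 * l"] K1 K2 superexpD[OF PB, of "K + 1 + R"] ge[of "ln 2"]
    proof eventually_elim
      case (elim n)
      have pt: "D l n \<omega> * indicator (B n) \<omega>
          \<le> exp ((K2 + 2 * K1 - R) * s n) * D (2 * l) n \<omega> + exp (R * s n) * indicator (B n) \<omega>"
        if w: "\<omega> \<in> space M" for \<omega>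
      proof (cases "\<omega> \<in> B n")
        case True
        have "D l n \<omega> \<le> exp (- R * s n) * (D l n \<omega>)\<^sup>2 + exp (R * s n)"
        proof -
          have "0 \<le> (exp (- R * s n / 2) * D l n \<omega> - exp (R * s n / 2))\<^sup>2" by simp
          also have "\<dots> = exp (- R * s n) * (D l n \<omega>)\<^sup>2 + exp (R * s n) - 2 * D l n \<omega>"
            by (simp add: power2_diff power_mult_distrib exp_double[symmetric] mult_exp_exp
                algebra_simps)
          finally show ?thesis by (smt (verit) D_def exp_gt_zero)
        qed
        also have "(D l n \<omega>)\<^sup>2 = D (2 * l) n \<omega> * exp (C (2 * l) n \<omega> - 2 * C l n \<omega>)"
          by (simp add: D_def exp_double[symmetric] mult_exp_exp algebra_simps)
        also have "exp (C (2 * l) n \<omega> - 2 * C l n \<omega>) \<le> exp ((K2 + 2 * K1) * s n)"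
        proof -
          have "\<bar>C l n \<omega>\<bar> \<le> K1 * s n" "\<bar>C (2 * l) n \<omega>\<bar> \<le> K2 * s n"
            using elim(3,4) w by auto
          then have "C (2 * l) n \<omega> - 2 * C l n \<omega> \<le> K2 * s n + 2 * (K1 * s n)" by linarith
          then show ?thesis by (simp add: algebra_simps)
        qed
        finally have "D l n \<omega> \<le> exp (- R * s n) * (D (2 * l) n \<omega> * exp ((K2 + 2 * K1) * s n)) + exp (R * s n)"
          by (simp add: D_def)
        also have "exp (- R * s n) * (D (2 * l) n \<omega> * exp ((K2 + 2 * K1) * s n)) =
            exp ((K2 + 2 * K1 - R) * s n) * D (2 * l) n \<omega>"
          by (simp add: D_def mult_exp_exp algebra_simps)
        finally show ?thesis using True by simp
      qed (simp add: D_def)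
      have "expectation (\<lambda>\<omega>. D l n \<omega> * indicator (B n) \<omega>)
          \<le> expectation (\<lambda>\<omega>. exp ((K2 + 2 * K1 - R) * s n) * D (2 * l) n \<omega> + exp (R * s n) * indicator (B n) \<omega>)"
        using elim(1,2) pt
        by (intro integral_mono integrable_real_mult_indicator Bochner_Integration.integrable_add
              integrable_mult_right) (auto simp: emeasure_eq_measure)
      also have "\<dots> = exp ((K2 + 2 * K1 - R) * s n) + exp (R * s n) * prob (B n)"
        using elim(2) by (subst Bochner_Integration.integral_add) (auto simp: emeasure_eq_measure)
      also have "\<dots> \<le> exp (- (K + 1) * s n) + exp (R * s n) * exp (- (K + 1 + R) * s n)"
        using elim(5) by (intro add_mono mult_left_mono) (auto simp: R_def)
      also have "\<dots> = 2 * exp (- (K + 1) * s n)"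
        by (simp add: mult_exp_exp algebra_simps)
      also have "\<dots> \<le> exp (s n) * exp (- (K + 1) * s n)"
        using elim(6) by (intro mult_right_mono) (auto simp: ln_ge_iff ln_le_cancel_iff[symmetric])
      also have "\<dots> = exp (- K * s n)" by (simp add: mult_exp_exp algebra_simps)
      finally show ?case .
    qed
  qed
  show "\<forall>\<^sub>F n in sequentially. integrable M (\<lambda>\<omega>. exp (l * Y n \<omega>))
    \<and> exp ((l\<^sup>2 * v / 2 - d) * s n) \<le> expectation (\<lambda>\<omega>. exp (l * Y n \<omega>))
    \<and> expectation (\<lambda>\<omega>. exp (l * Y n \<omega>)) \<le> exp ((l\<^sup>2 * v / 2 + d) * s n)"
    using D[of l] K1 superexpD[OF bad, of "\<bar>K1\<bar> + \<bar>l\<^sup>2 * v / 2\<bar>"] superexpD[OF bad, of "1"] ge[of "ln 2 * 2 / d"]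
      ge[of "ln 2"]
  proof eventually_elim
    case (elim n)
    have s0: "s n > 0" using elim(6) by (smt (verit) ln_gt_zero)
    have s2: "2 \<le> exp (d / 2 * s n)"
      using elim(5) d by (simp add: ln_ge_iff[symmetric] ln_le_cancel_iff[symmetric] field_simps)
    have E: "exp (l * Y n \<omega>) = D l n \<omega> * exp (C l n \<omega>)" for \<omega>
      by (simp add: D_def mult_exp_exp)
    have int: "integrable M (\<lambda>\<omega>. exp (l * Y n \<omega>))"
    proof (rule Bochner_Integration.integrable_bound)
      show "integrable M (\<lambda>\<omega>. D l n \<omega> * exp (K1 * s n))" using elim(1) by auto
      show "AE \<omega> in M. norm (exp (l * Y n \<omega>)) \<le> norm (D l n \<omega> * exp (K1 * s n))"
        using elim(2) by (intro AE_I2) (auto simp: E abs_mult D_def abs_le_iff)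
    qed measurable
    define q where "q = expectation (\<lambda>\<omega>. D l n \<omega> * indicator (B n) \<omega>)"
    have intB: "integrable M (\<lambda>\<omega>. D l n \<omega> * indicator (B n) \<omega>)"
      using elim(1) by (intro integrable_real_mult_indicator) auto
    have q0: "q \<ge> 0" unfolding q_def by (intro integral_nonneg_AE) (auto simp: D_def)
    have q1: "q \<le> 1/2"
    proof -
      have "q \<le> exp (- s n)" using elim(4) by (simp add: q_def)
      also have "\<dots> \<le> exp (- ln 2)" using elim(6) by simp
      finally show ?thesis by (simp add: exp_minus)
    qed
    \<comment> \<open>At least half of the mass of the density lies off \<open>B\<close>, where C is
      at least its predicted value minus \<open>d / 2 * s n\<close>; the other \<open>d / 2\<close>
      pays for the factor 1/2.\<close>
    have "exp ((l\<^sup>2 * v / 2 - d) * s n) = exp ((l\<^sup>2 * v / 2 - d / 2) * s n) / exp (d / 2 * s n)"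
      by (simp add: exp_diff[symmetric] algebra_simps)
    also have "\<dots> \<le> exp ((l\<^sup>2 * v / 2 - d / 2) * s n) / 2"
      using s2 by (intro divide_left_mono) auto
    also have "\<dots> \<le> exp ((l\<^sup>2 * v / 2 - d / 2) * s n) * (1 - q)"
      using q1 by simp
    also have "\<dots> = expectation (\<lambda>\<omega>. exp ((l\<^sup>2 * v / 2 - d / 2) * s n) * (D l n \<omega> - D l n \<omega> * indicator (B n) \<omega>))"
      using elim(1) intB by (simp add: q_def)
    also have "\<dots> \<le> expectation (\<lambda>\<omega>. exp (l * Y n \<omega>))"
    proof (intro integral_mono int integrable_mult_right Bochner_Integration.integrable_diff intB)
      fix \<omega> assume w: "\<omega> \<in> space M"
      show "exp ((l\<^sup>2 * v / 2 - d / 2) * s n) * (D l n \<omega> - D l n \<omega> * indicator (B n) \<omega>) \<le> exp (l * Y n \<omega>)"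
      proof (cases "\<omega> \<in> B n")
        case False
        then have "(l\<^sup>2 * v / 2 - d / 2) * s n \<le> C l n \<omega>"
          using w by (auto simp: B_def algebra_simps abs_if split: if_splits)
        then show ?thesis using False by (simp add: E D_def mult.commute)
      qed simp
    qed (use elim(1) in auto)
    finally have low: "exp ((l\<^sup>2 * v / 2 - d) * s n) \<le> expectation (\<lambda>\<omega>. exp (l * Y n \<omega>))" .
    have "expectation (\<lambda>\<omega>. exp (l * Y n \<omega>)) \<le>
      expectation (\<lambda>\<omega>. exp ((l\<^sup>2 * v / 2 + d / 2) * s n) * D l n \<omega> + exp (\<bar>K1\<bar> * s n) * (D l n \<omega> * indicator (B n) \<omega>))"
    proof (intro integral_mono int integrable_mult_right Bochner_Integration.integrable_add intB)
      fix \<omega> assume w: "\<omega> \<in> space M"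
      show "exp (l * Y n \<omega>) \<le> exp ((l\<^sup>2 * v / 2 + d / 2) * s n) * D l n \<omega> + exp (\<bar>K1\<bar> * s n) * (D l n \<omega> * indicator (B n) \<omega>)"
      proof (cases "\<omega> \<in> B n")
        case False
        then have "C l n \<omega> \<le> (l\<^sup>2 * v / 2 + d / 2) * s n"
          using w by (auto simp: B_def algebra_simps abs_if split: if_splits)
        then show ?thesis using False by (simp add: E D_def mult.commute)
      next
        case True
        have "C l n \<omega> \<le> K1 * s n" using elim(2) w by (auto simp: abs_le_iff)
        also have "\<dots> \<le> \<bar>K1\<bar> * s n" using s0 by (intro mult_right_mono) auto
        finally have "D l n \<omega> * exp (C l n \<omega>) \<le> D l n \<omega> * exp (\<bar>K1\<bar> * s n)"
          by (simp add: D_def)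
        moreover have "0 \<le> exp ((l\<^sup>2 * v / 2 + d / 2) * s n) * D l n \<omega>" by (simp add: D_def)
        ultimately show ?thesis using True by (simp add: E mult.commute)
      qed
    qed (use elim(1) in auto)
    also have "\<dots> = exp ((l\<^sup>2 * v / 2 + d / 2) * s n) + exp (\<bar>K1\<bar> * s n) * q"
      using elim(1) intB by (simp add: q_def)
    \<comment> \<open>On \<open>B\<close> only the crude bound on C is available. The first part of
      the rate required of q cancels it, the second leaves something below the main term whatever
      the sign of v.\<close>
    also have "exp (\<bar>K1\<bar> * s n) * q \<le> exp (\<bar>K1\<bar> * s n) * exp (- (\<bar>K1\<bar> + \<bar>l\<^sup>2 * v / 2\<bar>) * s n)"
      using elim(3) by (simp add: q_def)
    also have "\<dots> = exp (- \<bar>l\<^sup>2 * v / 2\<bar> * s n)" by (simp add: mult_exp_exp algebra_simps)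
    also have "\<dots> \<le> exp ((l\<^sup>2 * v / 2 + d / 2) * s n)"
      using s0 d unfolding exp_le_cancel_iff by (intro mult_right_mono) auto
    finally have "expectation (\<lambda>\<omega>. exp (l * Y n \<omega>)) \<le> 2 * exp ((l\<^sup>2 * v / 2 + d / 2) * s n)"
      by simp
    also have "\<dots> \<le> exp (d / 2 * s n) * exp ((l\<^sup>2 * v / 2 + d / 2) * s n)"
      using s2 by (intro mult_right_mono) auto
    also have "\<dots> = exp ((l\<^sup>2 * v / 2 + d) * s n)" by (simp add: mult_exp_exp algebra_simps)
    finally show ?case using int low by simp
  qed
qed


text \<open>Chernoff bound for both tails together, through exp (l |Y|) \<le> exp (l Y) + exp (- l
  Y). Half of d is the error of the Laplace transforms, the other half absorbs the factor 2.\<close>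

lemma (in prob_space) quadratic_log_laplace_upper:
  fixes s :: "nat \<Rightarrow> real" and Y :: "nat \<Rightarrow> 'a \<Rightarrow> real"
  assumes s: "filterlim s at_top sequentially"
    and Y[measurable]: "\<And>n. Y n \<in> borel_measurable M"
    and Laplace: "quadratic_log_laplace s v Y"
    and l: "l \<ge> 0" and d: "d > 0"
  shows "\<forall>\<^sub>F n in sequentially. prob {\<omega> \<in> space M. \<bar>Y n \<omega>\<bar> \<ge> y * s n} \<le> exp (- (l * y - l\<^sup>2 * v / 2 - d) * s n)"
proof -
  note Laplace = Laplace[unfolded quadratic_log_laplace_def, rule_format]
  have d2: "d / 2 > 0" using d by simp
  have "\<forall>\<^sub>F n in sequentially. s n \<ge> ln 2 * 2 / d"
    using s by (simp add: filterlim_at_top)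
  then show ?thesis
    using Laplace[OF d2, of l] Laplace[OF d2, of "- l"]
  proof eventually_elim
    case (elim n)
    have int: "integrable M (\<lambda>\<omega>. exp (l * Y n \<omega>))" "integrable M (\<lambda>\<omega>. exp (- l * Y n \<omega>))"
      using elim(2,3) d by auto
    have s2: "2 \<le> exp (d / 2 * s n)"
      using elim(1) d by (simp add: ln_ge_iff[symmetric] ln_le_cancel_iff[symmetric] field_simps)
    have "prob {\<omega> \<in> space M. \<bar>Y n \<omega>\<bar> \<ge> y * s n} =
        expectation (indicator {\<omega> \<in> space M. \<bar>Y n \<omega>\<bar> \<ge> y * s n})" by simp
    also have "\<dots> \<le> expectation (\<lambda>\<omega>. exp (- l * y * s n) * (exp (l * Y n \<omega>) + exp (- l * Y n \<omega>)))"
    proof (intro integral_mono integrable_mult_right Bochner_Integration.integrable_add int)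
      fix \<omega> assume "\<omega> \<in> space M"
      show "indicator {\<omega> \<in> space M. \<bar>Y n \<omega>\<bar> \<ge> y * s n} \<omega> \<le> exp (- l * y * s n) * (exp (l * Y n \<omega>) + exp (- l * Y n \<omega>))"
      proof (cases "\<bar>Y n \<omega>\<bar> \<ge> y * s n")
        case True
        have "1 \<le> exp (- l * y * s n) * exp (l * \<bar>Y n \<omega>\<bar>)"
          using mult_left_mono[OF True l] by (simp add: mult_exp_exp algebra_simps)
        also have "\<dots> \<le> exp (- l * y * s n) * (exp (l * Y n \<omega>) + exp (- l * Y n \<omega>))"
          by (intro mult_left_mono) (auto simp: abs_if)
        finally show ?thesis by (auto simp: indicator_def)
      qed (auto simp: indicator_def)
    qed (auto simp: emeasure_eq_measure)
    also have "\<dots> \<le> exp (- l * y * s n) * (exp ((l\<^sup>2 * v / 2 + d / 2) * s n) + exp ((l\<^sup>2 * v / 2 + d / 2) * s n))"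
      using elim(2,3) d int by (auto intro!: mult_left_mono add_mono)
    also have "\<dots> = 2 * (exp (- l * y * s n) * exp ((l\<^sup>2 * v / 2 + d / 2) * s n))" by simp
    also have "\<dots> \<le> exp (d / 2 * s n) * (exp (- l * y * s n) * exp ((l\<^sup>2 * v / 2 + d / 2) * s n))"
      using s2 by (intro mult_right_mono) auto
    also have "\<dots> = exp (- (l * y - l\<^sup>2 * v / 2 - d) * s n)" by (simp add: mult_exp_exp algebra_simps)
    finally show ?case .
  qed
qed

text \<open>The exponential change of measure, carried out by hand. E exp (l Y) is split over the
  window around \<open>l * v * s n\<close> and the two tails outside it. On the tails exp (l Y) is
  dominated by a multiple of exp ((l + h) Y) or exp ((l - h) Y), whose expectations are
  exponentially smaller than E exp (l Y); so the window carries at least a quarter of the leading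
  order, and there exp (l Y) is almost constant.\<close>

lemma (in prob_space) quadratic_log_laplace_lower:
  fixes s :: "nat \<Rightarrow> real" and Y :: "nat \<Rightarrow> 'a \<Rightarrow> real"
  assumes s: "filterlim s at_top sequentially"
    and v: "v \<ge> 0"
    and Y[measurable]: "\<And>n. Y n \<in> borel_measurable M"
    and Laplace: "quadratic_log_laplace s v Y"
    and \<epsilon>: "\<epsilon> > 0" and d: "d > 0"
  shows "\<forall>\<^sub>F n in sequentially. exp (- (l\<^sup>2 * v / 2 + d) * s n) \<le> prob {\<omega> \<in> space M. \<bar>Y n \<omega> - l * v * s n\<bar> < \<epsilon> * s n}"
proof -
  note Laplace = Laplace[unfolded quadratic_log_laplace_def, rule_format]
  \<comment> \<open>The second bound on the window width limits the variation of
    \<open>l * Y\<close> in it to \<open>d / 2 * s n\<close>.\<close>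
  define e where "e = min \<epsilon> (d / (2 * (\<bar>l\<bar> + 1)))"
  have e: "e > 0" "e \<le> \<epsilon>" using \<epsilon> d by (auto simp: e_def)
  have "\<bar>l\<bar> * e \<le> (\<bar>l\<bar> + 1) * e" using e by (simp add: algebra_simps)
  also have "\<dots> \<le> (\<bar>l\<bar> + 1) * (d / (2 * (\<bar>l\<bar> + 1)))" by (intro mult_left_mono) (auto simp: e_def)
  also have "\<dots> = d / 2" by (simp add: field_simps)
  finally have le: "\<bar>l\<bar> * e \<le> d / 2" .
  \<comment> \<open>The tails gain the exponent \<open>h * e - h\<^sup>2 * v / 2\<close>, which is
    maximal at e / v; the shift to v + 1 keeps h meaningful for v = 0 and still leaves a gain of at
    least \<open>h * e / 2\<close>.\<close>
  define h where "h = e / (v + 1)"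
  have h: "h > 0" using e v by (simp add: h_def)
  have "h * v \<le> e" using v e by (simp add: h_def field_simps)
  then have hv: "h\<^sup>2 * v / 2 \<le> h * e / 2"
    using h by (simp add: power2_eq_square mult.assoc)
  \<comment> \<open>The gain is at least 4 g and each Laplace transform may be off by g: the tails
    have exponent at most \<open>l\<^sup>2 * v / 2 - 3 * g\<close>, the total at least
    \<open>l\<^sup>2 * v / 2 - g\<close>. The gap 2 g absorbs the factor 4 coming from two tails
    that may use up half of the total.\<close>
  define g where "g = min (h * e / 8) (d / 8)"
  have g: "g > 0" "g \<le> h * e / 8" "g \<le> d / 8" using h e d by (auto simp: g_def)
  have "\<forall>\<^sub>F n in sequentially. s n \<ge> ln 4 / (2 * g) + ln 2 * 4 / d"
    using s by (simp add: filterlim_at_top)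
  then show ?thesis
    using Laplace[OF g(1), of l] Laplace[OF g(1), of "l + h"] Laplace[OF g(1), of "l - h"]
  proof eventually_elim
    case (elim n)
    have s1: "s n \<ge> ln 4 / (2 * g)" "s n \<ge> ln 2 * 4 / d"
      using elim(1) g d by (smt (verit) divide_nonneg_pos ln_ge_zero)+
    have s0: "s n > 0" using s1(1) g(1) by (smt (verit) divide_pos_pos ln_gt_zero)
    have s4: "4 \<le> exp (2 * g * s n)"
      using s1(1) g by (simp add: ln_ge_iff[symmetric] ln_le_cancel_iff[symmetric] field_simps)
    have s2: "2 \<le> exp (d / 4 * s n)"
      using s1(2) d by (simp add: ln_ge_iff[symmetric] ln_le_cancel_iff[symmetric] field_simps)
    let ?G = "{\<omega> \<in> space M. \<bar>Y n \<omega> - l * v * s n\<bar> < e * s n}"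
    let ?a = "exp ((l\<^sup>2 * v + d / 2) * s n)"
    let ?b = "exp (- h * s n * (l * v + e))"
    let ?c = "exp (h * s n * (l * v - e))"
    note int = elim(2)[THEN conjunct1] elim(3)[THEN conjunct1] elim(4)[THEN conjunct1]
    have [measurable]: "?G \<in> sets M" by measurable
    have "expectation (\<lambda>\<omega>. exp (l * Y n \<omega>)) \<le>
      expectation (\<lambda>\<omega>. ?a * indicator ?G \<omega> + (?b * exp ((l + h) * Y n \<omega>) + ?c * exp ((l - h) * Y n \<omega>)))"
    proof (intro integral_mono integrable_mult_right Bochner_Integration.integrable_add int)
      fix \<omega> assume w: "\<omega> \<in> space M"
      consider "\<omega> \<in> ?G" | "Y n \<omega> \<ge> s n * (l * v + e)" | "Y n \<omega> \<le> s n * (l * v - e)"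
        using w by (cases "Y n \<omega> < l * v * s n"; cases "\<bar>Y n \<omega> - l * v * s n\<bar> < e * s n")
          (auto simp: algebra_simps)
      then show "exp (l * Y n \<omega>) \<le> ?a * indicator ?G \<omega> + (?b * exp ((l + h) * Y n \<omega>) + ?c * exp ((l - h) * Y n \<omega>))"
      proof cases
        case 1
        then have "\<bar>Y n \<omega> - l * v * s n\<bar> \<le> e * s n" by simp
        then have "\<bar>l\<bar> * \<bar>Y n \<omega> - l * v * s n\<bar> \<le> \<bar>l\<bar> * (e * s n)" by (intro mult_left_mono) auto
        also have "\<dots> \<le> d / 2 * s n" using mult_right_mono[OF le, of "s n"] s0 by (simp add: mult.assoc)
        finally have "l * (Y n \<omega> - l * v * s n) \<le> d / 2 * s n"
          unfolding abs_mult[symmetric] by linarith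
        then have "l * Y n \<omega> \<le> (l\<^sup>2 * v + d / 2) * s n"
          by (simp add: algebra_simps power2_eq_square)
        then have "exp (l * Y n \<omega>) \<le> ?a * indicator ?G \<omega>" using 1 by simp
        then show ?thesis by (smt (verit) exp_gt_zero mult_pos_pos)
      next
        case 2
        have "exp (l * Y n \<omega>) \<le> ?b * exp ((l + h) * Y n \<omega>)"
          using mult_left_mono[OF 2, of h] h by (simp add: mult_exp_exp algebra_simps)
        moreover have "0 \<le> ?a * indicator ?G \<omega>" "0 \<le> ?c * exp ((l - h) * Y n \<omega>)" by auto
        ultimately show ?thesis by linarith
      next
        case 3
        have "exp (l * Y n \<omega>) \<le> ?c * exp ((l - h) * Y n \<omega>)"
          using mult_left_mono[OF 3, of h] h by (simp add: mult_exp_exp algebra_simps)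
        moreover have "0 \<le> ?a * indicator ?G \<omega>" "0 \<le> ?b * exp ((l + h) * Y n \<omega>)" by auto
        ultimately show ?thesis by linarith
      qed
    qed (auto simp: emeasure_eq_measure)
    also have "\<dots> = ?a * prob ?G + (?b * expectation (\<lambda>\<omega>. exp ((l + h) * Y n \<omega>)) + ?c * expectation (\<lambda>\<omega>. exp ((l - h) * Y n \<omega>)))"
      using int by (simp add: emeasure_eq_measure)
    also have "?b * expectation (\<lambda>\<omega>. exp ((l + h) * Y n \<omega>)) \<le> ?b * exp (((l + h)\<^sup>2 * v / 2 + g) * s n)"
      using elim(3) by (intro mult_left_mono) auto
    also have "\<dots> = exp ((l\<^sup>2 * v / 2 + (h\<^sup>2 * v / 2 - h * e) + g) * s n)"
      proof -
        have "- h * s n * (l * v + e) + ((l + h)\<^sup>2 * v / 2 + g) * s n = (l\<^sup>2 * v / 2 + (h\<^sup>2 * v / 2 - h * e) + g) * s n"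
          by (simp add: field_simps power2_eq_square)
        then show ?thesis unfolding mult_exp_exp by simp
      qed
    also have "\<dots> \<le> exp ((l\<^sup>2 * v / 2 - 3 * g) * s n)"
      using hv g s0 unfolding exp_le_cancel_iff by (intro mult_right_mono) auto
    also have "?c * expectation (\<lambda>\<omega>. exp ((l - h) * Y n \<omega>)) \<le> ?c * exp (((l - h)\<^sup>2 * v / 2 + g) * s n)"
      using elim(4) by (intro mult_left_mono) auto
    also have "\<dots> = exp ((l\<^sup>2 * v / 2 + (h\<^sup>2 * v / 2 - h * e) + g) * s n)"
      proof -
        have "h * s n * (l * v - e) + ((l - h)\<^sup>2 * v / 2 + g) * s n = (l\<^sup>2 * v / 2 + (h\<^sup>2 * v / 2 - h * e) + g) * s n"
          by (simp add: field_simps power2_eq_square)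
        then show ?thesis unfolding mult_exp_exp by simp
      qed
    also have "\<dots> \<le> exp ((l\<^sup>2 * v / 2 - 3 * g) * s n)"
      using hv g s0 unfolding exp_le_cancel_iff by (intro mult_right_mono) auto
    finally have "expectation (\<lambda>\<omega>. exp (l * Y n \<omega>)) \<le> ?a * prob ?G + 2 * exp ((l\<^sup>2 * v / 2 - 3 * g) * s n)"
      by simp
    moreover have "2 * exp ((l\<^sup>2 * v / 2 - 3 * g) * s n) \<le> exp ((l\<^sup>2 * v / 2 - g) * s n) / 2"
      using mult_right_mono[OF s4, of "exp ((l\<^sup>2 * v / 2 - 3 * g) * s n)"]
      by (simp add: mult_exp_exp algebra_simps)
    ultimately have "exp ((l\<^sup>2 * v / 2 - g) * s n) / 2 \<le> ?a * prob ?G"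
      using elim(2) by linarith
    then have *: "exp ((l\<^sup>2 * v / 2 - g) * s n) / 2 / ?a \<le> prob ?G"
      by (simp add: pos_divide_le_eq mult.commute)
    have "exp (- (l\<^sup>2 * v / 2 + d) * s n) \<le> exp ((l\<^sup>2 * v / 2 - g) * s n - d / 4 * s n - (l\<^sup>2 * v + d / 2) * s n)"
      using mult_right_mono[OF g(3), of "s n"] s0 d by (simp add: field_simps)
    also have "\<dots> = exp ((l\<^sup>2 * v / 2 - g) * s n) / exp (d / 4 * s n) / ?a"
      by (simp add: exp_diff)
    also have "\<dots> \<le> exp ((l\<^sup>2 * v / 2 - g) * s n) / 2 / ?a"
      using s2 by (intro divide_right_mono divide_left_mono) auto
    also note *
    also have "prob ?G \<le> prob {\<omega> \<in> space M. \<bar>Y n \<omega> - l * v * s n\<bar> < \<epsilon> * s n}"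
    proof (intro finite_measure_mono subsetI)
      fix \<omega> assume "\<omega> \<in> ?G"
      moreover have "e * s n \<le> \<epsilon> * s n" using e s0 by (intro mult_right_mono) auto
      ultimately show "\<omega> \<in> {\<omega> \<in> space M. \<bar>Y n \<omega> - l * v * s n\<bar> < \<epsilon> * s n}" by auto
    qed measurable
    finally show ?case .
  qed
qed

section \<open>From quadratic Laplace asymptotics to the two deviation bounds\<close>

lemma ereal_le_uminus_swap: "a \<le> - b \<longleftrightarrow> b \<le> - a" for a b :: ereal
  by (metis ereal_minus_le_minus ereal_uminus_uminus)

text \<open>Z is the normalised variable, Y a substitute for \<open>s n * Z n\<close> that differs
  from it only on a negligible event. Lower bound: every point of finite rate is a tilted mean
  \<open>l * v\<close>, so a small ball around an interior point is reached by tilting. Upper bound: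
  the rate is even and increases with |x|, so A lies outside a symmetric interval whose endpoints
  already have the required rate, and a single two-sided Chernoff bound suffices.\<close>

lemma (in prob_space) moderate_deviations_of_quadratic_log_laplace:
  fixes s :: "nat \<Rightarrow> real" and Y Z :: "nat \<Rightarrow> 'a \<Rightarrow> real"
  assumes s: "filterlim s at_top sequentially"
    and v: "v \<ge> 0"
    and Y[measurable]: "\<And>n. Y n \<in> borel_measurable M"
    and Z[measurable]: "\<And>n. Z n \<in> borel_measurable M"
    and Laplace: "quadratic_log_laplace s v Y"
    and eq: "superexp s (\<lambda>n. prob {\<omega> \<in> space M. s n * Z n \<omega> \<noteq> Y n \<omega>})"
    and A[measurable]: "A \<in> sets borel"
    and L: "\<forall>\<^sub>F n in sequentially. L n = ereal (1 / s n) * ln_ereal (ereal (prob {\<omega> \<in> space M. Z n \<omega> \<in> A}))"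
  shows "- (INF x\<in>interior A. rate v x) \<le> liminf L"
    and "limsup L \<le> - (INF x\<in>closure A. rate v x)"
proof -
  have spos: "\<forall>\<^sub>F n in sequentially. s n > 0"
    using s by (simp add: filterlim_at_top_dense)
  have rate_nonneg: "0 \<le> rate v x" for x using v by (auto simp: rate_def)
  show "- (INF x\<in>interior A. rate v x) \<le> liminf L"
    unfolding ereal_uminus_le_reorder[of "INF x\<in>interior A. rate v x"]
  proof (rule INF_greatest)
    fix x assume x: "x \<in> interior A"
    show "- liminf L \<le> rate v x"
    proof (cases "rate v x = \<infinity>")
      case False
      \<comment> \<open>For v = 0 the only point of finite rate is 0, and \<open>l = 0\<close>
        represents it.\<close>
      define l where "l = (if v = 0 then 0 else x / v)"
      have xl: "x = l * v" and rl: "rate v x = ereal (l\<^sup>2 * v / 2)"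
        using False by (auto simp: rate_def l_def power2_eq_square split: if_splits)
      obtain e where e: "e > 0" "ball x e \<subseteq> A"
        using x by (auto simp: mem_interior)
      have "ereal (- (l\<^sup>2 * v / 2 + d)) \<le> liminf L" if d: "d > 0" for d
      proof (rule Liminf_bounded)
        have d2: "d / 2 > 0" using d by simp
        have low: "\<forall>\<^sub>F n in sequentially. exp (- (l\<^sup>2 * v / 2 + d / 2) * s n)
            \<le> prob {\<omega> \<in> space M. \<bar>Y n \<omega> - l * v * s n\<bar> < e * s n}"
          by (rule quadratic_log_laplace_lower[OF s v Y Laplace e(1) d2])
        have "\<forall>\<^sub>F n in sequentially. s n \<ge> ln 2 * 2 / d"
          using s by (simp add: filterlim_at_top)
        then show "\<forall>\<^sub>F n in sequentially. ereal (- (l\<^sup>2 * v / 2 + d)) \<le> L n"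
          using low superexpD[OF eq, of "l\<^sup>2 * v / 2 + d"] spos L
        proof eventually_elim
          case (elim n)
          have s2: "2 \<le> exp (d / 2 * s n)"
            using elim(1) d by (simp add: ln_ge_iff[symmetric] ln_le_cancel_iff[symmetric] field_simps)
          let ?N = "{\<omega> \<in> space M. s n * Z n \<omega> \<noteq> Y n \<omega>}"
          have "prob {\<omega> \<in> space M. \<bar>Y n \<omega> - l * v * s n\<bar> < e * s n} \<le> prob ({\<omega> \<in> space M. Z n \<omega> \<in> A} \<union> ?N)"
          proof (intro finite_measure_mono subsetI)
            fix \<omega> assume w: "\<omega> \<in> {\<omega> \<in> space M. \<bar>Y n \<omega> - l * v * s n\<bar> < e * s n}"
            show "\<omega> \<in> {\<omega> \<in> space M. Z n \<omega> \<in> A} \<union> ?N"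
            proof (cases "s n * Z n \<omega> = Y n \<omega>")
              case True
              have "\<bar>s n * Z n \<omega> - l * v * s n\<bar> = s n * \<bar>Z n \<omega> - x\<bar>"
                using elim(4) abs_mult[of "s n" "Z n \<omega> - x"] by (simp add: xl algebra_simps)
              then have "s n * \<bar>Z n \<omega> - x\<bar> < s n * e" using w True by (simp add: mult.commute)
              then have "Z n \<omega> \<in> ball x e" using elim(4) by (simp add: dist_real_def abs_minus_commute)
              then show ?thesis using w e by auto
            qed (use w in auto)
          qed measurable
          also have "\<dots> \<le> prob {\<omega> \<in> space M. Z n \<omega> \<in> A} + prob ?N"
            by (intro measure_Un_le) measurable
          finally have "exp (- (l\<^sup>2 * v / 2 + d / 2) * s n) - exp (- (l\<^sup>2 * v / 2 + d) * s n) \<le> prob {\<omega> \<in> space M. Z n \<omega> \<in> A}"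
            using elim(2,3) d by auto
          moreover have "exp (- (l\<^sup>2 * v / 2 + d / 2) * s n) = exp (d / 2 * s n) * exp (- (l\<^sup>2 * v / 2 + d) * s n)"
            by (simp add: mult_exp_exp algebra_simps)
          moreover have "\<dots> \<ge> 2 * exp (- (l\<^sup>2 * v / 2 + d) * s n)"
            using s2 by (intro mult_right_mono) auto
          ultimately have "exp (- (l\<^sup>2 * v / 2 + d) * s n) \<le> prob {\<omega> \<in> space M. Z n \<omega> \<in> A}" by linarith
          from ln_ereal_scaled_ge[OF elim(4) this] show ?case using elim(5) by simp
        qed
      qed
      then have "- liminf L \<le> ereal (l\<^sup>2 * v / 2) + ereal d" if "d > 0" for d
        using that ereal_uminus_le_reorder by fastforce
      then show ?thesis unfolding rl by (rule ereal_le_epsilon2) auto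
    qed simp
  qed
  show "limsup L \<le> - (INF x\<in>closure A. rate v x)"
    unfolding ereal_le_uminus_swap[of "limsup L"]
  proof (rule dense_le)
    \<comment> \<open>Working strictly below the infimum makes every positive level a real number,
      even when the infimum is infinite, as for an empty closure.\<close>
    fix a assume a: "a < (INF x\<in>closure A. rate v x)"
    have up: "limsup L \<le> ereal (- c)" if c: "\<forall>\<^sub>F n in sequentially. prob {\<omega> \<in> space M. Z n \<omega> \<in> A} \<le> exp (- c * s n)" for c
    proof (rule Limsup_bounded)
      show "\<forall>\<^sub>F n in sequentially. L n \<le> ereal (- c)"
        using c spos L by eventually_elim (auto intro: ln_ereal_scaled_le)
    qed
    show "a \<le> - limsup L"
    proof (cases "a \<le> 0")
      case True
      have "limsup L \<le> ereal (- 0)" by (rule up) simp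
      then have "limsup L \<le> 0" by (simp add: zero_ereal_def)
      then have "0 \<le> - limsup L" by simp
      with True show ?thesis by (rule order_trans)
    next
      case False
      then obtain c where c: "a = ereal c" "c > 0" using a by (cases a) auto
      have rA: "ereal c < rate v x" if "x \<in> closure A" for x
        by (rule less_le_trans[OF _ INF_lower[OF that]]) (use a c in simp)
      \<comment> \<open>For v > 0, y solves y^2 / (2 v) = c and l = y / v maximises the Chernoff
        exponent. For v = 0 that exponent is linear in l, and any y > 0 separating A from 0
        serves.\<close>
      obtain l y where ly: "l \<ge> 0" "c \<le> l * y - l\<^sup>2 * v / 2" "\<And>x. x \<in> A \<Longrightarrow> \<bar>x\<bar> \<ge> y"
      proof (cases "v = 0")
        case True
        have "0 \<notin> closure A" using rA[of 0] c True by (auto simp: rate_def)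
        then obtain y where y: "y > 0" "\<And>x. x \<in> A \<Longrightarrow> \<not> dist x 0 < y"
          by (auto simp: closure_approachable)
        show ?thesis
        proof (rule that[of "c / y" y])
          show "\<bar>x\<bar> \<ge> y" if "x \<in> A" for x using y(2)[OF that] by simp
        qed (use y c True in auto)
      next
        case False
        then have v0: "v > 0" using v by simp
        define y where "y = sqrt (2 * v * c)"
        have y2: "y\<^sup>2 = 2 * v * c" using v c by (simp add: y_def)
        show ?thesis
        proof (rule that[of "y / v" y])
          show "c \<le> y / v * y - (y / v)\<^sup>2 * v / 2"
            using v0 y2 by (simp add: power2_eq_square field_simps)
          show "\<bar>x\<bar> \<ge> y" if "x \<in> A" for x
          proof -
            have "c < x\<^sup>2 / (2 * v)" using rA[of x] that closure_subset v0 by (auto simp: rate_def)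
            then have "2 * v * c \<le> x\<^sup>2" using v0 by (simp add: field_simps)
            then show ?thesis unfolding y_def by (metis real_sqrt_abs real_sqrt_le_mono)
          qed
        qed (use v0 c in \<open>auto simp: y_def\<close>)
      qed
      have "ereal (c - d) \<le> - limsup L" if d: "d > 0" for d
      proof -
        have "limsup L \<le> ereal (- (c - d))"
        proof (rule up)
          have d2: "d / 2 > 0" using d by simp
          have upp: "\<forall>\<^sub>F n in sequentially. prob {\<omega> \<in> space M. \<bar>Y n \<omega>\<bar> \<ge> y * s n}
              \<le> exp (- (l * y - l\<^sup>2 * v / 2 - d / 2) * s n)"
            by (rule quadratic_log_laplace_upper[OF s Y Laplace ly(1) d2])
          have "\<forall>\<^sub>F n in sequentially. s n \<ge> ln 2 * 2 / d"
            using s by (simp add: filterlim_at_top)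
          then show "\<forall>\<^sub>F n in sequentially. prob {\<omega> \<in> space M. Z n \<omega> \<in> A} \<le> exp (- (c - d) * s n)"
            using upp superexpD[OF eq, of "c - d / 2"] spos
          proof eventually_elim
            case (elim n)
            have s2: "2 \<le> exp (d / 2 * s n)"
              using elim(1) d by (simp add: ln_ge_iff[symmetric] ln_le_cancel_iff[symmetric] field_simps)
            let ?N = "{\<omega> \<in> space M. s n * Z n \<omega> \<noteq> Y n \<omega>}"
            have "prob {\<omega> \<in> space M. Z n \<omega> \<in> A} \<le> prob ({\<omega> \<in> space M. \<bar>Y n \<omega>\<bar> \<ge> y * s n} \<union> ?N)"
            proof (intro finite_measure_mono subsetI)
              fix \<omega> assume w: "\<omega> \<in> {\<omega> \<in> space M. Z n \<omega> \<in> A}"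
              show "\<omega> \<in> {\<omega> \<in> space M. \<bar>Y n \<omega>\<bar> \<ge> y * s n} \<union> ?N"
              proof (cases "s n * Z n \<omega> = Y n \<omega>")
                case True
                have "y * s n \<le> \<bar>Z n \<omega>\<bar> * s n" using w ly(3) elim(4) by (intro mult_right_mono) auto
                also have "\<dots> = \<bar>Y n \<omega>\<bar>" using elim(4) by (simp add: True[symmetric] abs_mult)
                finally show ?thesis using w by simp
              qed (use w in auto)
            qed measurable
            also have "\<dots> \<le> prob {\<omega> \<in> space M. \<bar>Y n \<omega>\<bar> \<ge> y * s n} + prob ?N"
              by (intro measure_Un_le) measurable
            also have "\<dots> \<le> exp (- (l * y - l\<^sup>2 * v / 2 - d / 2) * s n) + exp (- (c - d / 2) * s n)"
              using elim(2,3) d by auto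
            also have "exp (- (l * y - l\<^sup>2 * v / 2 - d / 2) * s n) \<le> exp (- (c - d / 2) * s n)"
              using ly(2) elim(4) unfolding exp_le_cancel_iff by (intro mult_right_mono) auto
            finally have "prob {\<omega> \<in> space M. Z n \<omega> \<in> A} \<le> 2 * exp (- (c - d / 2) * s n)" by simp
            also have "\<dots> \<le> exp (d / 2 * s n) * exp (- (c - d / 2) * s n)"
              using s2 by (intro mult_right_mono) auto
            also have "\<dots> = exp (- (c - d) * s n)" by (simp add: mult_exp_exp algebra_simps)
            finally show ?case .
          qed
        qed
        then show ?thesis by (simp add: ereal_le_uminus_swap)
      qed
      then have "ereal c \<le> - limsup L + ereal d" if "d > 0" for d
        using that by (cases "limsup L") (auto simp: algebra_simps)
      then show ?thesis unfolding c by (rule ereal_le_epsilon2) auto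
    qed
  qed
qed

section \<open>Second moments along a bifurcating chain\<close>

lemma finite_gen[simp]: "finite (gen r)" and gen_ge_1: "i \<in> gen r \<Longrightarrow> i \<ge> 1"
  and card_gen: "card (gen r) = 2 ^ r"
  using one_le_power[of "2 :: nat" r] by (auto simp: gen_def)

lemma ex_gen: "i \<ge> 1 \<Longrightarrow> \<exists>r. i \<in> gen r"
  unfolding gen_def using ex_power_ivl1[of 2 i] by auto

lemma sum_gen_Suc: "(\<Sum>i\<in>gen (Suc r). h i) = (\<Sum>i\<in>gen r. h (2 * i) + h (2 * i + 1))"
proof -
  have "gen (Suc r) = (\<lambda>i. 2 * i) ` gen r \<union> (\<lambda>i. 2 * i + 1) ` gen r"
  proof (intro equalityI subsetI)
    fix i assume "i \<in> gen (Suc r)"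
    then have "i div 2 \<in> gen r" and "i = 2 * (i div 2) \<or> i = 2 * (i div 2) + 1"
      by (auto simp: gen_def)
    then show "i \<in> (\<lambda>i. 2 * i) ` gen r \<union> (\<lambda>i. 2 * i + 1) ` gen r" by blast
  qed (auto simp: gen_def)
  then have "(\<Sum>i\<in>gen (Suc r). h i) = (\<Sum>i\<in>(\<lambda>i. 2 * i) ` gen r. h i) + (\<Sum>i\<in>(\<lambda>i. 2 * i + 1) ` gen r. h i)"
    by (simp add: sum.union_disjoint) (intro sum.union_disjoint; auto; presburger)
  also have "\<dots> = (\<Sum>i\<in>gen r. h (2 * i)) + (\<Sum>i\<in>gen r. h (2 * i + 1))"
    by (simp add: sum.reindex inj_on_def)
  finally show ?thesis by (simp add: sum.distrib)
qed

section \<open>Generated sigma-fields\<close>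

lemma space_sig_gen: "space (sig_gen M Ys N) = space M"
  unfolding sig_gen_def by (subst space_measure_of_conv) simp

lemma space_in_sig_gen: "space M \<in> sets (sig_gen M Ys N)"
  by (metis sets.top space_sig_gen)

lemma subalgebra_sig_gen:
  assumes "\<And>Y. Y \<in> Ys \<Longrightarrow> Y \<in> M \<rightarrow>\<^sub>M N"
  shows "subalgebra M (sig_gen M Ys N)"
  unfolding subalgebra_def sig_gen_def
proof
  show "space (sigma (space M) (\<Union>Y\<in>Ys. {Y -` B \<inter> space M |B. B \<in> sets N})) = space M"
    by (simp add: space_measure_of_conv)
  have "(\<Union>Y\<in>Ys. {Y -` B \<inter> space M |B. B \<in> sets N}) \<subseteq> sets M"
    using assms by (auto intro: measurable_sets)
  then show "sets (sigma (space M) (\<Union>Y\<in>Ys. {Y -` B \<inter> space M |B. B \<in> sets N})) \<subseteq> sets M"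
    by (rule sets.sigma_sets_subset[OF _, THEN order_trans[rotated]]) (auto simp: sets_measure_of_conv)
qed

lemma measurable_sig_gen:
  assumes "Y \<in> Ys" "Y \<in> space M \<rightarrow> space N"
  shows "Y \<in> sig_gen M Ys N \<rightarrow>\<^sub>M N"
proof (rule measurableI)
  note sp = space_sig_gen[of M Ys N]
  show "Y x \<in> space N" if "x \<in> space (sig_gen M Ys N)" for x using that assms sp by auto
  fix B assume "B \<in> sets N"
  then have "Y -` B \<inter> space M \<in> (\<Union>Y\<in>Ys. {Y -` B \<inter> space M |B. B \<in> sets N})" using assms by blast
  then show "Y -` B \<inter> space (sig_gen M Ys N) \<in> sets (sig_gen M Ys N)"
    unfolding sp unfolding sig_gen_def by (intro in_measure_of) auto
qed

section \<open>Triangles of one generation\<close>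

locale bifurcating_chain = prob_space M for M :: "'b measure" +
  fixes X :: "nat \<Rightarrow> 'b \<Rightarrow> 'a::metric_space"
    and P :: "'a \<Rightarrow> ('a \<times> 'a) measure"
  assumes P_kernel: "P \<in> borel \<rightarrow>\<^sub>M prob_algebra S2"
    and X_meas: "\<And>i. i \<ge> 1 \<Longrightarrow> X i \<in> M \<rightarrow>\<^sub>M borel"
    and BMC: "\<And>r (fs :: nat \<Rightarrow> 'a \<times> 'a \<times> 'a \<Rightarrow> real) A.
        (\<And>n. n \<in> gen r \<Longrightarrow> fs n \<in> borel_measurable S3) \<Longrightarrow>
        (\<And>n. n \<in> gen r \<Longrightarrow> bounded (range (fs n))) \<Longrightarrow>
        A \<in> sets (sig_gen M (X ` tree_upto r) borel) \<Longrightarrow>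
        (LINT \<omega>:A|M. (\<Prod>n\<in>gen r. fs n (Delta X n \<omega>)))
          = (LINT \<omega>:A|M. (\<Prod>n\<in>gen r. Pop P (fs n) (X n \<omega>)))"
begin

lemma P_prob: "prob_space (P x)" and sets_P[simp, measurable_cong]: "sets (P x) = sets S2"
  using measurable_space[OF P_kernel, of x] sets_eq_imp_space_eq[of "P x" S2]
  by (auto simp: space_prob_algebra space_pair_measure)

lemma Delta_meas: "i \<ge> 1 \<Longrightarrow> Delta X i \<in> M \<rightarrow>\<^sub>M S3"
  unfolding Delta_def[abs_def] by (intro measurable_Pair X_meas) auto

definition kernel3 :: "'a \<Rightarrow> ('a \<times> 'a \<times> 'a) measure" where
  "kernel3 x = distr (P x) S3 (Pair x)"

lemma kernel3_meas: "kernel3 \<in> borel \<rightarrow>\<^sub>M subprob_algebra S3"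
  unfolding kernel3_def
  by (intro measurable_distr2[OF _ measurable_prob_algebraD[OF P_kernel]]) simp

lemma Pair_meas[measurable]: "Pair x \<in> P x \<rightarrow>\<^sub>M S3"
  by (subst measurable_cong_sets[OF sets_P refl]) simp

lemma section_meas: "f \<in> borel_measurable S3 \<Longrightarrow> (\<lambda>yz. f (x, fst yz, snd yz)) \<in> borel_measurable (P x)"
  using measurable_compose[OF Pair_meas[of x], of f borel] by simp

lemma Pop_kernel3: "f \<in> borel_measurable S3 \<Longrightarrow> Pop P f x = integral\<^sup>L (kernel3 x) f"
  unfolding Pop_def kernel3_def by (subst integral_distr) auto

lemma Pop_meas: "f \<in> borel_measurable S3 \<Longrightarrow> Pop P f \<in> borel_measurable borel"
  using measurable_compose[OF kernel3_meas integral_measurable_subprob_algebra, of f]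
  by (subst measurable_cong[OF Pop_kernel3]) auto

lemma Pop_const: "Pop P (\<lambda>_. c) x = c"
  unfolding Pop_def using prob_space.prob_space[OF P_prob, of x] by simp

lemma BMC_space:
  assumes "\<And>n. n \<in> gen r \<Longrightarrow> fs n \<in> borel_measurable S3"
    and "\<And>n. n \<in> gen r \<Longrightarrow> bounded (range (fs n))"
  shows "expectation (\<lambda>\<omega>. \<Prod>n\<in>gen r. fs n (Delta X n \<omega>)) = expectation (\<lambda>\<omega>. \<Prod>n\<in>gen r. Pop P (fs n) (X n \<omega>))"
proof -
  have sp: "(LINT \<omega>:space M|M. h \<omega>) = expectation h" for h :: "'b \<Rightarrow> real"
    unfolding set_lebesgue_integral_def by (intro Bochner_Integration.integral_cong) auto
  show ?thesis
    using BMC[of r fs "space M", OF assms(1) assms(2) space_in_sig_gen] by (simp add: sp)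
qed

text \<open>Test functions equal to 1 at all other vertices of the generation isolate one triangle,
  since P has total mass one. Identifying the law, and not only the integrals of bounded functions,
  opens the way to unbounded f.\<close>

lemma distr_Delta:
  assumes i: "i \<ge> 1"
  shows "distr M S3 (Delta X i) = distr M borel (X i) \<bind> kernel3"
proof (rule measure_eqI)
  have k: "kernel3 \<in> distr M borel (X i) \<rightarrow>\<^sub>M subprob_algebra S3"
    using kernel3_meas by simp
  have ne: "space (distr M borel (X i)) \<noteq> {}" by simp
  show "sets (distr M S3 (Delta X i)) = sets (distr M borel (X i) \<bind> kernel3)"
    using sets_bind[OF sets_kernel[OF k] ne] by simp
  fix B assume "B \<in> sets (distr M S3 (Delta X i))"
  then have B[measurable]: "B \<in> sets S3" by simp
  obtain r where r: "i \<in> gen r" using ex_gen i by blast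
  define fs where "fs n = (if n = i then indicator B else (\<lambda>_. 1 :: real))" for n
  have m: "fs n \<in> borel_measurable S3" for n by (simp add: fs_def)
  have b: "bounded (range (fs n))" for n
    unfolding bounded_iff by (intro exI[of _ 1]) (auto simp: fs_def indicator_def)
  have "expectation (\<lambda>\<omega>. indicator B (Delta X i \<omega>)) = expectation (\<lambda>\<omega>. \<Prod>n\<in>gen r. fs n (Delta X n \<omega>))"
  proof -
    have "(\<Prod>n\<in>gen r. fs n (Delta X n \<omega>)) = (\<Prod>n\<in>gen r. if n = i then indicator B (Delta X i \<omega>) else 1)" for \<omega>
      by (intro prod.cong) (auto simp: fs_def)
    then show ?thesis using r by (simp add: prod.delta)
  qed
  also have "\<dots> = expectation (\<lambda>\<omega>. \<Prod>n\<in>gen r. Pop P (fs n) (X n \<omega>))"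
    by (rule BMC_space[OF m b])
  also have "\<dots> = expectation (\<lambda>\<omega>. Pop P (indicator B) (X i \<omega>))"
  proof -
    have "(\<Prod>n\<in>gen r. Pop P (fs n) (X n \<omega>)) = (\<Prod>n\<in>gen r. if n = i then Pop P (indicator B) (X i \<omega>) else 1)" for \<omega>
      by (intro prod.cong) (auto simp: fs_def Pop_const)
    then show ?thesis using r by (simp add: prod.delta)
  qed
  finally have e: "expectation (\<lambda>\<omega>. indicator B (Delta X i \<omega>)) = expectation (\<lambda>\<omega>. Pop P (indicator B) (X i \<omega>))" .
  have pr: "prob_space (kernel3 x)" for x
    unfolding kernel3_def by (intro prob_space.prob_space_distr P_prob) simp
  have pop: "Pop P (indicator B) x = measure (kernel3 x) B" for x
    by (subst Pop_kernel3) (auto simp: kernel3_def)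
  have Xi[measurable]: "X i \<in> M \<rightarrow>\<^sub>M borel" by (rule X_meas[OF i])
  have Di[measurable]: "Delta X i \<in> M \<rightarrow>\<^sub>M S3" by (rule Delta_meas[OF i])
  have km: "(\<lambda>x. measure (kernel3 x) B) \<in> borel_measurable borel"
    using Pop_meas[of "indicator B"] by (simp add: pop[abs_def])
  have "emeasure (distr M S3 (Delta X i)) B = ennreal (expectation (\<lambda>\<omega>. indicator B (Delta X i \<omega>)))"
  proof -
    have "expectation (\<lambda>\<omega>. indicator B (Delta X i \<omega>)) = (expectation (indicator (Delta X i -` B \<inter> space M)) :: real)"
      by (intro Bochner_Integration.integral_cong) (auto simp: indicator_def)
    then show ?thesis by (simp add: emeasure_distr emeasure_eq_measure)
  qed
  also have "\<dots> = (\<integral>\<^sup>+\<omega>. ennreal (measure (kernel3 (X i \<omega>)) B) \<partial>M)"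
    unfolding e pop
    by (rule nn_integral_eq_integral[symmetric], rule integrable_const_bound[where B = 1])
      (simp_all add: prob_space.prob_le_1[OF pr] measurable_compose[OF Xi km])
  also have "\<dots> = (\<integral>\<^sup>+\<omega>. emeasure (kernel3 (X i \<omega>)) B \<partial>M)"
    by (simp add: finite_measure.emeasure_eq_measure[OF prob_space.finite_measure[OF pr]])
  also have "\<dots> = (\<integral>\<^sup>+x. emeasure (kernel3 x) B \<partial>distr M borel (X i))"
    by (rule nn_integral_distr[symmetric, OF Xi])
      (simp add: measurable_emeasure_kernel[OF kernel3_meas B])
  also have "\<dots> = emeasure (distr M borel (X i) \<bind> kernel3) B"
    by (rule emeasure_bind[OF ne k B, symmetric])
  finally show "emeasure (distr M S3 (Delta X i)) B = emeasure (distr M borel (X i) \<bind> kernel3) B" .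
qed

lemma nn_integral_Delta:
  assumes i: "i \<ge> 1" and u[measurable]: "u \<in> borel_measurable S3"
  shows "(\<integral>\<^sup>+\<omega>. u (Delta X i \<omega>) \<partial>M) = (\<integral>\<^sup>+\<omega>. (\<integral>\<^sup>+yz. u (X i \<omega>, fst yz, snd yz) \<partial>P (X i \<omega>)) \<partial>M)"
proof -
  have [measurable]: "X i \<in> M \<rightarrow>\<^sub>M borel" by (rule X_meas[OF i])
  have [measurable]: "Delta X i \<in> M \<rightarrow>\<^sub>M S3" by (rule Delta_meas[OF i])
  have "(\<integral>\<^sup>+\<omega>. u (Delta X i \<omega>) \<partial>M) = (\<integral>\<^sup>+t. u t \<partial>distr M S3 (Delta X i))"
    by (simp add: nn_integral_distr)
  also have "\<dots> = (\<integral>\<^sup>+x. \<integral>\<^sup>+t. u t \<partial>kernel3 x \<partial>distr M borel (X i))"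
    unfolding distr_Delta[OF i] using kernel3_meas by (intro nn_integral_bind[of _ S3]) auto
  also have "\<dots> = (\<integral>\<^sup>+\<omega>. \<integral>\<^sup>+t. u t \<partial>kernel3 (X i \<omega>) \<partial>M)"
    by (rule nn_integral_distr[OF X_meas[OF i]])
      (simp add: measurable_compose[OF kernel3_meas nn_integral_measurable_subprob_algebra[OF u]])
  also have "\<dots> = (\<integral>\<^sup>+\<omega>. (\<integral>\<^sup>+yz. u (X i \<omega>, fst yz, snd yz) \<partial>P (X i \<omega>)) \<partial>M)"
    unfolding kernel3_def by (simp add: nn_integral_distr[OF Pair_meas])
  finally show ?thesis .
qed

text \<open>\<open>Pop\<close> is a Bochner integral, so it agrees with the nonnegative integral
  only under \<open>int\<close>; the finiteness in \<open>fin\<close> then passes to the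
  triangle.\<close>

lemma Delta_nonneg:
  assumes i: "i \<ge> 1" and u: "u \<in> borel_measurable S3" "\<And>t. u t \<ge> 0"
    and int: "\<And>x. integrable (P x) (\<lambda>yz. u (x, fst yz, snd yz))"
    and fin: "integrable M (\<lambda>\<omega>. Pop P u (X i \<omega>))"
  shows "integrable M (\<lambda>\<omega>. u (Delta X i \<omega>))"
    and "expectation (\<lambda>\<omega>. u (Delta X i \<omega>)) = expectation (\<lambda>\<omega>. Pop P u (X i \<omega>))"
proof -
  have "(\<integral>\<^sup>+\<omega>. ennreal (u (Delta X i \<omega>)) \<partial>M) = (\<integral>\<^sup>+\<omega>. (\<integral>\<^sup>+yz. ennreal (u (X i \<omega>, fst yz, snd yz)) \<partial>P (X i \<omega>)) \<partial>M)"
    using u by (intro nn_integral_Delta i) auto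
  also have "\<dots> = (\<integral>\<^sup>+\<omega>. ennreal (Pop P u (X i \<omega>)) \<partial>M)"
    unfolding Pop_def by (intro nn_integral_cong nn_integral_eq_integral int) (auto simp: u)
  also have "\<dots> = ennreal (expectation (\<lambda>\<omega>. Pop P u (X i \<omega>)))"
    by (intro nn_integral_eq_integral fin) (auto simp: Pop_def u intro!: integral_nonneg_AE)
  finally have e: "(\<integral>\<^sup>+\<omega>. ennreal (u (Delta X i \<omega>)) \<partial>M) = ennreal (expectation (\<lambda>\<omega>. Pop P u (X i \<omega>)))" .
  have m: "(\<lambda>\<omega>. u (Delta X i \<omega>)) \<in> borel_measurable M"
    using measurable_compose[OF Delta_meas[OF i] u(1)] .
  show int: "integrable M (\<lambda>\<omega>. u (Delta X i \<omega>))"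
    using e m u by (intro integrableI_nonneg) auto
  have "0 \<le> expectation (\<lambda>\<omega>. Pop P u (X i \<omega>))"
    by (intro integral_nonneg_AE AE_I2) (auto simp: Pop_def u intro!: integral_nonneg_AE)
  then show "expectation (\<lambda>\<omega>. u (Delta X i \<omega>)) = expectation (\<lambda>\<omega>. Pop P u (X i \<omega>))"
    using e nn_integral_eq_integral[OF int] u by (simp add: ennreal_inj integral_nonneg_AE)
qed

text \<open>Conditional independence within the generation: for distinct i and j the mixed moment of
  u equals that of \<open>Pop P u\<close>. On the diagonal the second moment of u is added and the
  square of \<open>Pop P u\<close> is kept as a nonnegative surplus. Boundedness is what the Markov
  property asks of its test functions.\<close>

lemma second_moment_bounded:
  fixes u :: "'a \<times> 'a \<times> 'a \<Rightarrow> real"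
  assumes u[measurable]: "u \<in> borel_measurable S3" and B: "\<And>t. \<bar>u t\<bar> \<le> B"
  shows "expectation (\<lambda>\<omega>. (\<Sum>i\<in>gen r. u (Delta X i \<omega>))\<^sup>2) \<le>
    expectation (\<lambda>\<omega>. (\<Sum>i\<in>gen r. Pop P u (X i \<omega>))\<^sup>2) + (\<Sum>i\<in>gen r. expectation (\<lambda>\<omega>. (u (Delta X i \<omega>))\<^sup>2))"
proof -
  have B0: "B \<ge> 0" using B[of undefined] by linarith
  have dm[measurable]: "(\<lambda>\<omega>. u (Delta X i \<omega>)) \<in> borel_measurable M" if "i \<in> gen r" for i
    using measurable_compose[OF Delta_meas u] gen_ge_1[OF that] by blast
  have pm[measurable]: "(\<lambda>\<omega>. Pop P u (X i \<omega>)) \<in> borel_measurable M" if "i \<in> gen r" for i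
    using measurable_compose[OF X_meas Pop_meas[OF u]] gen_ge_1[OF that] by blast
  have PB: "\<bar>Pop P u x\<bar> \<le> B" for x
  proof -
    interpret Px: prob_space "P x" by (rule P_prob)
    have i: "integrable (P x) (\<lambda>yz. u (x, fst yz, snd yz))"
      by (rule Px.integrable_const_bound[where B = B]) (auto simp: B section_meas)
    show ?thesis unfolding Pop_def
      using Px.integral_ge_const[OF i, of "- B"] Px.integral_le_const[OF i, of B] B
      by (auto simp: abs_le_iff minus_le_iff)
  qed
  have iu: "integrable M (\<lambda>\<omega>. u (Delta X i \<omega>) * u (Delta X j \<omega>))" if "i \<in> gen r" "j \<in> gen r" for i j
  proof (rule integrable_const_bound[where B = "B * B"], rule AE_I2)
  qed (simp_all add: abs_mult mult_mono B B0 borel_measurable_times dm that)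
  have ip: "integrable M (\<lambda>\<omega>. Pop P u (X i \<omega>) * Pop P u (X j \<omega>))" if "i \<in> gen r" "j \<in> gen r" for i j
  proof (rule integrable_const_bound[where B = "B * B"], rule AE_I2)
  qed (simp_all add: abs_mult mult_mono PB B0 borel_measurable_times pm that)
  have cross: "expectation (\<lambda>\<omega>. u (Delta X i \<omega>) * u (Delta X j \<omega>)) = expectation (\<lambda>\<omega>. Pop P u (X i \<omega>) * Pop P u (X j \<omega>))"
    if ij: "i \<in> gen r" "j \<in> gen r" "i \<noteq> j" for i j
  proof -
    define fs where "fs n = (if n \<in> {i, j} then u else (\<lambda>_. 1 :: real))" for n
    have m: "fs n \<in> borel_measurable S3" for n by (simp add: fs_def)
    have b: "bounded (range (fs n))" for n
      unfolding bounded_iff by (intro exI[of _ "max B 1"]) (auto simp: fs_def intro: order_trans[OF B])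
    have pr: "(\<Prod>n\<in>gen r. if n \<in> {i, j} then h n else 1) = h i * h j" for h :: "nat \<Rightarrow> real"
      using ij by (subst prod.inter_restrict[symmetric]) (auto simp: Int_absorb1)
    have "(\<Prod>n\<in>gen r. fs n (Delta X n \<omega>)) = u (Delta X i \<omega>) * u (Delta X j \<omega>)" for \<omega>
      by (subst pr[symmetric]) (auto simp: fs_def intro!: prod.cong)
    moreover have "(\<Prod>n\<in>gen r. Pop P (fs n) (X n \<omega>)) = Pop P u (X i \<omega>) * Pop P u (X j \<omega>)" for \<omega>
      by (subst pr[symmetric]) (auto simp: fs_def Pop_const intro!: prod.cong)
    ultimately show ?thesis using BMC_space[of r fs, OF m b] by simp
  qed
  have "expectation (\<lambda>\<omega>. (\<Sum>i\<in>gen r. u (Delta X i \<omega>))\<^sup>2) =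
      (\<Sum>i\<in>gen r. \<Sum>j\<in>gen r. expectation (\<lambda>\<omega>. u (Delta X i \<omega>) * u (Delta X j \<omega>)))"
    using iu by (simp add: power2_eq_square sum_product Bochner_Integration.integral_sum)
  also have "\<dots> \<le> (\<Sum>i\<in>gen r. \<Sum>j\<in>gen r. expectation (\<lambda>\<omega>. Pop P u (X i \<omega>) * Pop P u (X j \<omega>))
      + (if i = j then expectation (\<lambda>\<omega>. (u (Delta X i \<omega>))\<^sup>2) else 0))"
    using cross by (intro sum_mono) (auto simp: power2_eq_square)
  also have "\<dots> = expectation (\<lambda>\<omega>. (\<Sum>i\<in>gen r. Pop P u (X i \<omega>))\<^sup>2) + (\<Sum>i\<in>gen r. expectation (\<lambda>\<omega>. (u (Delta X i \<omega>))\<^sup>2))"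
    using ip by (simp add: power2_eq_square sum_product Bochner_Integration.integral_sum sum.distrib)
  finally show ?thesis .
qed

text \<open>The bounded case is applied to u truncated to [-k, k], and k tends to infinity by
  dominated convergence; the dominating functions are built from u^2 on the left and from
  \<open>Pop P\<close> of u^2 on the right.\<close>

lemma second_moment_step:
  fixes u :: "'a \<times> 'a \<times> 'a \<Rightarrow> real"
  assumes u[measurable]: "u \<in> borel_measurable S3"
    and int: "\<And>x. integrable (P x) (\<lambda>yz. (u (x, fst yz, snd yz))\<^sup>2)"
    and fin: "\<And>i. i \<in> gen r \<Longrightarrow> integrable M (\<lambda>\<omega>. Pop P (\<lambda>t. (u t)\<^sup>2) (X i \<omega>))"
  shows "expectation (\<lambda>\<omega>. (\<Sum>i\<in>gen r. u (Delta X i \<omega>))\<^sup>2) \<le>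
    expectation (\<lambda>\<omega>. (\<Sum>i\<in>gen r. Pop P u (X i \<omega>))\<^sup>2) + (\<Sum>i\<in>gen r. expectation (\<lambda>\<omega>. (u (Delta X i \<omega>))\<^sup>2))"
proof -
  define w where "w k t = max (- real k) (min (real k) (u t))" for k t
  have w[measurable]: "w k \<in> borel_measurable S3" for k unfolding w_def by measurable
  have wk: "\<bar>w k t\<bar> \<le> real k" for k t unfolding w_def by auto
  have wu: "\<bar>w k t\<bar> \<le> \<bar>u t\<bar>" for k t unfolding w_def by auto
  have wu2: "(w k t)\<^sup>2 \<le> (u t)\<^sup>2" for k t using wu by (simp add: abs_le_square_iff)
  have wlim: "(\<lambda>k. w k t) \<longlonglongrightarrow> u t" for t
  proof (rule tendsto_eventually)
    obtain K where K: "real K \<ge> \<bar>u t\<bar>" using real_arch_simple by blast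
    show "\<forall>\<^sub>F k in sequentially. w k t = u t"
      using eventually_ge_at_top[of K] by eventually_elim (use K in \<open>auto simp: w_def\<close>)
  qed
  have dm: "(\<lambda>\<omega>. v (Delta X i \<omega>)) \<in> borel_measurable M" if "i \<in> gen r" "v \<in> borel_measurable S3" for i and v :: "_ \<Rightarrow> real"
    using measurable_compose[OF Delta_meas that(2)] gen_ge_1[OF that(1)] by blast
  have pm: "(\<lambda>\<omega>. Pop P v (X i \<omega>)) \<in> borel_measurable M" if "i \<in> gen r" "v \<in> borel_measurable S3" for i and v :: "_ \<Rightarrow> real"
    using measurable_compose[OF X_meas Pop_meas[OF that(2)]] gen_ge_1[OF that(1)] by blast
  have fu: "integrable M (\<lambda>\<omega>. (u (Delta X i \<omega>))\<^sup>2)" if "i \<in> gen r" for i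
    using gen_ge_1[OF that] by (intro Delta_nonneg(1)[where u = "\<lambda>t. (u t)\<^sup>2"] int fin that) auto
  have sq: "(Pop P (w k) x)\<^sup>2 \<le> Pop P (\<lambda>t. (u t)\<^sup>2) x" for k x
  proof -
    interpret Px: prob_space "P x" by (rule P_prob)
    have i1: "integrable (P x) (\<lambda>yz. w k (x, fst yz, snd yz))"
      by (rule Px.integrable_const_bound[where B = "real k"]) (auto simp: wk section_meas)
    have i2: "integrable (P x) (\<lambda>yz. (w k (x, fst yz, snd yz))\<^sup>2)"
      by (rule Bochner_Integration.integrable_bound[OF int]) (auto simp: wu2 section_meas)
    \<comment> \<open>Jensen's inequality as nonnegativity of a variance.\<close>
    have "(Pop P (w k) x)\<^sup>2 \<le> Px.expectation (\<lambda>yz. (w k (x, fst yz, snd yz))\<^sup>2)"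
      using Px.variance_eq[OF i1 i2] Px.variance_positive[of "\<lambda>yz. w k (x, fst yz, snd yz)"] by (simp add: Pop_def)
    also have "\<dots> \<le> Pop P (\<lambda>t. (u t)\<^sup>2) x"
      unfolding Pop_def by (intro integral_mono i2 int wu2)
    finally show ?thesis .
  qed
  have plim: "(\<lambda>k. Pop P (w k) x) \<longlonglongrightarrow> Pop P u x" for x
    unfolding Pop_def
  proof (rule integral_dominated_convergence)
    interpret Px: prob_space "P x" by (rule P_prob)
    show "integrable (P x) (\<lambda>yz. 1 + (u (x, fst yz, snd yz))\<^sup>2)" using int by simp
    have "\<bar>u t\<bar> \<le> 1 + (u t)\<^sup>2" for t
      using zero_le_power2[of "\<bar>u t\<bar> - 1"] zero_le_power2[of "u t"] by (simp add: power2_diff)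
    then have "\<bar>w k t\<bar> \<le> 1 + (u t)\<^sup>2" for k t using wu order_trans by blast
    then show "AE yz in P x. norm (w k (x, fst yz, snd yz)) \<le> 1 + (u (x, fst yz, snd yz))\<^sup>2" for k
      by simp
  qed (auto simp: section_meas wlim)
  have L: "(\<lambda>k. expectation (\<lambda>\<omega>. (\<Sum>i\<in>gen r. w k (Delta X i \<omega>))\<^sup>2)) \<longlonglongrightarrow> expectation (\<lambda>\<omega>. (\<Sum>i\<in>gen r. u (Delta X i \<omega>))\<^sup>2)"
  proof (rule integral_dominated_convergence)
    show "integrable M (\<lambda>\<omega>. (\<Sum>i\<in>gen r. (u (Delta X i \<omega>))\<^sup>2) * real (card (gen r)))" using fu by auto
    show "AE \<omega> in M. norm ((\<Sum>i\<in>gen r. w k (Delta X i \<omega>))\<^sup>2) \<le> (\<Sum>i\<in>gen r. (u (Delta X i \<omega>))\<^sup>2) * real (card (gen r))" for k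
      by (intro AE_I2) (auto intro!: order_trans[OF sum_squared_le_sum_of_squares] mult_right_mono sum_mono wu2)
  qed (auto intro!: borel_measurable_power borel_measurable_sum dm AE_I2 tendsto_power tendsto_sum wlim)
  have R1: "(\<lambda>k. expectation (\<lambda>\<omega>. (\<Sum>i\<in>gen r. Pop P (w k) (X i \<omega>))\<^sup>2)) \<longlonglongrightarrow> expectation (\<lambda>\<omega>. (\<Sum>i\<in>gen r. Pop P u (X i \<omega>))\<^sup>2)"
  proof (rule integral_dominated_convergence)
    show "integrable M (\<lambda>\<omega>. (\<Sum>i\<in>gen r. Pop P (\<lambda>t. (u t)\<^sup>2) (X i \<omega>)) * real (card (gen r)))" using fin by auto
    show "AE \<omega> in M. norm ((\<Sum>i\<in>gen r. Pop P (w k) (X i \<omega>))\<^sup>2) \<le> (\<Sum>i\<in>gen r. Pop P (\<lambda>t. (u t)\<^sup>2) (X i \<omega>)) * real (card (gen r))" for k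
      by (intro AE_I2) (auto intro!: order_trans[OF sum_squared_le_sum_of_squares] mult_right_mono sum_mono sq)
  qed (auto intro!: borel_measurable_power borel_measurable_sum pm AE_I2 tendsto_power tendsto_sum plim)
  have "(\<Sum>i\<in>gen r. expectation (\<lambda>\<omega>. (w k (Delta X i \<omega>))\<^sup>2)) \<le> (\<Sum>i\<in>gen r. expectation (\<lambda>\<omega>. (u (Delta X i \<omega>))\<^sup>2))" for k
  proof (intro sum_mono integral_mono fu wu2)
    fix i assume i: "i \<in> gen r"
    show "integrable M (\<lambda>\<omega>. (w k (Delta X i \<omega>))\<^sup>2)"
      using i by (intro Bochner_Integration.integrable_bound[OF fu[OF i]]) (auto intro!: borel_measurable_power dm simp: wu2)
  qed
  then have le: "expectation (\<lambda>\<omega>. (\<Sum>i\<in>gen r. w k (Delta X i \<omega>))\<^sup>2) \<le>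
    expectation (\<lambda>\<omega>. (\<Sum>i\<in>gen r. Pop P (w k) (X i \<omega>))\<^sup>2) + (\<Sum>i\<in>gen r. expectation (\<lambda>\<omega>. (u (Delta X i \<omega>))\<^sup>2))" for k
    using second_moment_bounded[OF w wk, of k r] by (meson add_left_mono order_trans)
  show ?thesis
    by (rule LIMSEQ_le[OF L tendsto_add[OF R1 tendsto_const]]) (use le in blast)
qed

end

section \<open>Moments of generation sums under geometric ergodicity\<close>

locale ergodic_chain = bifurcating_chain M X P
  for M :: "'b measure" and X :: "nat \<Rightarrow> 'b \<Rightarrow> 'a::metric_space" and P :: "'a \<Rightarrow> ('a \<times> 'a) measure" +
  fixes \<nu> \<mu> :: "'a measure" and F :: "('a \<Rightarrow> real) set"
  assumes X1_law: "distr M borel (X 1) = \<nu>"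
    and F_meas: "F \<subseteq> borel_measurable borel"
    and F_add: "\<And>g h. g \<in> F \<Longrightarrow> h \<in> F \<Longrightarrow> (\<lambda>x. g x + h x) \<in> F"
    and F_scale: "\<And>c g. g \<in> F \<Longrightarrow> (\<lambda>x. c * g x) \<in> F"
    and F_const: "\<And>c. (\<lambda>_. c) \<in> F"
    and F_sq: "\<And>g. g \<in> F \<Longrightarrow> (\<lambda>x. (g x)^2) \<in> F"
    and F_tens_int: "\<And>x g h. g \<in> F \<Longrightarrow> h \<in> F \<Longrightarrow>
        integrable (P x) (\<lambda>yz. g (fst yz) * h (snd yz))"
    and F_tens: "\<And>g h. g \<in> F \<Longrightarrow> h \<in> F \<Longrightarrow> Ptens P g h \<in> F"
    and F_dom: "\<And>g. g \<in> F \<Longrightarrow> \<exists>h\<in>F. \<forall>r x. \<bar>(Qop P ^^ r) g x\<bar> \<le> h x"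
    and F_nu_int: "\<And>g. g \<in> F \<Longrightarrow> integrable \<nu> g"
    and H1: "\<exists>\<alpha>::real. 0 < \<alpha> \<and> \<alpha> < 1 \<and> (\<forall>g\<in>F. (\<integral>y. g y \<partial>\<mu>) = 0 \<longrightarrow>
        (\<exists>h\<in>F. \<forall>r x. \<bar>(Qop P ^^ r) g x\<bar> \<le> \<alpha>^r * h x))"
begin

lemma F_measD: "g \<in> F \<Longrightarrow> g \<in> borel_measurable borel"
  using F_meas by auto

lemma F_int_fst: "g \<in> F \<Longrightarrow> integrable (P x) (\<lambda>yz. g (fst yz))"
  and F_int_snd: "g \<in> F \<Longrightarrow> integrable (P x) (\<lambda>yz. g (snd yz))"
  using F_tens_int[OF _ F_const[of 1]] F_tens_int[OF F_const[of 1]] by auto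

text \<open>The marginals of P are tensor products with the constant 1, so (i) and (iii) make F
  stable under Q.\<close>

lemma Qop_F: "g \<in> F \<Longrightarrow> Qop P g \<in> F"
proof -
  assume g: "g \<in> F"
  have "Qop P g = (\<lambda>x. (1/2) * (Ptens P g (\<lambda>_. 1) x + Ptens P (\<lambda>_. 1) g x))"
    by (auto simp: Qop_def Ptens_def fun_eq_iff)
  then show ?thesis using g by (simp only: F_scale F_add F_tens F_const)
qed

lemma Qpow_F: "g \<in> F \<Longrightarrow> (Qop P ^^ k) g \<in> F"
  by (induction k) (auto intro: Qop_F)

lemma Qop_nonneg: "(\<And>x. w x \<ge> 0) \<Longrightarrow> Qop P w x \<ge> 0"
  by (auto simp: Qop_def intro!: add_nonneg_nonneg integral_nonneg_AE)

text \<open>Along a single line of descent the two marginal kernels of P alternate in an arbitrary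
  pattern; only the sum over a generation produces powers of Q. The formula is proved with extended
  integrals because integrability is deduced from it.\<close>

lemma nn_first_moment:
  assumes "w \<in> F" "\<And>x. w x \<ge> 0"
  shows "(\<integral>\<^sup>+\<omega>. (\<Sum>i\<in>gen q. ennreal (w (X i \<omega>))) \<partial>M) = 2 ^ q * (\<integral>\<^sup>+x. ennreal ((Qop P ^^ q) w x) \<partial>\<nu>)"
  using assms
proof (induction q arbitrary: w)
  case 0
  have "gen 0 = {1}" by (auto simp: gen_def)
  moreover have "(\<integral>\<^sup>+x. ennreal (w x) \<partial>\<nu>) = (\<integral>\<^sup>+\<omega>. ennreal (w (X 1 \<omega>)) \<partial>M)"
    unfolding X1_law[symmetric]
    by (rule nn_integral_distr[OF X_meas])
      (simp_all add: measurable_compose[OF F_measD[OF 0(1)] measurable_ennreal])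
  ultimately show ?case by simp
next
  case (Suc q)
  note w[measurable] = F_measD[OF Suc(2)]
  have Xm: "(\<lambda>\<omega>. h (X i \<omega>)) \<in> borel_measurable M" if "i \<in> gen q" "h \<in> borel_measurable borel" for i h
    using measurable_compose[OF X_meas that(2)] gen_ge_1[OF that(1)] by blast
  have pw: "(\<integral>\<^sup>+yz. ennreal (w (fst yz)) + ennreal (w (snd yz)) \<partial>P x) = ennreal (2 * Qop P w x)" for x
  proof -
    have "(\<integral>\<^sup>+yz. ennreal (w (fst yz)) + ennreal (w (snd yz)) \<partial>P x) = (\<integral>\<^sup>+yz. ennreal (w (fst yz) + w (snd yz)) \<partial>P x)"
      using Suc(3) by (simp add: ennreal_plus)
    also have "\<dots> = ennreal (\<integral>yz. w (fst yz) + w (snd yz) \<partial>P x)"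
      using Suc(2,3) by (intro nn_integral_eq_integral Bochner_Integration.integrable_add F_int_fst F_int_snd) auto
    also have "(\<integral>yz. w (fst yz) + w (snd yz) \<partial>P x) = 2 * Qop P w x"
      using Suc(2) by (simp add: Qop_def F_int_fst F_int_snd)
    finally show ?thesis .
  qed
  define u where "u t = ennreal (w (fst (snd t))) + ennreal (w (snd (snd t)))" for t :: "'a \<times> 'a \<times> 'a"
  have um: "u \<in> borel_measurable S3"
    unfolding u_def[abs_def] by measurable
  have uD: "ennreal (w (X (2 * i) \<omega>)) + ennreal (w (X (2 * i + 1) \<omega>)) = u (Delta X i \<omega>)" for i \<omega>
    by (simp add: u_def Delta_def)
  have uP: "(\<integral>\<^sup>+yz. u (x, fst yz, snd yz) \<partial>P x) = ennreal (2 * Qop P w x)" for x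
    using pw[of x] by (simp add: u_def)
  have "(\<integral>\<^sup>+\<omega>. (\<Sum>i\<in>gen (Suc q). ennreal (w (X i \<omega>))) \<partial>M)
      = (\<integral>\<^sup>+\<omega>. (\<Sum>i\<in>gen q. ennreal (w (X (2 * i) \<omega>)) + ennreal (w (X (2 * i + 1) \<omega>))) \<partial>M)"
    by (simp only: sum_gen_Suc)
  also have "\<dots> = (\<Sum>i\<in>gen q. \<integral>\<^sup>+\<omega>. ennreal (w (X (2 * i) \<omega>)) + ennreal (w (X (2 * i + 1) \<omega>)) \<partial>M)"
  proof (rule nn_integral_sum)
    fix i assume i: "i \<in> gen q"
    show "(\<lambda>\<omega>. ennreal (w (X (2 * i) \<omega>)) + ennreal (w (X (2 * i + 1) \<omega>))) \<in> borel_measurable M"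
      unfolding uD by (rule measurable_compose[OF Delta_meas[OF gen_ge_1[OF i]] um])
  qed
  also have "\<dots> = (\<Sum>i\<in>gen q. \<integral>\<^sup>+\<omega>. ennreal (2 * Qop P w (X i \<omega>)) \<partial>M)"
  proof (rule sum.cong[OF refl])
    fix i assume i: "i \<in> gen q"
    show "(\<integral>\<^sup>+\<omega>. ennreal (w (X (2 * i) \<omega>)) + ennreal (w (X (2 * i + 1) \<omega>)) \<partial>M) = (\<integral>\<^sup>+\<omega>. ennreal (2 * Qop P w (X i \<omega>)) \<partial>M)"
      unfolding uD nn_integral_Delta[OF gen_ge_1[OF i] um] uP ..
  qed
  also have "\<dots> = (\<Sum>i\<in>gen q. 2 * (\<integral>\<^sup>+\<omega>. ennreal (Qop P w (X i \<omega>)) \<partial>M))"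
    using Qop_nonneg[OF Suc(3)]
    by (intro sum.cong refl, subst nn_integral_cmult[symmetric])
      (auto simp: ennreal_mult intro!: Xm F_measD Qop_F Suc(2) measurable_compose[OF _ measurable_ennreal])
  also have "\<dots> = 2 * (\<integral>\<^sup>+\<omega>. (\<Sum>i\<in>gen q. ennreal (Qop P w (X i \<omega>))) \<partial>M)"
    by (subst nn_integral_sum)
      (auto simp: sum_distrib_left intro!: Xm F_measD Qop_F Suc(2) measurable_compose[OF _ measurable_ennreal])
  also have "\<dots> = 2 ^ Suc q * (\<integral>\<^sup>+x. ennreal ((Qop P ^^ Suc q) w x) \<partial>\<nu>)"
    using Suc(1)[OF Qop_F[OF Suc(2)] Qop_nonneg[OF Suc(3)]] by (simp add: funpow_swap1 mult.assoc)
  finally show ?case .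
qed

text \<open>(v) bounds all powers of Q by one function of F, and (vi) makes that function integrable
  under the initial law. A single vertex inherits integrability because it is dominated by its
  generation.\<close>

lemma first_moment:
  assumes w: "w \<in> F" "\<And>x. w x \<ge> 0"
  shows "i \<ge> 1 \<Longrightarrow> integrable M (\<lambda>\<omega>. w (X i \<omega>))"
    and "\<exists>C\<ge>0. \<forall>q. (\<Sum>i\<in>gen q. expectation (\<lambda>\<omega>. w (X i \<omega>))) \<le> 2 ^ q * C"
proof -
  obtain h where h: "h \<in> F" "\<And>r x. \<bar>(Qop P ^^ r) w x\<bar> \<le> h x" using F_dom[OF w(1)] by blast
  have h0: "h x \<ge> 0" for x using h(2)[of 0 x] by auto
  define C where "C = integral\<^sup>L \<nu> h"
  have C0: "C \<ge> 0" unfolding C_def by (intro integral_nonneg_AE) (simp add: h0)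
  have le: "(\<integral>\<^sup>+\<omega>. (\<Sum>i\<in>gen q. ennreal (w (X i \<omega>))) \<partial>M) \<le> ennreal (2 ^ q * C)" for q
  proof -
    have "(\<integral>\<^sup>+x. ennreal ((Qop P ^^ q) w x) \<partial>\<nu>) \<le> (\<integral>\<^sup>+x. ennreal (h x) \<partial>\<nu>)"
      using h(2)[of q] by (intro nn_integral_mono ennreal_leI) (auto simp: abs_le_iff)
    also have "\<dots> = ennreal C" unfolding C_def
      by (rule nn_integral_eq_integral[OF F_nu_int[OF h(1)]]) (simp add: h0)
    finally show ?thesis unfolding nn_first_moment[OF w]
      using C0 by (simp add: ennreal_mult ennreal_power[symmetric] mult_left_mono)
  qed
  have m: "(\<lambda>\<omega>. w (X i \<omega>)) \<in> borel_measurable M" if "i \<ge> 1" for i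
    using measurable_compose[OF X_meas[OF that] F_measD[OF w(1)]] .
  show int: "integrable M (\<lambda>\<omega>. w (X i \<omega>))" if i: "i \<ge> 1" for i
  proof (rule integrableI_nonneg[OF m[OF i]])
    obtain q where q: "i \<in> gen q" using ex_gen i by blast
    have "(\<integral>\<^sup>+\<omega>. ennreal (w (X i \<omega>)) \<partial>M) \<le> (\<integral>\<^sup>+\<omega>. (\<Sum>i\<in>gen q. ennreal (w (X i \<omega>))) \<partial>M)"
      using q by (intro nn_integral_mono member_le_sum) auto
    also note le[of q]
    finally show "(\<integral>\<^sup>+\<omega>. ennreal (w (X i \<omega>)) \<partial>M) < \<infinity>"
      by (simp add: le_less_trans)
  qed (simp add: w)
  have "(\<Sum>i\<in>gen q. expectation (\<lambda>\<omega>. w (X i \<omega>))) \<le> 2 ^ q * C" for q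
  proof -
    have "ennreal (expectation (\<lambda>\<omega>. \<Sum>i\<in>gen q. w (X i \<omega>))) = (\<integral>\<^sup>+\<omega>. ennreal (\<Sum>i\<in>gen q. w (X i \<omega>)) \<partial>M)"
      using int gen_ge_1 w by (intro nn_integral_eq_integral[symmetric] Bochner_Integration.integrable_sum) (auto intro!: sum_nonneg)
    also have "\<dots> \<le> ennreal (2 ^ q * C)" using le[of q] w by simp
    finally have "expectation (\<lambda>\<omega>. \<Sum>i\<in>gen q. w (X i \<omega>)) \<le> 2 ^ q * C"
      using C0 by (simp add: ennreal_le_iff)
    then show ?thesis using int gen_ge_1 by (subst (asm) Bochner_Integration.integral_sum) auto
  qed
  then show "\<exists>C\<ge>0. \<forall>q. (\<Sum>i\<in>gen q. expectation (\<lambda>\<omega>. w (X i \<omega>))) \<le> 2 ^ q * C" using C0 by blast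
qed

lemma F_square_integrable: "g \<in> F \<Longrightarrow> i \<ge> 1 \<Longrightarrow> integrable M (\<lambda>\<omega>. (g (X i \<omega>))\<^sup>2)"
  using first_moment(1)[OF F_sq] by simp

text \<open>Apply \<open>second_moment_step\<close> to u(x, y, z) = g(y) + g(z), whose image under P
  is 2 Q g; this is where the factor 4 comes from. The factor 2 in front of the diagonal comes from
  (a + b)^2 \<le> 2 (a^2 + b^2).\<close>

lemma second_moment_gen_Suc:
  assumes g: "g \<in> F"
  shows "expectation (\<lambda>\<omega>. (\<Sum>i\<in>gen (Suc q). g (X i \<omega>))\<^sup>2) \<le>
    4 * expectation (\<lambda>\<omega>. (\<Sum>i\<in>gen q. Qop P g (X i \<omega>))\<^sup>2) + 2 * (\<Sum>i\<in>gen (Suc q). expectation (\<lambda>\<omega>. (g (X i \<omega>))\<^sup>2))"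
proof -
  define u where "u t = g (fst (snd t)) + g (snd (snd t))" for t :: "'a \<times> 'a \<times> 'a"
  note [measurable] = F_measD[OF g]
  have um: "u \<in> borel_measurable S3" unfolding u_def by measurable
  have u2: "(u t)\<^sup>2 \<le> 2 * ((g (fst (snd t)))\<^sup>2 + (g (snd (snd t)))\<^sup>2)" for t
    unfolding u_def using zero_le_power2[of "g (fst (snd t)) - g (snd (snd t))"]
    by (simp add: power2_sum power2_diff)
  have u2x: "(u (x, fst yz, snd yz))\<^sup>2 \<le> 2 * ((g (fst yz))\<^sup>2 + (g (snd yz))\<^sup>2)" for x yz
    using u2[of "(x, fst yz, snd yz)"] by simp
  have u2d: "(u (Delta X i \<omega>))\<^sup>2 \<le> 2 * ((g (X (2 * i) \<omega>))\<^sup>2 + (g (X (2 * i + 1) \<omega>))\<^sup>2)" for i \<omega>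
    using u2[of "Delta X i \<omega>"] by (simp add: Delta_def)
  have ig: "integrable (P x) (\<lambda>yz. 2 * ((g (fst yz))\<^sup>2 + (g (snd yz))\<^sup>2))" for x
    using F_int_fst[OF F_sq[OF g]] F_int_snd[OF F_sq[OF g]] by auto
  have iu: "integrable (P x) (\<lambda>yz. (u (x, fst yz, snd yz))\<^sup>2)" for x
  proof (rule Bochner_Integration.integrable_bound[OF ig])
    show "AE yz in P x. norm ((u (x, fst yz, snd yz))\<^sup>2) \<le> norm (2 * ((g (fst yz))\<^sup>2 + (g (snd yz))\<^sup>2))"
      using u2x[of x] by (intro AE_I2) (simp add: abs_mult)
  qed (use section_meas[OF um] in simp)
  have pu2: "Pop P (\<lambda>t. (u t)\<^sup>2) x \<le> 4 * Qop P (\<lambda>x. (g x)\<^sup>2) x" for x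
  proof -
    have "Pop P (\<lambda>t. (u t)\<^sup>2) x \<le> (\<integral>yz. 2 * ((g (fst yz))\<^sup>2 + (g (snd yz))\<^sup>2) \<partial>P x)"
      unfolding Pop_def using u2x[of x] by (intro integral_mono iu ig) simp
    also have "\<dots> = 4 * Qop P (\<lambda>x. (g x)\<^sup>2) x"
      using F_int_fst[OF F_sq[OF g], of x] F_int_snd[OF F_sq[OF g], of x] by (simp add: Qop_def)
    finally show ?thesis .
  qed
  have fin: "integrable M (\<lambda>\<omega>. Pop P (\<lambda>t. (u t)\<^sup>2) (X i \<omega>))" if i: "i \<in> gen q" for i
  proof (rule Bochner_Integration.integrable_bound)
    show "integrable M (\<lambda>\<omega>. 4 * Qop P (\<lambda>x. (g x)\<^sup>2) (X i \<omega>))"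
      using gen_ge_1[OF i] g by (intro integrable_mult_right first_moment(1) Qop_F F_sq Qop_nonneg) auto
    show "(\<lambda>\<omega>. Pop P (\<lambda>t. (u t)\<^sup>2) (X i \<omega>)) \<in> borel_measurable M"
      using um gen_ge_1[OF i] by (intro measurable_compose[OF X_meas Pop_meas]) auto
    have "0 \<le> Pop P (\<lambda>t. (u t)\<^sup>2) x" for x unfolding Pop_def by (intro integral_nonneg_AE) auto
    then show "AE \<omega> in M. norm (Pop P (\<lambda>t. (u t)\<^sup>2) (X i \<omega>)) \<le> norm (4 * Qop P (\<lambda>x. (g x)\<^sup>2) (X i \<omega>))"
      using pu2 by (intro AE_I2) (auto intro: order_trans[OF _ abs_ge_self])
  qed
  have Pu: "Pop P u x = 2 * Qop P g x" for x
    unfolding Pop_def u_def Qop_def using g by (simp add: F_int_fst F_int_snd)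
  have Du: "u (Delta X i \<omega>) = g (X (2 * i) \<omega>) + g (X (2 * i + 1) \<omega>)" for i \<omega>
    by (simp add: u_def Delta_def)
  have "(\<Sum>i\<in>gen q. expectation (\<lambda>\<omega>. (u (Delta X i \<omega>))\<^sup>2)) \<le>
      (\<Sum>i\<in>gen q. 2 * (expectation (\<lambda>\<omega>. (g (X (2 * i) \<omega>))\<^sup>2) + expectation (\<lambda>\<omega>. (g (X (2 * i + 1) \<omega>))\<^sup>2)))"
  proof (rule sum_mono)
    fix i assume i: "i \<in> gen q"
    have i2: "integrable M (\<lambda>\<omega>. (g (X (2 * i) \<omega>))\<^sup>2)" "integrable M (\<lambda>\<omega>. (g (X (2 * i + 1) \<omega>))\<^sup>2)"
      using gen_ge_1[OF i] by (intro F_square_integrable g; simp)+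
    have "expectation (\<lambda>\<omega>. (u (Delta X i \<omega>))\<^sup>2) \<le> expectation (\<lambda>\<omega>. 2 * ((g (X (2 * i) \<omega>))\<^sup>2 + (g (X (2 * i + 1) \<omega>))\<^sup>2))"
      using i2 gen_ge_1[OF i]
      by (intro integral_mono u2d Delta_nonneg(1)[where u = "\<lambda>t. (u t)\<^sup>2"] iu fin[OF i] integrable_mult_right
          Bochner_Integration.integrable_add borel_measurable_power um) auto
    then show "expectation (\<lambda>\<omega>. (u (Delta X i \<omega>))\<^sup>2) \<le>
        2 * (expectation (\<lambda>\<omega>. (g (X (2 * i) \<omega>))\<^sup>2) + expectation (\<lambda>\<omega>. (g (X (2 * i + 1) \<omega>))\<^sup>2))"
      using i2 by simp
  qed
  also have "\<dots> = 2 * (\<Sum>i\<in>gen (Suc q). expectation (\<lambda>\<omega>. (g (X i \<omega>))\<^sup>2))"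
    by (simp only: sum_gen_Suc sum_distrib_left)
  finally have *: "(\<Sum>i\<in>gen q. expectation (\<lambda>\<omega>. (u (Delta X i \<omega>))\<^sup>2)) \<le> 2 * (\<Sum>i\<in>gen (Suc q). expectation (\<lambda>\<omega>. (g (X i \<omega>))\<^sup>2))" .
  have "expectation (\<lambda>\<omega>. (\<Sum>i\<in>gen (Suc q). g (X i \<omega>))\<^sup>2) = expectation (\<lambda>\<omega>. (\<Sum>i\<in>gen q. u (Delta X i \<omega>))\<^sup>2)"
    by (simp only: sum_gen_Suc Du)
  also have "\<dots> \<le> expectation (\<lambda>\<omega>. (\<Sum>i\<in>gen q. Pop P u (X i \<omega>))\<^sup>2) + (\<Sum>i\<in>gen q. expectation (\<lambda>\<omega>. (u (Delta X i \<omega>))\<^sup>2))"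
    by (rule second_moment_step[OF um iu fin])
  also have "expectation (\<lambda>\<omega>. (\<Sum>i\<in>gen q. Pop P u (X i \<omega>))\<^sup>2) = 4 * expectation (\<lambda>\<omega>. (\<Sum>i\<in>gen q. Qop P g (X i \<omega>))\<^sup>2)"
    by (simp add: Pu sum_distrib_left[symmetric] power_mult_distrib)
  finally show ?thesis using * by linarith
qed

text \<open>Each step back by one generation multiplies by 4 and replaces g by Q g, which (H1)
  shrinks, while the diagonal adds order 2^q times the square of the shrinking factor. Compared with
  4^q, the squared size of the generation, the larger of \<alpha>^2 and 1/2 decides the decay. The
  bound \<open>1 / 2 \<le> \<rho>\<close> is recorded so that 2^q can later be absorbed in
  \<open>(4 * \<rho>) ^ q\<close>.\<close>

lemma second_moment_gen:
  assumes g: "g \<in> F" and centred: "(\<integral>y. g y \<partial>\<mu>) = 0"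
  shows "\<exists>C \<rho>. 0 \<le> C \<and> 1 / 2 \<le> \<rho> \<and> \<rho> < 1 \<and>
    (\<forall>q. expectation (\<lambda>\<omega>. (\<Sum>i\<in>gen q. g (X i \<omega>))\<^sup>2) \<le> C * (4 * \<rho>) ^ q)"
proof -
  obtain \<alpha> h where \<alpha>: "0 < \<alpha>" "\<alpha> < 1" and h: "h \<in> F" "\<And>r x. \<bar>(Qop P ^^ r) g x\<bar> \<le> \<alpha> ^ r * h x"
    using H1 g centred by blast
  obtain C where C: "C \<ge> 0" "\<And>q. (\<Sum>i\<in>gen q. expectation (\<lambda>\<omega>. (h (X i \<omega>))\<^sup>2)) \<le> 2 ^ q * C"
    using first_moment(2)[OF F_sq[OF h(1)]] by auto
  have a2: "\<alpha>\<^sup>2 < 1" using \<alpha> by (simp add: power_less_one_iff)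
  \<comment> \<open>Strictly above both rates: at \<alpha>^2 = 1/2 the recursion produces an
    additional factor linear in q.\<close>
  obtain \<rho> where \<rho>: "max (\<alpha>\<^sup>2) (1 / 2) < \<rho>" "\<rho> < 1" using dense[of "max (\<alpha>\<^sup>2) (1/2)" 1] a2 by auto
  \<comment> \<open>D satisfies \<open>\<alpha>\<^sup>2 * D + 1 \<le> \<rho> * D\<close>, the
    inequality that closes the recursion; \<open>D \<ge> 1\<close> serves its start.\<close>
  define D where "D = max 1 (1 / (\<rho> - \<alpha>\<^sup>2))"
  have D: "D \<ge> 1" "D * (\<rho> - \<alpha>\<^sup>2) \<ge> 1"
  proof -
    have "1 / (\<rho> - \<alpha>\<^sup>2) * (\<rho> - \<alpha>\<^sup>2) \<le> D * (\<rho> - \<alpha>\<^sup>2)"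
      using \<rho> by (intro mult_right_mono) (auto simp: D_def)
    then show "D * (\<rho> - \<alpha>\<^sup>2) \<ge> 1" using \<rho> by auto
  qed (simp add: D_def)
  have sq: "(\<Sum>i\<in>gen q. expectation (\<lambda>\<omega>. ((Qop P ^^ k) g (X i \<omega>))\<^sup>2)) \<le> \<alpha> ^ (2 * k) * (2 ^ q * C)" for q k
  proof -
    have "(\<Sum>i\<in>gen q. expectation (\<lambda>\<omega>. ((Qop P ^^ k) g (X i \<omega>))\<^sup>2)) \<le> (\<Sum>i\<in>gen q. expectation (\<lambda>\<omega>. \<alpha> ^ (2 * k) * (h (X i \<omega>))\<^sup>2))"
    proof (intro sum_mono integral_mono F_square_integrable integrable_mult_right Qpow_F g h gen_ge_1)
      fix x
      show "((Qop P ^^ k) g (X i x))\<^sup>2 \<le> \<alpha> ^ (2 * k) * (h (X i x))\<^sup>2" for i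
        using power_mono[OF h(2)[of k "X i x"], of 2] by (simp add: power_mult_distrib power_mult mult.commute[of 2 k])
    qed
    also have "\<dots> = \<alpha> ^ (2 * k) * (\<Sum>i\<in>gen q. expectation (\<lambda>\<omega>. (h (X i \<omega>))\<^sup>2))"
      by (simp add: sum_distrib_left)
    also have "\<dots> \<le> \<alpha> ^ (2 * k) * (2 ^ q * C)" using C \<alpha> by (intro mult_left_mono) auto
    finally show ?thesis .
  qed
  have "expectation (\<lambda>\<omega>. (\<Sum>i\<in>gen q. (Qop P ^^ k) g (X i \<omega>))\<^sup>2) \<le> C * \<alpha> ^ (2 * k) * (D * (4 * \<rho>) ^ q)" for q k
  \<comment> \<open>k must vary, because the step from q to q + 1 uses the bound for the next power
    of Q.\<close>
  proof (induction q arbitrary: k)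
    case 0
    have "gen 0 = {1}" by (auto simp: gen_def)
    then have "expectation (\<lambda>\<omega>. (\<Sum>i\<in>gen 0. (Qop P ^^ k) g (X i \<omega>))\<^sup>2) \<le> C * \<alpha> ^ (2 * k) * 1"
      using sq[of k 0] by (simp add: mult.commute)
    also have "\<dots> \<le> C * \<alpha> ^ (2 * k) * D" using C \<alpha> D by (intro mult_left_mono) auto
    finally show ?case by simp
  next
    case (Suc q)
    have pw: "2 ^ q \<le> (4 * \<rho>) ^ q" using \<rho> by (intro power_mono) auto
    have "4 * 2 ^ q \<le> 4 * ((4 * \<rho>) ^ q * (D * (\<rho> - \<alpha>\<^sup>2)))"
      using mult_mono[OF pw D(2)] \<rho> by auto
    then have key: "4 * \<alpha>\<^sup>2 * (D * (4 * \<rho>) ^ q) + 4 * 2 ^ q \<le> D * (4 * \<rho>) ^ Suc q"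
      by (simp add: algebra_simps)
    have "expectation (\<lambda>\<omega>. (\<Sum>i\<in>gen (Suc q). (Qop P ^^ k) g (X i \<omega>))\<^sup>2) \<le>
        4 * expectation (\<lambda>\<omega>. (\<Sum>i\<in>gen q. (Qop P ^^ Suc k) g (X i \<omega>))\<^sup>2) + 2 * (\<Sum>i\<in>gen (Suc q). expectation (\<lambda>\<omega>. ((Qop P ^^ k) g (X i \<omega>))\<^sup>2))"
      using second_moment_gen_Suc[OF Qpow_F[OF g], of k q] by simp
    also have "\<dots> \<le> 4 * (C * \<alpha> ^ (2 * Suc k) * (D * (4 * \<rho>) ^ q)) + 2 * (\<alpha> ^ (2 * k) * (2 ^ Suc q * C))"
      by (intro add_mono mult_left_mono Suc sq) auto
    also have "\<dots> = C * \<alpha> ^ (2 * k) * (4 * \<alpha>\<^sup>2 * (D * (4 * \<rho>) ^ q) + 4 * 2 ^ q)"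
      by (simp add: power2_eq_square algebra_simps)
    also have "\<dots> \<le> C * \<alpha> ^ (2 * k) * (D * (4 * \<rho>) ^ Suc q)"
      using C \<alpha> by (intro mult_left_mono key) auto
    finally show ?case .
  qed
  from this[of 0] have "expectation (\<lambda>\<omega>. (\<Sum>i\<in>gen q. g (X i \<omega>))\<^sup>2) \<le> C * D * (4 * \<rho>) ^ q" for q
    by (simp add: mult.assoc)
  then show ?thesis using C D \<rho> by (intro exI[of _ "C * D"] exI[of _ \<rho>]) auto
qed

end

section \<open>Uniform permutations of the generations\<close>

lemma finite_tree_upto[simp]: "finite (tree_upto r)"
  by (simp add: tree_upto_def)

lemma gen_subset_tree_upto: "q \<le> r \<Longrightarrow> gen q \<subseteq> tree_upto r"
  by (auto simp: tree_upto_def)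

lemma gen_disjoint: "i \<in> gen q \<Longrightarrow> i \<in> gen q' \<Longrightarrow> q = q'"
proof (induction q q' rule: linorder_wlog)
  case (le q q')
  show ?case
  proof (rule ccontr)
    assume "q \<noteq> q'"
    then have "Suc q \<le> q'" using le by simp
    then have "(2::nat) ^ Suc q \<le> 2 ^ q'" by (rule power_increasing) simp
    then show False using le unfolding gen_def by auto
  qed
qed auto

lemma tree_upto_eq: "tree_upto r = {1..<2 ^ Suc r}"
proof (intro equalityI subsetI)
  fix i assume "i \<in> tree_upto r"
  then obtain q where q: "q \<le> r" "i \<in> gen q" by (auto simp: tree_upto_def)
  have "(2::nat) ^ Suc q \<le> 2 ^ Suc r" using q(1) by (intro power_increasing) auto
  moreover have "i < 2 ^ Suc q" "i \<ge> 1" using q(2) gen_ge_1 by (auto simp: gen_def)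
  ultimately show "i \<in> {1..<2 ^ Suc r}" by (meson atLeastLessThan_iff less_le_trans)
next
  fix i :: nat assume i: "i \<in> {1..<2 ^ Suc r}"
  then obtain q where q: "i \<in> gen q" using ex_gen[of i] by auto
  have "(2::nat) ^ q < 2 ^ Suc r" using q i by (auto simp: gen_def)
  then have "q < Suc r" by (rule power_less_imp_less_exp[rotated]) simp
  then show "i \<in> tree_upto r" using q by (auto simp: tree_upto_def)
qed

text \<open>Extensional functions, so that the set is finite and a permutation restricted to the
  first generations is determined by its values there.\<close>

definition perms :: "nat \<Rightarrow> (nat \<Rightarrow> nat) set" where
  "perms r = {\<sigma> \<in> tree_upto r \<rightarrow>\<^sub>E tree_upto r. \<forall>q\<le>r. bij_betw \<sigma> (gen q) (gen q)}"

lemma finite_perms[simp]: "finite (perms r)"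
  unfolding perms_def by (rule finite_subset[OF _ finite_PiE[of "tree_upto r" "\<lambda>_. tree_upto r"]]) auto

lemma perms_bij: "\<sigma> \<in> perms r \<Longrightarrow> q \<le> r \<Longrightarrow> bij_betw \<sigma> (gen q) (gen q)"
  by (simp add: perms_def)

lemma restrict_in_perms:
  assumes "\<And>q. q \<le> r \<Longrightarrow> bij_betw \<sigma> (gen q) (gen q)"
  shows "restrict \<sigma> (tree_upto r) \<in> perms r"
  unfolding perms_def
proof (intro CollectI conjI allI impI)
  show "restrict \<sigma> (tree_upto r) \<in> tree_upto r \<rightarrow>\<^sub>E tree_upto r"
    using assms bij_betwE by (fastforce simp: tree_upto_def)
  show "bij_betw (restrict \<sigma> (tree_upto r)) (gen q) (gen q)" if "q \<le> r" for q
    using assms[OF that] gen_subset_tree_upto[OF that] by (subst bij_betw_cong[of _ _ \<sigma>]) auto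
qed

definition shuffle :: "nat \<Rightarrow> (nat \<Rightarrow> nat) \<Rightarrow> (nat \<Rightarrow> nat) \<Rightarrow> nat \<Rightarrow> nat" where
  "shuffle r \<tau> \<sigma> = restrict (\<sigma> \<circ> \<tau>) (tree_upto r)"

lemma shuffle_perms:
  assumes \<tau>: "\<And>q. q \<le> r \<Longrightarrow> bij_betw \<tau> (gen q) (gen q)" and \<sigma>: "\<sigma> \<in> perms r"
  shows "shuffle r \<tau> \<sigma> \<in> perms r"
  unfolding shuffle_def by (intro restrict_in_perms bij_betw_trans[OF \<tau> perms_bij[OF \<sigma>]])

lemma transpose_bij_gen:
  assumes "a \<in> gen q" "b \<in> gen q"
  shows "bij_betw (Transposition.transpose a b) (gen q') (gen q')"
proof (cases "q' = q")
  case False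
  then have "a \<notin> gen q'" "b \<notin> gen q'" using assms gen_disjoint by blast+
  then show ?thesis by (subst bij_betw_cong[of _ _ id]) (auto simp: Transposition.transpose_def)
qed (use assms in \<open>simp add: bij_betw_transpose_iff\<close>)

text \<open>Precomposition with a transposition inside a generation is an involution of
  \<open>perms r\<close>. This is the exchangeability of the positions of a generation.\<close>

lemma sum_perms_transpose:
  fixes h :: "nat \<Rightarrow> nat \<Rightarrow> real"
  assumes q: "q \<le> r" and ab: "a \<in> gen q" "b \<in> gen q" and ij: "i \<in> gen q" "j \<in> gen q"
  shows "(\<Sum>\<sigma>\<in>perms r. h (\<sigma> (Transposition.transpose a b i)) (\<sigma> (Transposition.transpose a b j))) = (\<Sum>\<sigma>\<in>perms r. h (\<sigma> i) (\<sigma> j))"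
proof -
  let ?S = "shuffle r (Transposition.transpose a b)"
  have T: "Transposition.transpose a b k \<in> gen p" if "k \<in> gen p" for k p
    using transpose_bij_gen[OF ab, of p] that bij_betwE by blast
  have sub: "gen q \<subseteq> tree_upto r" by (rule gen_subset_tree_upto[OF q])
  have inv: "?S (?S \<sigma>) = \<sigma>" if "\<sigma> \<in> perms r" for \<sigma>
  proof
    fix k
    have "\<sigma> \<in> extensional (tree_upto r)" using that by (auto simp: perms_def PiE_def)
    moreover have "Transposition.transpose a b k \<in> tree_upto r" if "k \<in> tree_upto r"
      using that T by (auto simp: tree_upto_def)
    ultimately show "?S (?S \<sigma>) k = \<sigma> k"
      by (auto simp: shuffle_def restrict_def extensional_def)
  qed
  have mem: "?S \<sigma> \<in> perms r" if "\<sigma> \<in> perms r" for \<sigma>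
    by (rule shuffle_perms[OF transpose_bij_gen[OF ab] that])
  have "(\<Sum>\<sigma>\<in>perms r. h (\<sigma> i) (\<sigma> j)) = (\<Sum>\<sigma>\<in>perms r. h (?S \<sigma> i) (?S \<sigma> j))"
    by (rule sum.reindex_bij_witness[of _ ?S ?S]) (auto simp: inv mem)
  also have "\<dots> = (\<Sum>\<sigma>\<in>perms r. h (\<sigma> (Transposition.transpose a b i)) (\<sigma> (Transposition.transpose a b j)))"
    using sub ij by (intro sum.cong refl) (auto simp: shuffle_def)
  finally show ?thesis by simp
qed

text \<open>By exchangeability the sums of \<open>a (\<sigma> i) * a (\<sigma> j)\<close> over all
  \<sigma> take only two values, d on the diagonal and c off it, so the left side is m d + (m^2 - m)
  c with m the size of J. For the full generation the same expression is computable, since there the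
  inner sum does not depend on \<sigma>.\<close>

lemma sum_perms_square_le:
  fixes a :: "nat \<Rightarrow> real"
  assumes q: "q \<le> r" and J: "J \<subseteq> gen q"
  shows "(\<Sum>\<sigma>\<in>perms r. (\<Sum>j\<in>J. a (\<sigma> j))\<^sup>2) \<le> card (perms r) * ((\<Sum>i\<in>gen q. (a i)\<^sup>2) + (\<Sum>i\<in>gen q. a i)\<^sup>2)"
proof -
  define e where "e i j = (\<Sum>\<sigma>\<in>perms r. a (\<sigma> i) * a (\<sigma> j))" for i j
  have finJ: "finite J" by (rule finite_subset[OF J]) simp
  have diag: "e i i = e i' i'" if "i \<in> gen q" "i' \<in> gen q" for i i'
    using sum_perms_transpose[OF q that that(1) that(1), of "\<lambda>x y. a x * a y"] by (simp add: e_def)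
  have off: "e i j = e i' j'" if ij: "i \<in> gen q" "j \<in> gen q" "i' \<in> gen q" "j' \<in> gen q" "i \<noteq> j" "i' \<noteq> j'" for i j i' j'
  proof -
    \<comment> \<open>Two transpositions carry (i, j) to (i', j'): the first sends i to i' and j to
      \<open>?k\<close>, the second fixes i' and sends \<open>?k\<close> to j'.\<close>
    let ?k = "Transposition.transpose i i' j"
    have k: "?k \<in> gen q" "?k \<noteq> i'" using ij by (auto simp: Transposition.transpose_def)
    have "e i j = e i' ?k"
      using sum_perms_transpose[OF q ij(1,3) ij(1,2), of "\<lambda>x y. a x * a y"] by (simp add: e_def)
    also have "\<dots> = e i' j'"
      using sum_perms_transpose[OF q k(1) ij(4) ij(3) k(1), of "\<lambda>x y. a x * a y"] k ij by (simp add: e_def)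
    finally show ?thesis .
  qed
  obtain d c where dc: "\<And>i j. i \<in> gen q \<Longrightarrow> j \<in> gen q \<Longrightarrow> e i j = (if i = j then d else c)"
  proof -
    have i0: "2 ^ q \<in> gen q" by (simp add: gen_def)
    show thesis
    proof (cases "\<exists>i\<in>gen q. \<exists>j\<in>gen q. i \<noteq> j")
      case True
      then obtain i j where ij: "i \<in> gen q" "j \<in> gen q" "i \<noteq> j" by blast
      show ?thesis
      proof (rule that[of "e (2 ^ q) (2 ^ q)" "e i j"])
        fix k l assume "k \<in> gen q" "l \<in> gen q"
        then show "e k l = (if k = l then e (2 ^ q) (2 ^ q) else e i j)"
          using diag[OF _ i0, of k] off[of k l i j] ij by auto
      qed
    next
      \<comment> \<open>Generation 0 has a single vertex; with no off-diagonal pair the value of c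
        is arbitrary.\<close>
      case False
      show ?thesis
      proof (rule that[of "e (2 ^ q) (2 ^ q)" 0])
        fix i j assume ij: "i \<in> gen q" "j \<in> gen q"
        then have "i = j" using False by blast
        then show "e i j = (if i = j then e (2 ^ q) (2 ^ q) else 0)" using diag[OF ij(1) i0] by simp
      qed
    qed
  qed
  have square: "(\<Sum>\<sigma>\<in>perms r. (\<Sum>j\<in>K. a (\<sigma> j))\<^sup>2) = card K * d + ((real (card K))\<^sup>2 - card K) * c" if K: "K \<subseteq> gen q" for K
  proof -
    have fK: "finite K" by (rule finite_subset[OF K]) simp
    have "(\<Sum>\<sigma>\<in>perms r. (\<Sum>j\<in>K. a (\<sigma> j))\<^sup>2) = (\<Sum>\<sigma>\<in>perms r. \<Sum>i\<in>K. \<Sum>j\<in>K. a (\<sigma> i) * a (\<sigma> j))"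
      by (simp add: power2_eq_square sum_product)
    also have "\<dots> = (\<Sum>i\<in>K. \<Sum>\<sigma>\<in>perms r. \<Sum>j\<in>K. a (\<sigma> i) * a (\<sigma> j))" by (rule sum.swap)
    also have "\<dots> = (\<Sum>i\<in>K. \<Sum>j\<in>K. e i j)"
      unfolding e_def by (intro sum.cong refl) (rule sum.swap)
    also have "\<dots> = (\<Sum>i\<in>K. \<Sum>j\<in>K. (if i = j then d - c else 0) + c)"
      using K dc by (intro sum.cong refl) (auto simp: subset_iff)
    also have "\<dots> = card K * d + ((real (card K))\<^sup>2 - card K) * c"
      using fK by (simp add: sum.distrib power2_eq_square algebra_simps)
    finally show ?thesis .
  qed
  have diagsum: "(\<Sum>\<sigma>\<in>perms r. \<Sum>i\<in>gen q. (a (\<sigma> i))\<^sup>2) = card (gen q) * d"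
  proof -
    have "(\<Sum>\<sigma>\<in>perms r. \<Sum>i\<in>gen q. (a (\<sigma> i))\<^sup>2) = (\<Sum>i\<in>gen q. e i i)"
      unfolding e_def power2_eq_square by (rule sum.swap)
    also have "\<dots> = card (gen q) * d" using dc by simp
    finally show ?thesis .
  qed
  have reindex: "(\<Sum>i\<in>gen q. h (\<sigma> i)) = (\<Sum>i\<in>gen q. h i)" if "\<sigma> \<in> perms r" for \<sigma> and h :: "nat \<Rightarrow> real"
    by (rule sum.reindex_bij_betw[OF perms_bij[OF that q]])
  let ?m = "real (card J)" and ?N = "real (card (gen q))"
  have A: "card (perms r) * (\<Sum>i\<in>gen q. (a i)\<^sup>2) = ?N * d"
    unfolding diagsum[symmetric] using reindex[of _ "\<lambda>i. (a i)\<^sup>2"] by simp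
  have T: "card (perms r) * (\<Sum>i\<in>gen q. a i)\<^sup>2 = ?N * d + (?N\<^sup>2 - ?N) * c"
    unfolding square[OF subset_refl, symmetric] using reindex[of _ a] by simp
  have d0: "d \<ge> 0"
  proof -
    have "0 \<le> e (2 ^ q) (2 ^ q)" unfolding e_def by (intro sum_nonneg) auto
    then show ?thesis using dc[of "2 ^ q" "2 ^ q"] by (simp add: gen_def)
  qed
  have mN: "?m \<le> ?N" using J by (simp add: card_mono)
  have md: "?m * d \<le> ?N * d" by (rule mult_right_mono[OF mN d0])
  have m2: "0 \<le> ?m\<^sup>2 - ?m" by (cases "card J") (auto simp: power2_eq_square)
  have m2N: "?m\<^sup>2 - ?m \<le> ?N\<^sup>2 - ?N"
  proof (cases "card J = 0")
    case True
    then show ?thesis by (cases "card (gen q)") (auto simp: power2_eq_square)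
  next
    case False
    then have "?m * (?m - 1) \<le> ?N * (?N - 1)" using mN by (intro mult_mono) auto
    then show ?thesis by (simp add: power2_eq_square algebra_simps)
  qed
  have T0: "0 \<le> card (perms r) * (\<Sum>i\<in>gen q. a i)\<^sup>2" by simp
  have Nd: "0 \<le> ?N * d" using d0 by simp
  have "?m * d + (?m\<^sup>2 - ?m) * c \<le> ?N * d + (card (perms r) * (\<Sum>i\<in>gen q. a i)\<^sup>2)"
  \<comment> \<open>For c \<ge> 0 the expression grows with m up to the full generation; for c < 0
    the off-diagonal part only helps and is dropped.\<close>
  proof (cases "c \<ge> 0")
    case True
    then have "(?m\<^sup>2 - ?m) * c \<le> (?N\<^sup>2 - ?N) * c" by (rule mult_right_mono[OF m2N])
    then show ?thesis unfolding T using md Nd by linarith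
  next
    case False
    then have "(?m\<^sup>2 - ?m) * c \<le> 0" using m2 by (simp add: mult_nonneg_nonpos)
    then show ?thesis using md T0 by linarith
  qed
  then show ?thesis unfolding square[OF J] using A by (simp add: distrib_left)
qed

section \<open>Independence of permutation and chain\<close>

locale permuted_chain = bifurcating_chain M X P
  for M :: "'b measure" and X :: "nat \<Rightarrow> 'b \<Rightarrow> 'a::metric_space" and P :: "'a \<Rightarrow> ('a \<times> 'a) measure" +
  fixes Pi :: "'b \<Rightarrow> nat \<Rightarrow> nat"
  assumes Pi_perm: "\<And>\<omega> r. \<omega> \<in> space M \<Longrightarrow> bij_betw (Pi \<omega>) (gen r) (gen r)"
    and Pi_meas: "\<And>i j. {\<omega> \<in> space M. Pi \<omega> i = j} \<in> sets M"
    and Pi_law: "\<And>r \<sigma> E. (\<And>q. q \<le> r \<Longrightarrow> bij_betw \<sigma> (gen q) (gen q)) \<Longrightarrow>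
        E \<in> sets (sig_gen M (X ` {1..}) borel) \<Longrightarrow>
        measure M ({\<omega> \<in> space M. \<forall>i\<in>tree_upto r. Pi \<omega> i = \<sigma> i} \<inter> E)
          = measure M E / (\<Prod>q\<le>r. fact (2^q))"
begin

definition sigma_X :: "'b measure" where
  "sigma_X = sig_gen M (X ` {1..}) borel"

text \<open>Takes values in the finite set \<open>perms r\<close>, which turns averaging over the
  permutation into a finite sum.\<close>

definition permuted :: "nat \<Rightarrow> 'b \<Rightarrow> nat \<Rightarrow> nat" where
  "permuted r \<omega> = restrict (Pi \<omega>) (tree_upto r)"

lemma permuted_perms: "\<omega> \<in> space M \<Longrightarrow> permuted r \<omega> \<in> perms r"
  unfolding permuted_def by (intro restrict_in_perms Pi_perm)

lemma permuted_eq: "i \<in> tree_upto r \<Longrightarrow> permuted r \<omega> i = Pi \<omega> i"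
  by (simp add: permuted_def)

lemma Pi_ge_1: "\<omega> \<in> space M \<Longrightarrow> i \<ge> 1 \<Longrightarrow> Pi \<omega> i \<ge> 1"
  using ex_gen[of i] Pi_perm[of \<omega>] gen_ge_1 bij_betwE by blast

lemma subalgebra_sigma_X: "subalgebra M sigma_X"
  unfolding sigma_X_def
proof (rule subalgebra_sig_gen)
  fix Y assume "Y \<in> X ` {1..}"
  then obtain i where "i \<ge> 1" "Y = X i" by auto
  then show "Y \<in> M \<rightarrow>\<^sub>M borel" using X_meas by blast
qed

lemma X_sigma_X: "i \<ge> 1 \<Longrightarrow> X i \<in> sigma_X \<rightarrow>\<^sub>M borel"
  unfolding sigma_X_def by (rule measurable_sig_gen) simp_all

lemma permuted_eq_iff: "\<sigma> \<in> perms r \<Longrightarrow> permuted r \<omega> = \<sigma> \<longleftrightarrow> (\<forall>i\<in>tree_upto r. Pi \<omega> i = \<sigma> i)"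
  by (auto simp: permuted_def perms_def fun_eq_iff restrict_def PiE_def extensional_def)

lemma permuted_event: "{\<omega> \<in> space M. permuted r \<omega> = \<sigma>} \<in> sets M" if "\<sigma> \<in> perms r"
proof -
  have "{\<omega> \<in> space M. \<forall>i\<in>tree_upto r. Pi \<omega> i = \<sigma> i} \<in> sets M"
    by (intro sets.sets_Collect_finite_All Pi_meas) simp
  then show ?thesis by (simp add: permuted_eq_iff[OF that])
qed

lemma permuted_independent:
  assumes \<sigma>: "\<sigma> \<in> perms r" and E: "E \<in> sets sigma_X"
  shows "emeasure M ({\<omega> \<in> space M. permuted r \<omega> = \<sigma>} \<inter> E) = ennreal (1 / (\<Prod>q\<le>r. fact (2^q))) * emeasure M E"
  using Pi_law[OF perms_bij[OF \<sigma>] E[unfolded sigma_X_def]]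
  by (simp add: permuted_eq_iff[OF \<sigma>] emeasure_eq_measure ennreal_mult''[symmetric] prod_nonneg)

text \<open>No counting: the events \<open>permuted r \<omega> = \<sigma>\<close> partition the
  space, and the law of the permutation gives each the mass 1 / (product of factorials).\<close>

lemma card_perms: "real (card (perms r)) = (\<Prod>q\<le>r. fact (2^q))"
proof -
  let ?N = "(\<Prod>q\<le>r. fact (2^q)) :: real"
  have N: "?N > 0" by (simp add: prod_pos)
  have "(\<Union>\<sigma>\<in>perms r. {\<omega> \<in> space M. permuted r \<omega> = \<sigma>}) = space M"
    using permuted_perms by auto
  then have "1 = prob (\<Union>\<sigma>\<in>perms r. {\<omega> \<in> space M. permuted r \<omega> = \<sigma>})"
    by (simp add: prob_space)
  also have "\<dots> = (\<Sum>\<sigma>\<in>perms r. prob {\<omega> \<in> space M. permuted r \<omega> = \<sigma>})"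
    by (intro finite_measure_finite_Union) (auto simp: permuted_event disjoint_family_on_def)
  also have "\<dots> = (\<Sum>\<sigma>\<in>perms r. 1 / ?N)"
  proof (rule sum.cong[OF refl])
    fix \<sigma> assume \<sigma>: "\<sigma> \<in> perms r"
    show "prob {\<omega> \<in> space M. permuted r \<omega> = \<sigma>} = 1 / ?N"
      using Pi_law[OF perms_bij[OF \<sigma>] space_in_sig_gen, of r]
      by (simp add: permuted_eq_iff[OF \<sigma>] prob_space Int_absorb2)
  qed
  finally show ?thesis using N by (simp add: field_simps)
qed

text \<open>Freezing of the independent permutation. On the event of a given \<sigma>, the measure
  restricted to \<open>sigma_X\<close> is a multiple of the original one, so nonnegative integrals
  of functions measurable for \<open>sigma_X\<close> scale by that multiple.\<close>

lemma nn_integral_permuted: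
  fixes G :: "(nat \<Rightarrow> nat) \<Rightarrow> 'b \<Rightarrow> ennreal"
  assumes G: "\<And>\<sigma>. \<sigma> \<in> perms r \<Longrightarrow> G \<sigma> \<in> borel_measurable sigma_X"
  shows "(\<integral>\<^sup>+\<omega>. G (permuted r \<omega>) \<omega> \<partial>M) = ennreal (1 / card (perms r)) * (\<Sum>\<sigma>\<in>perms r. \<integral>\<^sup>+\<omega>. G \<sigma> \<omega> \<partial>M)"
proof -
  have one: "(\<integral>\<^sup>+\<omega>. indicator {\<omega> \<in> space M. permuted r \<omega> = \<sigma>} \<omega> * G \<sigma> \<omega> \<partial>M) = ennreal (1 / card (perms r)) * (\<integral>\<^sup>+\<omega>. G \<sigma> \<omega> \<partial>M)"
    if \<sigma>: "\<sigma> \<in> perms r" for \<sigma>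
  proof -
    let ?A = "{\<omega> \<in> space M. permuted r \<omega> = \<sigma>}"
    note A = permuted_event[OF \<sigma>]
    let ?D = "density M (indicator ?A)"
    have subD: "subalgebra ?D sigma_X" using subalgebra_sigma_X by (simp add: subalgebra_def)
    have eq: "restr_to_subalg ?D sigma_X = scale_measure (ennreal (1 / card (perms r))) (restr_to_subalg M sigma_X)"
    proof (rule measure_eqI)
      show "sets (restr_to_subalg ?D sigma_X) = sets (scale_measure (ennreal (1 / card (perms r))) (restr_to_subalg M sigma_X))"
        by (simp add: sets_restr_to_subalg[OF subD] sets_restr_to_subalg[OF subalgebra_sigma_X])
      fix E assume "E \<in> sets (restr_to_subalg ?D sigma_X)"
      then have E: "E \<in> sets sigma_X" by (simp add: sets_restr_to_subalg[OF subD])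
      then have EM: "E \<in> sets M" using subalgebra_sigma_X by (auto simp: subalgebra_def)
      have "emeasure (restr_to_subalg ?D sigma_X) E = (\<integral>\<^sup>+\<omega>. indicator (?A \<inter> E) \<omega> \<partial>M)"
        unfolding emeasure_restr_to_subalg[OF subD E] indicator_inter_arith
        by (rule emeasure_density) (use A EM in simp_all)
      also have "\<dots> = emeasure M (?A \<inter> E)"
        by (rule nn_integral_indicator) (use A EM in simp)
      also have "\<dots> = ennreal (1 / card (perms r)) * emeasure M E"
        unfolding card_perms by (rule permuted_independent[OF \<sigma> E])
      finally show "emeasure (restr_to_subalg ?D sigma_X) E = emeasure (scale_measure (ennreal (1 / card (perms r))) (restr_to_subalg M sigma_X)) E"
        by (simp add: emeasure_restr_to_subalg[OF subalgebra_sigma_X E])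
    qed
    have GM: "G \<sigma> \<in> borel_measurable M" using measurable_from_subalg[OF subalgebra_sigma_X G[OF \<sigma>]] .
    have "(\<integral>\<^sup>+\<omega>. indicator ?A \<omega> * G \<sigma> \<omega> \<partial>M) = (\<integral>\<^sup>+\<omega>. G \<sigma> \<omega> \<partial>?D)"
      using A GM by (simp add: nn_integral_density)
    also have "\<dots> = (\<integral>\<^sup>+\<omega>. G \<sigma> \<omega> \<partial>restr_to_subalg ?D sigma_X)"
      by (rule nn_integral_subalgebra2[OF subD G[OF \<sigma>], symmetric])
    also have "\<dots> = ennreal (1 / card (perms r)) * (\<integral>\<^sup>+\<omega>. G \<sigma> \<omega> \<partial>restr_to_subalg M sigma_X)"
      unfolding eq by (rule nn_integral_scale_measure) (simp add: measurable_in_subalg[OF subalgebra_sigma_X G[OF \<sigma>]])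
    also have "(\<integral>\<^sup>+\<omega>. G \<sigma> \<omega> \<partial>restr_to_subalg M sigma_X) = (\<integral>\<^sup>+\<omega>. G \<sigma> \<omega> \<partial>M)"
      by (rule nn_integral_subalgebra2[OF subalgebra_sigma_X G[OF \<sigma>]])
    finally show ?thesis .
  qed
  have "(\<integral>\<^sup>+\<omega>. G (permuted r \<omega>) \<omega> \<partial>M) = (\<integral>\<^sup>+\<omega>. (\<Sum>\<sigma>\<in>perms r. indicator {\<omega> \<in> space M. permuted r \<omega> = \<sigma>} \<omega> * G \<sigma> \<omega>) \<partial>M)"
  proof (rule nn_integral_cong)
    fix \<omega> assume w: "\<omega> \<in> space M"
    have "(\<Sum>\<sigma>\<in>perms r. indicator {\<omega> \<in> space M. permuted r \<omega> = \<sigma>} \<omega> * G \<sigma> \<omega>) = (\<Sum>\<sigma>\<in>perms r. if permuted r \<omega> = \<sigma> then G \<sigma> \<omega> else 0)"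
      using w by (intro sum.cong) auto
    then show "G (permuted r \<omega>) \<omega> = (\<Sum>\<sigma>\<in>perms r. indicator {\<omega> \<in> space M. permuted r \<omega> = \<sigma>} \<omega> * G \<sigma> \<omega>)"
      using permuted_perms[OF w] by simp
  qed
  also have "\<dots> = (\<Sum>\<sigma>\<in>perms r. \<integral>\<^sup>+\<omega>. indicator {\<omega> \<in> space M. permuted r \<omega> = \<sigma>} \<omega> * G \<sigma> \<omega> \<partial>M)"
    using permuted_event measurable_from_subalg[OF subalgebra_sigma_X G]
    by (intro nn_integral_sum borel_measurable_times_ennreal borel_measurable_indicator) auto
  finally show ?thesis using one by (simp add: sum_distrib_left)
qed

text \<open>J may be part of a generation, while the bound involves the whole generation only, where
  the second moments of the chain are known.\<close>

lemma permuted_second_moment: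
  assumes g[measurable]: "g \<in> borel_measurable borel" and q: "q \<le> r" and J: "J \<subseteq> gen q"
    and int: "\<And>i. i \<in> gen q \<Longrightarrow> integrable M (\<lambda>\<omega>. (g (X i \<omega>))\<^sup>2)"
  shows "(\<integral>\<^sup>+\<omega>. ennreal ((\<Sum>j\<in>J. g (X (Pi \<omega> j) \<omega>))\<^sup>2) \<partial>M) \<le>
    ennreal ((\<Sum>i\<in>gen q. expectation (\<lambda>\<omega>. (g (X i \<omega>))\<^sup>2)) + expectation (\<lambda>\<omega>. (\<Sum>i\<in>gen q. g (X i \<omega>))\<^sup>2))"
proof -
  have gXm: "(\<lambda>\<omega>. g (X i \<omega>)) \<in> borel_measurable sigma_X" if "i \<in> gen q" for i
    using measurable_compose[OF X_sigma_X g] gen_ge_1[OF that] by blast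
  have gXM: "(\<lambda>\<omega>. g (X i \<omega>)) \<in> borel_measurable M" if "i \<in> gen q" for i
    using measurable_compose[OF X_meas g] gen_ge_1[OF that] by blast
  define G where "G \<sigma> \<omega> = ennreal ((\<Sum>j\<in>J. g (X (\<sigma> j) \<omega>))\<^sup>2)" for \<sigma> \<omega>
  have s: "\<sigma> j \<in> gen q" if "\<sigma> \<in> perms r" "j \<in> J" for \<sigma> j
    using perms_bij[OF that(1) q] that(2) J bij_betwE by blast
  have Gm: "G \<sigma> \<in> borel_measurable sigma_X" if "\<sigma> \<in> perms r" for \<sigma>
    unfolding G_def
    by (rule measurable_compose[OF _ measurable_ennreal], intro borel_measurable_power borel_measurable_sum gXm s[OF that])
  let ?S = "\<lambda>\<omega>. (\<Sum>i\<in>gen q. (g (X i \<omega>))\<^sup>2) + (\<Sum>i\<in>gen q. g (X i \<omega>))\<^sup>2"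
  have intT: "integrable M (\<lambda>\<omega>. (\<Sum>i\<in>gen q. g (X i \<omega>))\<^sup>2)"
  proof (rule Bochner_Integration.integrable_bound)
    show "integrable M (\<lambda>\<omega>. (\<Sum>i\<in>gen q. (g (X i \<omega>))\<^sup>2) * real (card (gen q)))" using int by auto
    show "AE \<omega> in M. norm ((\<Sum>i\<in>gen q. g (X i \<omega>))\<^sup>2) \<le> norm ((\<Sum>i\<in>gen q. (g (X i \<omega>))\<^sup>2) * real (card (gen q)))"
      by (intro AE_I2) (auto intro!: order_trans[OF sum_squared_le_sum_of_squares] simp: abs_mult sum_nonneg)
  qed (intro borel_measurable_power borel_measurable_sum gXM)
  have intS: "integrable M ?S" using intT int by auto
  have S0: "?S \<omega> \<ge> 0" for \<omega> by (simp add: sum_nonneg)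
  have "(\<integral>\<^sup>+\<omega>. ennreal ((\<Sum>j\<in>J. g (X (Pi \<omega> j) \<omega>))\<^sup>2) \<partial>M) = (\<integral>\<^sup>+\<omega>. G (permuted r \<omega>) \<omega> \<partial>M)"
  proof -
    have "(\<Sum>j\<in>J. g (X (permuted r \<omega> j) \<omega>)) = (\<Sum>j\<in>J. g (X (Pi \<omega> j) \<omega>))" for \<omega>
      using J gen_subset_tree_upto[OF q] by (intro sum.cong) (auto simp: permuted_eq)
    then show ?thesis by (simp add: G_def)
  qed
  also have "\<dots> = ennreal (1 / card (perms r)) * (\<Sum>\<sigma>\<in>perms r. \<integral>\<^sup>+\<omega>. G \<sigma> \<omega> \<partial>M)"
    by (rule nn_integral_permuted[OF Gm])
  also have "(\<Sum>\<sigma>\<in>perms r. \<integral>\<^sup>+\<omega>. G \<sigma> \<omega> \<partial>M) = (\<integral>\<^sup>+\<omega>. (\<Sum>\<sigma>\<in>perms r. G \<sigma> \<omega>) \<partial>M)"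
    using measurable_from_subalg[OF subalgebra_sigma_X Gm] by (subst nn_integral_sum) auto
  also have "\<dots> \<le> (\<integral>\<^sup>+\<omega>. ennreal (card (perms r) * ?S \<omega>) \<partial>M)"
  proof (rule nn_integral_mono)
    fix \<omega>
    have "(\<Sum>\<sigma>\<in>perms r. G \<sigma> \<omega>) = ennreal (\<Sum>\<sigma>\<in>perms r. (\<Sum>j\<in>J. g (X (\<sigma> j) \<omega>))\<^sup>2)"
      unfolding G_def by (rule sum_ennreal) simp
    also have "\<dots> \<le> ennreal (card (perms r) * ?S \<omega>)"
      by (intro ennreal_leI sum_perms_square_le[OF q J, of "\<lambda>i. g (X i \<omega>)"])
    finally show "(\<Sum>\<sigma>\<in>perms r. G \<sigma> \<omega>) \<le> ennreal (card (perms r) * ?S \<omega>)" .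
  qed
  also have "\<dots> = ennreal (card (perms r) * expectation ?S)"
    using intS S0 by (subst nn_integral_eq_integral) auto
  finally have "(\<integral>\<^sup>+\<omega>. ennreal ((\<Sum>j\<in>J. g (X (Pi \<omega> j) \<omega>))\<^sup>2) \<partial>M) \<le> ennreal (1 / card (perms r)) * ennreal (card (perms r) * expectation ?S)"
    by (simp add: mult_left_mono)
  also have "\<dots> = ennreal (expectation ?S)"
  proof -
    have "real (card (perms r)) > 0" unfolding card_perms by (simp add: prod_pos)
    then show ?thesis using S0 by (subst ennreal_mult[symmetric]) (auto intro!: integral_nonneg_AE)
  qed
  also have "expectation ?S = (\<Sum>i\<in>gen q. expectation (\<lambda>\<omega>. (g (X i \<omega>))\<^sup>2)) + expectation (\<lambda>\<omega>. (\<Sum>i\<in>gen q. g (X i \<omega>))\<^sup>2)"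
    using intT int by simp
  finally show ?thesis .
qed

end

section \<open>Exponential tilting\<close>

lemma exp_quadratic_error:
  fixes u a :: real
  assumes "\<bar>u\<bar> \<le> a"
  shows "\<bar>exp u - 1 - u - u\<^sup>2 / 2\<bar> \<le> exp a * \<bar>u\<bar> ^ 3"
proof -
  obtain z where z: "\<bar>z\<bar> \<le> \<bar>u\<bar>" "exp u = (\<Sum>m<3. u ^ m / fact m) + exp z / fact 3 * u ^ 3"
    using Maclaurin_exp_le[of u 3] by blast
  have "exp u - 1 - u - u\<^sup>2 / 2 = exp z / 6 * u ^ 3"
    using z(2) by (simp add: eval_nat_numeral)
  then have "\<bar>exp u - 1 - u - u\<^sup>2 / 2\<bar> = \<bar>exp z / 6 * u ^ 3\<bar>" by (simp only:)
  also have "\<dots> = exp z / 6 * \<bar>u\<bar> ^ 3" by (simp add: abs_mult power_abs)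
  also have "\<dots> \<le> exp a * \<bar>u\<bar> ^ 3"
  proof (rule mult_right_mono)
    have "exp z \<le> exp a" using z(1) assms by auto
    then show "exp z / 6 \<le> exp a" using exp_ge_zero[of z] by linarith
  qed simp
  finally show ?thesis .
qed

text \<open>From ln x \<le> x - 1 at y and at 1/y: the two bounds on ln y differ by exactly (y -
  1)^2 / y.\<close>

lemma ln_minus_linear_error:
  fixes y c :: real
  assumes "0 < c" "c \<le> y"
  shows "\<bar>ln y - (y - 1)\<bar> \<le> (y - 1)\<^sup>2 / c"
proof -
  have y: "y > 0" using assms by linarith
  have "ln y \<le> y - 1" by (rule ln_le_minus_one[OF y])
  moreover have "ln (1 / y) \<le> 1 / y - 1" using y by (intro ln_le_minus_one) simp
  then have "1 - 1 / y \<le> ln y" using y by (simp add: ln_div)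
  moreover have "y - 1 - (1 - 1 / y) = (y - 1)\<^sup>2 / y"
    using y by (simp add: field_simps power2_eq_square)
  ultimately have "\<bar>ln y - (y - 1)\<bar> \<le> (y - 1)\<^sup>2 / y" by linarith
  also have "\<dots> \<le> (y - 1)\<^sup>2 / c" using assms by (intro divide_left_mono) auto
  finally show ?thesis .
qed

text \<open>Large values are replaced by 0. The level is the inverse of the scale, so that
  \<open>t * clip t z\<close> is at most 1 in modulus; for t = b_n / n the level is n / b_n.\<close>

definition clip :: "real \<Rightarrow> real \<Rightarrow> real" where
  "clip t z = (if \<bar>z\<bar> \<le> 1 / t then z else 0)"

lemma clip_meas[measurable]: "clip t \<in> borel_measurable borel"
  unfolding clip_def[abs_def] by measurable

lemma clip_bound:
  assumes t: "t > 0"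
  shows "\<bar>l * t * clip t z\<bar> \<le> \<bar>l\<bar>"
proof -
  have "t * \<bar>clip t z\<bar> \<le> 1" using t by (auto simp: clip_def field_simps)
  then have "\<bar>l\<bar> * (t * \<bar>clip t z\<bar>) \<le> \<bar>l\<bar> * 1" by (intro mult_left_mono) auto
  then show ?thesis using t by (simp add: abs_mult mult.assoc)
qed

text \<open>The expansion is in the untruncated z, so that after integration the linear term
  vanishes and the quadratic one is exact. Below the level the cubic Taylor error is bounded by z^2
  + z^4; above it t |z| \<ge> 1, so lower powers of t |z| are at most its fourth power.\<close>

lemma clip_exp_error:
  fixes l t z :: real
  assumes t: "0 < t" "t \<le> 1"
  shows "\<bar>exp (l * t * clip t z) - 1 - l * t * z - l\<^sup>2 * t\<^sup>2 / 2 * z\<^sup>2\<bar>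
    \<le> (exp \<bar>l\<bar> * \<bar>l\<bar> ^ 3 + \<bar>l\<bar> + l\<^sup>2) * (t ^ 3 * (z\<^sup>2 + z ^ 4))"
proof -
  let ?T = "t ^ 3 * (z\<^sup>2 + z ^ 4)"
  have T0: "0 \<le> ?T" using t by simp
  have nonneg: "0 \<le> exp \<bar>l\<bar> * \<bar>l\<bar> ^ 3 * ?T" "0 \<le> \<bar>l\<bar> * ?T" "0 \<le> l\<^sup>2 * ?T" using T0 by simp_all
  have split: "(exp \<bar>l\<bar> * \<bar>l\<bar> ^ 3 + \<bar>l\<bar> + l\<^sup>2) * ?T = exp \<bar>l\<bar> * \<bar>l\<bar> ^ 3 * ?T + \<bar>l\<bar> * ?T + l\<^sup>2 * ?T"
    by (simp only: distrib_right)
  show ?thesis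
  proof (cases "\<bar>z\<bar> \<le> 1 / t")
    case True
    \<comment> \<open>A perfect square yielding 2 |z|^3 \<le> z^2 + z^4.\<close>
    have "0 \<le> (\<bar>z\<bar> * (\<bar>z\<bar> - 1))\<^sup>2" by simp
    also have "\<dots> = z\<^sup>2 + z ^ 4 - 2 * \<bar>z\<bar> ^ 3"
      by (simp add: power_mult_distrib power2_diff algebra_simps eval_nat_numeral abs_mult[symmetric])
    finally have z3: "\<bar>z\<bar> ^ 3 \<le> z\<^sup>2 + z ^ 4" using zero_le_power[of "\<bar>z\<bar>" 3] by linarith
    have "\<bar>exp (l * t * z) - 1 - l * t * z - (l * t * z)\<^sup>2 / 2\<bar> \<le> exp \<bar>l\<bar> * \<bar>l * t * z\<bar> ^ 3"
      using clip_bound[OF t(1), of l z] True by (intro exp_quadratic_error) (simp add: clip_def)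
    also have "\<dots> = (exp \<bar>l\<bar> * \<bar>l\<bar> ^ 3) * (t ^ 3 * \<bar>z\<bar> ^ 3)"
      using t by (simp add: abs_mult power_mult_distrib)
    also have "\<dots> \<le> exp \<bar>l\<bar> * \<bar>l\<bar> ^ 3 * ?T"
      using t z3 by (intro mult_left_mono) auto
    finally have "\<bar>exp (l * t * z) - 1 - l * t * z - (l * t * z)\<^sup>2 / 2\<bar> \<le> exp \<bar>l\<bar> * \<bar>l\<bar> ^ 3 * ?T" .
    then show ?thesis unfolding split using True nonneg by (simp add: clip_def power_mult_distrib)
  next
    case False
    then have tz: "1 \<le> t * \<bar>z\<bar>" using t by (simp add: field_simps)
    have p: "(t * \<bar>z\<bar>) ^ k \<le> ?T" if "k \<le> 4" for k
    proof -
      have "(t * \<bar>z\<bar>) ^ k \<le> (t * \<bar>z\<bar>) ^ 4" using tz that by (intro power_increasing) auto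
      also have "\<dots> = t ^ 4 * z ^ 4" by (simp add: power_mult_distrib)
      also have "\<dots> \<le> ?T" using t by (intro mult_mono power_decreasing) auto
      finally show ?thesis .
    qed
    have "\<bar>exp (l * t * clip t z) - 1 - l * t * z - l\<^sup>2 * t\<^sup>2 / 2 * z\<^sup>2\<bar> = \<bar>l * t * z + l\<^sup>2 * t\<^sup>2 / 2 * z\<^sup>2\<bar>"
      using False by (simp add: clip_def abs_minus_commute[of "l * t * z + _" 0, simplified])
    also have "\<dots> \<le> \<bar>l * t * z\<bar> + \<bar>l\<^sup>2 * t\<^sup>2 / 2 * z\<^sup>2\<bar>" by (rule abs_triangle_ineq)
    also have "\<dots> = \<bar>l\<bar> * (t * \<bar>z\<bar>) ^ 1 + l\<^sup>2 / 2 * (t * \<bar>z\<bar>) ^ 2"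
      using t by (simp add: abs_mult power_mult_distrib)
    also have "\<dots> \<le> \<bar>l\<bar> * ?T + l\<^sup>2 * ?T"
      using t by (intro add_mono mult_mono p) auto
    finally show ?thesis unfolding split using nonneg by linarith
  qed
qed

text \<open>K is the constant of \<open>clip_exp_error\<close>; the second summand is the quadratic
  error of the logarithm, with \<open>exp \<bar>l\<bar>\<close> from the lower bound on its
  argument.\<close>

definition laplace_const :: "real \<Rightarrow> real" where
  "laplace_const l = (let K = exp \<bar>l\<bar> * \<bar>l\<bar> ^ 3 + \<bar>l\<bar> + l\<^sup>2 in K + exp \<bar>l\<bar> * (l\<^sup>2 + K)\<^sup>2)"

lemma laplace_const_nonneg: "laplace_const l \<ge> 0"
  by (auto simp: laplace_const_def Let_def intro!: add_nonneg_nonneg)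

text \<open>Integrating \<open>clip_exp_error\<close> expands \<phi> - 1; passing to ln \<phi> costs
  the square of \<phi> - 1, of order t^4 V^2. This explains V^2 in the error. Truncation keeps
  \<phi> away from 0, which controls the logarithm.\<close>

lemma (in prob_space) log_laplace_clip:
  fixes Z :: "'a \<Rightarrow> real" and l t :: real
  assumes Z[measurable]: "Z \<in> borel_measurable M"
    and i2: "integrable M (\<lambda>\<omega>. (Z \<omega>)\<^sup>2)" and i4: "integrable M (\<lambda>\<omega>. (Z \<omega>) ^ 4)"
    and Z0: "expectation Z = 0" and t: "0 < t" "t \<le> 1"
  defines "\<phi> \<equiv> expectation (\<lambda>\<omega>. exp (l * t * clip t (Z \<omega>)))"
    and "V \<equiv> expectation (\<lambda>\<omega>. (Z \<omega>)\<^sup>2) + expectation (\<lambda>\<omega>. (Z \<omega>) ^ 4)"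
  shows "\<bar>ln \<phi> - l\<^sup>2 * t\<^sup>2 / 2 * expectation (\<lambda>\<omega>. (Z \<omega>)\<^sup>2)\<bar> \<le> laplace_const l * t ^ 3 * (V + V\<^sup>2)"
    and "exp (- \<bar>l\<bar>) \<le> \<phi>"
proof -
  define K where "K = exp \<bar>l\<bar> * \<bar>l\<bar> ^ 3 + \<bar>l\<bar> + l\<^sup>2"
  have K0: "K \<ge> 0" unfolding K_def by (intro add_nonneg_nonneg) auto
  let ?m = "expectation (\<lambda>\<omega>. (Z \<omega>)\<^sup>2)"
  have i1: "integrable M Z" by (rule square_integrable_imp_integrable[OF Z i2])
  have bd: "exp (- \<bar>l\<bar>) \<le> exp (l * t * clip t z)" "exp (l * t * clip t z) \<le> exp \<bar>l\<bar>" for z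
    using clip_bound[OF t(1), of l z] unfolding exp_le_cancel_iff by linarith+
  have ie: "integrable M (\<lambda>\<omega>. exp (l * t * clip t (Z \<omega>)))"
    by (rule integrable_const_bound[where B = "exp \<bar>l\<bar>"]) (use bd(2) in simp_all)
  show low: "exp (- \<bar>l\<bar>) \<le> \<phi>"
    unfolding \<phi>_def by (rule integral_ge_const[OF ie]) (use bd(1) in simp)
  have m0: "0 \<le> ?m" "0 \<le> expectation (\<lambda>\<omega>. (Z \<omega>) ^ 4)" by (auto intro!: integral_nonneg_AE)
  then have V0: "V \<ge> 0" "?m \<le> V" by (auto simp: V_def)
  have eq: "\<phi> - 1 - l\<^sup>2 * t\<^sup>2 / 2 * ?m = expectation (\<lambda>\<omega>. exp (l * t * clip t (Z \<omega>)) - 1 - l * t * Z \<omega> - l\<^sup>2 * t\<^sup>2 / 2 * (Z \<omega>)\<^sup>2)"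
    using ie i1 i2 Z0 by (simp add: \<phi>_def prob_space)
  have "\<bar>expectation (\<lambda>\<omega>. exp (l * t * clip t (Z \<omega>)) - 1 - l * t * Z \<omega> - l\<^sup>2 * t\<^sup>2 / 2 * (Z \<omega>)\<^sup>2)\<bar> \<le> expectation (\<lambda>\<omega>. K * (t ^ 3 * ((Z \<omega>)\<^sup>2 + (Z \<omega>) ^ 4)))"
  proof (rule order_trans[OF integral_abs_bound], rule integral_mono)
    show "integrable M (\<lambda>\<omega>. \<bar>exp (l * t * clip t (Z \<omega>)) - 1 - l * t * Z \<omega> - l\<^sup>2 * t\<^sup>2 / 2 * (Z \<omega>)\<^sup>2\<bar>)"
      using ie i1 i2 by (intro integrable_abs Bochner_Integration.integrable_diff integrable_mult_right) auto
    show "integrable M (\<lambda>\<omega>. K * (t ^ 3 * ((Z \<omega>)\<^sup>2 + (Z \<omega>) ^ 4)))"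
      using i2 i4 by (intro integrable_mult_right Bochner_Integration.integrable_add)
  qed (unfold K_def, rule clip_exp_error[OF t])
  also have "\<dots> = K * t ^ 3 * V"
    by (simp only: integral_mult_right_zero Bochner_Integration.integral_add[OF i2 i4] V_def mult.assoc)
  finally have e: "\<bar>\<phi> - 1 - l\<^sup>2 * t\<^sup>2 / 2 * ?m\<bar> \<le> K * t ^ 3 * V" unfolding eq .
  have t32: "t ^ 3 \<le> t\<^sup>2" "t ^ 4 \<le> t ^ 3" using t by (auto intro!: power_decreasing)
  have "\<bar>\<phi> - 1\<bar> \<le> \<bar>l\<^sup>2 * t\<^sup>2 / 2 * ?m\<bar> + K * t ^ 3 * V" using e by linarith
  also have "\<dots> \<le> l\<^sup>2 * t\<^sup>2 * V + K * t\<^sup>2 * V"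
  proof (rule add_mono)
    have "0 \<le> l\<^sup>2 * t\<^sup>2 * ?m" using m0 by simp
    then have "\<bar>l\<^sup>2 * t\<^sup>2 / 2 * ?m\<bar> \<le> l\<^sup>2 * t\<^sup>2 * ?m" by simp
    also have "\<dots> \<le> l\<^sup>2 * t\<^sup>2 * V" using V0 by (intro mult_left_mono) auto
    finally show "\<bar>l\<^sup>2 * t\<^sup>2 / 2 * ?m\<bar> \<le> l\<^sup>2 * t\<^sup>2 * V" .
    show "K * t ^ 3 * V \<le> K * t\<^sup>2 * V" using K0 V0 t32 by (intro mult_right_mono mult_left_mono) auto
  qed
  finally have "\<bar>\<phi> - 1\<bar> \<le> (l\<^sup>2 + K) * t\<^sup>2 * V" by (simp add: algebra_simps)
  then have "(\<phi> - 1)\<^sup>2 \<le> ((l\<^sup>2 + K) * t\<^sup>2 * V)\<^sup>2" by (metis abs_ge_zero power2_abs power_mono)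
  also have "\<dots> = (l\<^sup>2 + K)\<^sup>2 * t ^ 4 * V\<^sup>2" by (simp add: power_mult_distrib power_mult[symmetric])
  also have "\<dots> \<le> (l\<^sup>2 + K)\<^sup>2 * t ^ 3 * V\<^sup>2" using t32 by (intro mult_right_mono mult_left_mono) auto
  finally have sq: "(\<phi> - 1)\<^sup>2 \<le> (l\<^sup>2 + K)\<^sup>2 * t ^ 3 * V\<^sup>2" .
  have "\<bar>ln \<phi> - (\<phi> - 1)\<bar> \<le> (\<phi> - 1)\<^sup>2 / exp (- \<bar>l\<bar>)"
    by (rule ln_minus_linear_error[OF _ low]) simp
  also have "\<dots> = exp \<bar>l\<bar> * (\<phi> - 1)\<^sup>2" by (simp add: exp_minus field_simps)
  also have "\<dots> \<le> exp \<bar>l\<bar> * ((l\<^sup>2 + K)\<^sup>2 * t ^ 3 * V\<^sup>2)" by (intro mult_left_mono sq) simp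
  finally have "\<bar>ln \<phi> - l\<^sup>2 * t\<^sup>2 / 2 * ?m\<bar> \<le> K * t ^ 3 * V + exp \<bar>l\<bar> * ((l\<^sup>2 + K)\<^sup>2 * t ^ 3 * V\<^sup>2)"
    using e by linarith
  \<comment> \<open>The nonnegative cross terms are added to complete the product with V +
    V^2.\<close>
  also have "\<dots> \<le> (K * t ^ 3 * V + exp \<bar>l\<bar> * ((l\<^sup>2 + K)\<^sup>2 * t ^ 3 * V\<^sup>2)) + (K * t ^ 3 * V\<^sup>2 + exp \<bar>l\<bar> * ((l\<^sup>2 + K)\<^sup>2 * t ^ 3 * V))"
    using K0 V0 t by (simp add: add_nonneg_nonneg)
  also have "\<dots> = laplace_const l * t ^ 3 * (V + V\<^sup>2)"
    unfolding laplace_const_def Let_def K_def[symmetric] by (simp add: algebra_simps)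
  finally show "\<bar>ln \<phi> - l\<^sup>2 * t\<^sup>2 / 2 * ?m\<bar> \<le> laplace_const l * t ^ 3 * (V + V\<^sup>2)" .
qed

section \<open>Normalised densities along the generations\<close>

context bifurcating_chain
begin

definition history :: "nat \<Rightarrow> 'b measure" where
  "history r = sig_gen M (X ` tree_upto r) borel"

lemma space_history: "space (history r) = space M"
  unfolding history_def by (rule space_sig_gen)

lemma tree_upto_ge_1: "i \<in> tree_upto r \<Longrightarrow> i \<ge> 1"
  by (auto simp: tree_upto_def dest: gen_ge_1)

lemma subalgebra_history: "subalgebra M (history r)"
  unfolding history_def
proof (rule subalgebra_sig_gen)
  fix Y assume "Y \<in> X ` tree_upto r"
  then obtain i where "i \<in> tree_upto r" "Y = X i" by auto
  then show "Y \<in> M \<rightarrow>\<^sub>M borel" using X_meas tree_upto_ge_1 by blast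
qed

lemma X_history: "i \<in> tree_upto r \<Longrightarrow> X i \<in> history r \<rightarrow>\<^sub>M borel"
  unfolding history_def by (rule measurable_sig_gen) simp_all

lemma sets_history_mono:
  assumes "q \<le> r"
  shows "sets (history q) \<subseteq> sets (history r)"
proof -
  have "tree_upto q \<subseteq> tree_upto r" using assms by (force simp: tree_upto_def)
  then have "(\<Union>Y\<in>X ` tree_upto q. {Y -` B \<inter> space M |B. B \<in> sets borel})
      \<subseteq> (\<Union>Y\<in>X ` tree_upto r. {Y -` B \<inter> space M |B. B \<in> sets borel})" by blast
  moreover have "sets (history k) = sigma_sets (space M) (\<Union>Y\<in>X ` tree_upto k. {Y -` B \<inter> space M |B. B \<in> sets borel})" for k
    unfolding history_def sig_gen_def by (rule sets_measure_of) blast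
  ultimately show ?thesis by (simp only: sigma_sets_mono')
qed

lemma Delta_history:
  assumes "i \<in> gen q" "q < r"
  shows "Delta X i \<in> history r \<rightarrow>\<^sub>M S3"
proof -
  have "i \<in> tree_upto r" using gen_subset_tree_upto[of q r] assms by auto
  moreover have "2 * i \<in> gen (Suc q)" "2 * i + 1 \<in> gen (Suc q)" using assms by (auto simp: gen_def)
  then have "2 * i \<in> tree_upto r" "2 * i + 1 \<in> tree_upto r"
    using gen_subset_tree_upto[of "Suc q" r] assms by auto
  ultimately show ?thesis
    unfolding Delta_def[abs_def] by (intro measurable_Pair X_history)
qed

text \<open>The set of active positions is random but known from the history. On the event
  \<open>AJ J\<close> that it equals J, the product has fixed factors and the Markov property
  replaces each by its mean, one. Summing over J, the measure with density D agrees with M on the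
  history, hence so do the integrals of Z.\<close>

lemma history_step:
  assumes \<sigma>: "bij_betw \<sigma> (gen r) (gen r)"
    and act: "\<And>i. i \<in> gen r \<Longrightarrow> {\<omega> \<in> space M. act i \<omega>} \<in> sets (history r)"
    and e: "e \<in> borel_measurable S3" "\<And>t. 0 \<le> e t" "\<And>t. e t \<le> B" "\<And>x. Pop P e x = 1"
    and Z: "Z \<in> borel_measurable (history r)"
  shows "(\<integral>\<^sup>+\<omega>. (\<Prod>i\<in>gen r. ennreal (if act i \<omega> then e (Delta X (\<sigma> i) \<omega>) else 1)) * Z \<omega> \<partial>M) = (\<integral>\<^sup>+\<omega>. Z \<omega> \<partial>M)"
proof -
  define D where "D \<omega> = (\<Prod>i\<in>gen r. ennreal (if act i \<omega> then e (Delta X (\<sigma> i) \<omega>) else 1))" for \<omega>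
  define AJ where "AJ J = {\<omega> \<in> space M. \<forall>i\<in>gen r. act i \<omega> \<longleftrightarrow> i \<in> J}" for J
  define fs where "fs J v = (if v \<in> \<sigma> ` J then e else (\<lambda>_. 1))" for J v
  have HM: "A \<in> sets M" if "A \<in> sets (history r)" for A
    using subalgebra_history[of r] that by (auto simp: subalgebra_def)
  have ne: "gen r \<noteq> {}" using card_gen[of r] by auto
  have AJ: "AJ J \<in> sets (history r)" for J
  proof -
    have "AJ J = (\<Inter>i\<in>gen r. {\<omega> \<in> space M. act i \<omega> \<longleftrightarrow> i \<in> J})"
      using ne by (auto simp: AJ_def)
    also have "\<dots> \<in> sets (history r)"
    proof (rule sets.finite_INT[OF finite_gen ne])
      fix i assume i: "i \<in> gen r"
      have "{\<omega> \<in> space M. act i \<omega> \<longleftrightarrow> i \<in> J} =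
          (if i \<in> J then {\<omega> \<in> space M. act i \<omega>} else space M - {\<omega> \<in> space M. act i \<omega>})" by auto
      then show "{\<omega> \<in> space M. act i \<omega> \<longleftrightarrow> i \<in> J} \<in> sets (history r)"
        using act[OF i] sets.compl_sets[OF act[OF i]] by (simp add: space_history)
    qed
    finally show ?thesis .
  qed
  have \<sigma>g: "\<sigma> i \<in> gen r" if "i \<in> gen r" for i using bij_betwE[OF \<sigma>] that by blast
  have \<sigma>J: "\<sigma> i \<in> \<sigma> ` J \<longleftrightarrow> i \<in> J" if "i \<in> gen r" "J \<subseteq> gen r" for i J
    using \<sigma> that by (intro inj_on_image_mem_iff[of \<sigma> "gen r"]) (auto simp: bij_betw_def)
  have eD: "(\<lambda>\<omega>. e (Delta X i \<omega>)) \<in> borel_measurable M" if "i \<in> gen r" for i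
    using measurable_compose[OF Delta_meas e(1)] gen_ge_1[OF that] by blast
  have fsm: "fs J v \<in> borel_measurable S3" for J v using e(1) by (simp add: fs_def)
  have fsn: "0 \<le> fs J v t" "fs J v t \<le> max 1 B" for J v t using e(2,3)[of t] by (auto simp: fs_def)
  have fsb: "bounded (range (fs J v))" for J v
    unfolding bounded_iff using fsn by (intro exI[of _ "max 1 B"]) auto
  have fsP: "Pop P (fs J v) x = 1" for J v x by (simp add: fs_def e(4) Pop_const)
  have fsD: "(\<lambda>\<omega>. fs J v (Delta X v \<omega>)) \<in> borel_measurable M" if "v \<in> gen r" for J v
    using measurable_compose[OF Delta_meas fsm] gen_ge_1[OF that] by blast
  let ?p = "\<lambda>J \<omega>. \<Prod>v\<in>gen r. fs J v (Delta X v \<omega>)"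
  have piece: "(\<integral>\<^sup>+\<omega>. indicator (A \<inter> AJ J) \<omega> * ennreal (?p J \<omega>) \<partial>M) = emeasure M (A \<inter> AJ J)"
    if A: "A \<in> sets (history r)" for A J
  proof -
    have AA: "A \<inter> AJ J \<in> sets (history r)" using A AJ by auto
    have int: "integrable M (\<lambda>\<omega>. indicator (A \<inter> AJ J) \<omega> * ?p J \<omega>)"
    proof (rule integrable_const_bound[where B = "max 1 B ^ card (gen r)"], rule AE_I2)
      fix \<omega>
      have "?p J \<omega> \<le> (\<Prod>v\<in>gen r. max 1 B)"
        by (intro prod_mono conjI fsn)
      moreover have "0 \<le> ?p J \<omega>" by (intro prod_nonneg fsn)
      ultimately show "norm (indicator (A \<inter> AJ J) \<omega> * ?p J \<omega>) \<le> max 1 B ^ card (gen r)"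
        by (simp add: indicator_def)
    qed (intro borel_measurable_times borel_measurable_indicator borel_measurable_prod fsD HM AA)
    have "(\<integral>\<^sup>+\<omega>. indicator (A \<inter> AJ J) \<omega> * ennreal (?p J \<omega>) \<partial>M) =
       (\<integral>\<^sup>+\<omega>. ennreal (indicator (A \<inter> AJ J) \<omega> * ?p J \<omega>) \<partial>M)"
      by (intro nn_integral_cong) (simp add: indicator_def)
    also have "\<dots> = ennreal (LINT \<omega>:A \<inter> AJ J|M. ?p J \<omega>)"
      unfolding set_lebesgue_integral_def real_scaleR_def
      by (rule nn_integral_eq_integral[OF int]) (simp add: fsn(1) prod_nonneg)
    also have "(LINT \<omega>:A \<inter> AJ J|M. ?p J \<omega>) = (LINT \<omega>:A \<inter> AJ J|M. 1)"
      using BMC[of r "fs J", OF fsm fsb AA[unfolded history_def]] by (simp add: fsP)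
    also have "\<dots> = prob (A \<inter> AJ J)"
      using HM[OF AA] by (simp add: set_lebesgue_integral_def)
    finally show ?thesis by (simp add: emeasure_eq_measure)
  qed
  have DJ: "D \<omega> = (\<Sum>J\<in>Pow (gen r). indicator (AJ J) \<omega> * ennreal (?p J \<omega>))"
    if w: "\<omega> \<in> space M" for \<omega>
  proof -
    define J0 where "J0 = {i \<in> gen r. act i \<omega>}"
    have "indicator (AJ J) \<omega> = (if J = J0 then 1 else 0 :: ennreal)" if "J \<in> Pow (gen r)" for J
      using w that by (auto simp: AJ_def J0_def indicator_def)
    then have "(\<Sum>J\<in>Pow (gen r). indicator (AJ J) \<omega> * ennreal (?p J \<omega>)) =
        (\<Sum>J\<in>Pow (gen r). if J = J0 then ennreal (?p J0 \<omega>) else 0)"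
      by (intro sum.cong) auto
    also have "\<dots> = ennreal (?p J0 \<omega>)"
      by (subst sum.delta) (auto simp: J0_def)
    also have "?p J0 \<omega> = (\<Prod>i\<in>gen r. fs J0 (\<sigma> i) (Delta X (\<sigma> i) \<omega>))"
      by (rule prod.reindex_bij_betw[OF \<sigma>, symmetric])
    also have "\<dots> = (\<Prod>i\<in>gen r. if act i \<omega> then e (Delta X (\<sigma> i) \<omega>) else 1)"
      using \<sigma>J[of _ J0] by (intro prod.cong refl) (auto simp: fs_def J0_def)
    also have "ennreal \<dots> = D \<omega>" unfolding D_def using e(2) by (intro prod_ennreal[symmetric]) auto
    finally show ?thesis by simp
  qed
  have Dm: "D \<in> borel_measurable M"
    unfolding D_def
  proof (rule borel_measurable_prod_ennreal, rule measurable_compose[OF _ measurable_ennreal], rule measurable_If)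
    fix i assume "i \<in> gen r"
    then show "(\<lambda>\<omega>. e (Delta X (\<sigma> i) \<omega>)) \<in> borel_measurable M" "{\<omega> \<in> space M. act i \<omega>} \<in> sets M"
      by (rule eD[OF \<sigma>g], rule HM[OF act])
  qed simp
  have mass: "(\<integral>\<^sup>+\<omega>. D \<omega> * indicator A \<omega> \<partial>M) = emeasure M A" if A: "A \<in> sets (history r)" for A
  proof -
    have "(\<integral>\<^sup>+\<omega>. D \<omega> * indicator A \<omega> \<partial>M) =
      (\<integral>\<^sup>+\<omega>. (\<Sum>J\<in>Pow (gen r). indicator (A \<inter> AJ J) \<omega> * ennreal (?p J \<omega>)) \<partial>M)"
      by (intro nn_integral_cong) (simp only: DJ indicator_inter_arith sum_distrib_left mult_ac)
    also have "\<dots> = (\<Sum>J\<in>Pow (gen r). emeasure M (A \<inter> AJ J))"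
      unfolding piece[OF A, symmetric]
      by (intro nn_integral_sum borel_measurable_times_ennreal borel_measurable_indicator HM sets.Int A AJ
          measurable_compose[OF _ measurable_ennreal] borel_measurable_prod fsD)
    also have "\<dots> = emeasure M (\<Union>J\<in>Pow (gen r). A \<inter> AJ J)"
    proof (rule sum_emeasure)
      show "disjoint_family_on (\<lambda>J. A \<inter> AJ J) (Pow (gen r))"
        unfolding disjoint_family_on_def AJ_def by blast
      show "(\<lambda>J. A \<inter> AJ J) ` Pow (gen r) \<subseteq> sets M" using HM[OF A] HM[OF AJ] by blast
    qed simp
    also have "(\<Union>J\<in>Pow (gen r). A \<inter> AJ J) = A"
    proof -
      have "A \<subseteq> space M" using sets.sets_into_space[OF HM[OF A]] .
      then have "\<omega> \<in> AJ {i \<in> gen r. act i \<omega>}" if "\<omega> \<in> A" for \<omega> using that by (auto simp: AJ_def)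
      then have "\<omega> \<in> (\<Union>J\<in>Pow (gen r). A \<inter> AJ J)" if "\<omega> \<in> A" for \<omega>
        using that by (intro UN_I[of "{i \<in> gen r. act i \<omega>}"]) auto
      then show ?thesis by auto
    qed
    finally show ?thesis .
  qed
  have subD: "subalgebra (density M D) (history r)"
    using subalgebra_history[of r] by (simp add: subalgebra_def)
  have eq: "restr_to_subalg (density M D) (history r) = restr_to_subalg M (history r)"
  proof (rule measure_eqI)
    show "sets (restr_to_subalg (density M D) (history r)) = sets (restr_to_subalg M (history r))"
      by (simp only: sets_restr_to_subalg[OF subD] sets_restr_to_subalg[OF subalgebra_history])
    fix A assume "A \<in> sets (restr_to_subalg (density M D) (history r))"
    then have A: "A \<in> sets (history r)" by (simp only: sets_restr_to_subalg[OF subD])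
    show "emeasure (restr_to_subalg (density M D) (history r)) A = emeasure (restr_to_subalg M (history r)) A"
      unfolding emeasure_restr_to_subalg[OF subD A] emeasure_restr_to_subalg[OF subalgebra_history A]
        emeasure_density[OF Dm HM[OF A]] by (rule mass[OF A])
  qed
  have "(\<integral>\<^sup>+\<omega>. D \<omega> * Z \<omega> \<partial>M) = (\<integral>\<^sup>+\<omega>. Z \<omega> \<partial>density M D)"
    by (rule nn_integral_density[OF Dm measurable_from_subalg[OF subalgebra_history Z], symmetric])
  also have "\<dots> = (\<integral>\<^sup>+\<omega>. Z \<omega> \<partial>restr_to_subalg M (history r))"
    using nn_integral_subalgebra2[OF subD Z] unfolding eq by simp
  also have "\<dots> = (\<integral>\<^sup>+\<omega>. Z \<omega> \<partial>M)"
    by (rule nn_integral_subalgebra2[OF subalgebra_history Z])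
  finally show ?thesis unfolding D_def .
qed

text \<open>The last generation is integrated out first. The remaining factors are known by then,
  since triangles rooted before generation r + 1 reach at most that generation.\<close>

lemma tilted_mass:
  assumes \<sigma>: "\<And>q. q \<le> r \<Longrightarrow> bij_betw \<sigma> (gen q) (gen q)"
    and act: "\<And>q i. q \<le> r \<Longrightarrow> i \<in> gen q \<Longrightarrow> {\<omega> \<in> space M. act i \<omega>} \<in> sets (history q)"
    and e: "e \<in> borel_measurable S3" "\<And>t. 0 \<le> e t" "\<And>t. e t \<le> B" "\<And>x. Pop P e x = 1"
  shows "(\<integral>\<^sup>+\<omega>. (\<Prod>i\<in>tree_upto r. ennreal (if act i \<omega> then e (Delta X (\<sigma> i) \<omega>) else 1)) \<partial>M) = 1"
  using \<sigma> act
proof (induction r)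
  case 0
  have "tree_upto 0 = gen 0" by (simp add: tree_upto_def)
  moreover have "(\<integral>\<^sup>+\<omega>. (\<Prod>i\<in>gen 0. ennreal (if act i \<omega> then e (Delta X (\<sigma> i) \<omega>) else 1)) * 1 \<partial>M) = (\<integral>\<^sup>+\<omega>. 1 \<partial>M)"
    by (rule history_step[OF 0(1) 0(2) e]) simp_all
  ultimately show ?case by (simp add: emeasure_space_1)
next
  case (Suc r)
  define Z where "Z \<omega> = (\<Prod>i\<in>tree_upto r. ennreal (if act i \<omega> then e (Delta X (\<sigma> i) \<omega>) else 1))" for \<omega>
  have Zm: "Z \<in> borel_measurable (history (Suc r))"
    unfolding Z_def
  proof (rule borel_measurable_prod_ennreal, rule measurable_compose[OF _ measurable_ennreal], rule measurable_If)
    fix i assume "i \<in> tree_upto r"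
    then obtain q where q: "q \<le> r" "i \<in> gen q" by (auto simp: tree_upto_def)
    then have "\<sigma> i \<in> gen q" using bij_betwE[OF Suc(2)[of q]] by auto
    then show "(\<lambda>\<omega>. e (Delta X (\<sigma> i) \<omega>)) \<in> borel_measurable (history (Suc r))"
      using q by (intro measurable_compose[OF Delta_history e(1)]) auto
    have "{\<omega> \<in> space M. act i \<omega>} \<in> sets (history q)" using q by (intro Suc(3)) auto
    then show "{\<omega> \<in> space (history (Suc r)). act i \<omega>} \<in> sets (history (Suc r))"
      using sets_history_mono[of q "Suc r"] q by (auto simp: space_history)
  qed simp
  have split: "tree_upto (Suc r) = gen (Suc r) \<union> tree_upto r" "gen (Suc r) \<inter> tree_upto r = {}"
    by (auto simp: tree_upto_def le_Suc_eq dest: gen_disjoint)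
  have "(\<integral>\<^sup>+\<omega>. (\<Prod>i\<in>tree_upto (Suc r). ennreal (if act i \<omega> then e (Delta X (\<sigma> i) \<omega>) else 1)) \<partial>M)
      = (\<integral>\<^sup>+\<omega>. (\<Prod>i\<in>gen (Suc r). ennreal (if act i \<omega> then e (Delta X (\<sigma> i) \<omega>) else 1)) * Z \<omega> \<partial>M)"
    unfolding split(1) Z_def by (intro nn_integral_cong prod.union_disjoint split(2)) auto
  also have "\<dots> = (\<integral>\<^sup>+\<omega>. Z \<omega> \<partial>M)"
    by (rule history_step[OF Suc(2) Suc(3) e Zm]) auto
  also have "\<dots> = 1" unfolding Z_def by (rule Suc.IH) (use Suc(2,3) in auto)
  finally show ?case .
qed

end

section \<open>Polynomial deviation bounds\<close>

text \<open>As s n = o(ln n), \<open>exp (- K * s n)\<close> eventually exceeds n to the power -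
  \<epsilon> / 2; the other half of \<epsilon> absorbs D.\<close>

lemma superexp_polynomial:
  assumes s: "(\<lambda>n. s n / ln (real n)) \<longlonglongrightarrow> 0" and \<epsilon>: "\<epsilon> > 0"
    and p: "\<forall>\<^sub>F n in sequentially. p n \<le> D * real n powr (- \<epsilon>)"
  shows "superexp s p"
  unfolding superexp_def
proof
  fix K :: real
  define a where "a = \<epsilon> / (2 * (\<bar>K\<bar> + 1))"
  have a: "a > 0" using \<epsilon> by (simp add: a_def)
  have "\<bar>K\<bar> * a \<le> (\<bar>K\<bar> + 1) * a" using a by (simp add: algebra_simps)
  also have "\<dots> = \<epsilon> / 2" by (simp add: a_def field_simps)
  finally have Ka: "\<bar>K\<bar> * a \<le> \<epsilon> / 2" .
  have D: "\<forall>\<^sub>F n in sequentially. D \<le> real n powr (\<epsilon> / 2)"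
  proof -
    have "\<forall>\<^sub>F n in sequentially. (\<bar>D\<bar> + 1) powr (2 / \<epsilon>) \<le> real n"
      using filterlim_real_sequentially by (simp add: filterlim_at_top)
    then show ?thesis
    proof eventually_elim
      case (elim n)
      have "((\<bar>D\<bar> + 1) powr (2 / \<epsilon>)) powr (\<epsilon> / 2) \<le> real n powr (\<epsilon> / 2)"
        using elim \<epsilon> by (intro powr_mono2) auto
      then show ?case using \<epsilon> by (simp add: powr_powr)
    qed
  qed
  have "\<forall>\<^sub>F n in sequentially. \<bar>s n / ln (real n)\<bar> < a"
    using tendstoD[OF s a] by (simp add: dist_real_def)
  then show "\<forall>\<^sub>F n in sequentially. p n \<le> exp (- K * s n)"
    using p D eventually_ge_at_top[of 2]
  proof eventually_elim
    case (elim n)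
    have ln: "ln (real n) > 0" using elim(4) by simp
    have "\<bar>s n\<bar> \<le> a * ln (real n)"
      using elim(1) ln by (simp add: abs_divide pos_divide_less_eq)
    then have "\<bar>K\<bar> * \<bar>s n\<bar> \<le> \<bar>K\<bar> * (a * ln (real n))" by (intro mult_left_mono) auto
    also have "\<dots> \<le> \<epsilon> / 2 * ln (real n)"
      using mult_right_mono[OF Ka, of "ln (real n)"] ln by (simp add: mult.assoc)
    finally have "K * s n \<le> \<epsilon> / 2 * ln (real n)"
      unfolding abs_mult[symmetric] by linarith
    then have "real n powr (- (\<epsilon> / 2)) \<le> exp (- K * s n)"
      using elim(4) by (simp add: powr_def)
    moreover have "D * real n powr (- \<epsilon>) \<le> real n powr (\<epsilon> / 2) * real n powr (- \<epsilon>)"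
      by (intro mult_right_mono elim(3)) simp
    moreover have "real n powr (\<epsilon> / 2) * real n powr (- \<epsilon>) = real n powr (- (\<epsilon> / 2))"
      by (simp add: powr_add[symmetric])
    ultimately show ?case using elim(2) by linarith
  qed
qed

text \<open>Since n < 2^(r + 1), geometric decay in the generation is polynomial decay in n. The
  factor (r + 1)^2 is absorbed by enlarging \<rho> slightly, using Bernoulli's inequality.\<close>

lemma geometric_le_powr:
  assumes \<rho>: "0 < \<rho>" "\<rho> < 1"
  shows "\<exists>D \<epsilon>. 0 \<le> D \<and> 0 < \<epsilon> \<and> (\<forall>r n. n \<in> gen r \<longrightarrow> (real r + 1)\<^sup>2 * \<rho> ^ r \<le> D * real n powr (- \<epsilon>))"
proof -
  \<comment> \<open>A third of the gap: (1 + x)^2 \<le> 1 + 3 x = 2 - \<rho>, and (2 - \<rho>)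
    \<rho> = 1 - (1 - \<rho>)^2 is still below 1.\<close>
  define x where "x = (1 - \<rho>) / 3"
  define \<rho>' where "\<rho>' = (1 + x)\<^sup>2 * \<rho>"
  have x: "0 < x" "x \<le> 1" using \<rho> by (auto simp: x_def)
  have "(1 + x)\<^sup>2 \<le> 1 + 3 * x"
    using mult_left_mono[OF x(2), of x] x by (simp add: power2_eq_square algebra_simps)
  then have "\<rho>' \<le> (2 - \<rho>) * \<rho>" using \<rho> unfolding \<rho>'_def
    by (intro mult_right_mono) (auto simp: x_def field_simps)
  also have "\<dots> = 1 - (1 - \<rho>)\<^sup>2" by (simp add: power2_eq_square algebra_simps)
  also have "\<dots> < 1" using \<rho> by simp
  finally have \<rho>'1: "\<rho>' < 1" .
  have \<rho>'0: "\<rho>' > 0" using \<rho> x by (simp add: \<rho>'_def)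
  define \<epsilon> where "\<epsilon> = - log 2 \<rho>'"
  have \<epsilon>: "\<epsilon> > 0" using \<rho>'0 \<rho>'1 by (simp add: \<epsilon>_def)
  have "(real r + 1)\<^sup>2 * \<rho> ^ r \<le> 1 / (x\<^sup>2 * \<rho>') * real n powr (- \<epsilon>)" if n: "n \<in> gen r" for r n
  proof -
    have "(real r + 1) * x \<le> 1 + real r * x" using x by (simp add: algebra_simps)
    also have "\<dots> \<le> (1 + x) ^ r" using x by (intro Bernoulli_inequality) simp
    finally have "real r + 1 \<le> (1 + x) ^ r / x" using x by (simp add: pos_le_divide_eq)
    then have "(real r + 1)\<^sup>2 \<le> ((1 + x) ^ r / x)\<^sup>2" by (intro power_mono) auto
    then have "(real r + 1)\<^sup>2 * \<rho> ^ r \<le> ((1 + x) ^ r / x)\<^sup>2 * \<rho> ^ r" using \<rho> by (intro mult_right_mono) auto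
    also have "\<dots> = \<rho>' ^ r / x\<^sup>2"
      by (simp add: \<rho>'_def power_mult_distrib power_divide power_mult[symmetric] mult.commute)
    also have "\<dots> = 1 / (x\<^sup>2 * \<rho>') * \<rho>' ^ Suc r" using \<rho>'0 by simp
    also have "\<rho>' ^ Suc r = (2 ^ Suc r) powr (- \<epsilon>)"
    proof -
      have "(2 ^ Suc r) powr (- \<epsilon>) = (2 powr real (Suc r)) powr log 2 \<rho>'"
        unfolding \<epsilon>_def by (subst powr_realpow) auto
      also have "\<dots> = (2 powr log 2 \<rho>') powr real (Suc r)" by (simp only: powr_powr mult.commute)
      also have "\<dots> = \<rho>' ^ Suc r" using \<rho>'0 by (simp add: powr_realpow del: of_nat_Suc power_Suc)
      finally show ?thesis by simp
    qed
    also have "1 / (x\<^sup>2 * \<rho>') * (2 ^ Suc r) powr (- \<epsilon>) \<le> 1 / (x\<^sup>2 * \<rho>') * real n powr (- \<epsilon>)"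
    proof (intro mult_left_mono powr_mono2')
      have "n \<le> 2 ^ Suc r" using n by (simp add: gen_def)
      then show "real n \<le> 2 ^ Suc r" by (metis of_nat_le_iff of_nat_numeral of_nat_power)
      show "0 < real n" using gen_ge_1[OF n] by simp
    qed (use \<epsilon> x \<rho>'0 in auto)
    finally show ?thesis .
  qed
  then show ?thesis using \<epsilon> x \<rho>'0 by (intro exI[of _ "1 / (x\<^sup>2 * \<rho>')"] exI[of _ \<epsilon>]) auto
qed

lemma sum_split_gen:
  fixes h :: "nat \<Rightarrow> real"
  assumes n: "n \<in> gen r"
  shows "(\<Sum>i=1..n. h i) = (\<Sum>q\<le>r. \<Sum>i\<in>gen q \<inter> {1..n}. h i)"
proof -
  have "{1..n} \<subseteq> tree_upto r" using n unfolding tree_upto_eq by (auto simp: gen_def)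
  then have "{1..n} = (\<Union>q\<in>{..r}. gen q \<inter> {1..n})" by (auto simp: tree_upto_def)
  then have "(\<Sum>i=1..n. h i) = sum h (\<Union>q\<in>{..r}. gen q \<inter> {1..n})" by (rule arg_cong)
  also have "\<dots> = (\<Sum>q\<le>r. \<Sum>i\<in>gen q \<inter> {1..n}. h i)"
    by (rule sum.UNION_disjoint) (auto dest: gen_disjoint)
  finally show ?thesis .
qed

section \<open>Law of large numbers at permuted positions\<close>

context permuted_chain
begin

text \<open>The target starts at 1 because the chain is measurable only at indices from 1 on;
  countability then permits substituting the random index.\<close>

lemma Pi_measurable:
  assumes "i \<ge> 1"
  shows "(\<lambda>\<omega>. Pi \<omega> i) \<in> M \<rightarrow>\<^sub>M count_space {1..}"
proof (rule measurableI)
  show "Pi \<omega> i \<in> space (count_space {1..})" if "\<omega> \<in> space M" for \<omega>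
    using Pi_ge_1[OF that assms] by simp
  fix A :: "nat set"
  have "(\<lambda>\<omega>. Pi \<omega> i) -` A \<inter> space M = (\<Union>j\<in>A. {\<omega> \<in> space M. Pi \<omega> i = j})" by auto
  also have "\<dots> \<in> sets M" by (intro sets.countable_UN') (auto simp: Pi_meas)
  finally show "(\<lambda>\<omega>. Pi \<omega> i) -` A \<inter> space M \<in> sets M" .
qed

lemma permuted_measurable:
  assumes "i \<ge> 1" "\<And>v. v \<ge> 1 \<Longrightarrow> h v \<in> M \<rightarrow>\<^sub>M N"
  shows "(\<lambda>\<omega>. h (Pi \<omega> i) \<omega>) \<in> M \<rightarrow>\<^sub>M N"
  by (rule measurable_compose_countable'[OF _ Pi_measurable[OF assms(1)]]) (use assms(2) in auto)

end

locale permuted_ergodic_chain = ergodic_chain M X P \<nu> \<mu> F + permuted_chain M X P Pi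
  for M :: "'b measure" and X :: "nat \<Rightarrow> 'b \<Rightarrow> 'a::metric_space" and P :: "'a \<Rightarrow> ('a \<times> 'a) measure"
    and \<nu> \<mu> :: "'a measure" and F :: "('a \<Rightarrow> real) set" and Pi :: "'b \<Rightarrow> nat \<Rightarrow> nat"
begin

lemma permuted_X_measurable:
  assumes "g \<in> borel_measurable borel" "i \<ge> 1"
  shows "(\<lambda>\<omega>. g (X (Pi \<omega> i) \<omega>)) \<in> borel_measurable M"
  by (rule permuted_measurable[OF assms(2), of "\<lambda>v \<omega>. g (X v \<omega>)"])
    (rule measurable_compose[OF X_meas assms(1)])

text \<open>Chebyshev's inequality, with the sum split by generations: Cauchy-Schwarz over the r + 1
  pieces and the sum of their second moments give (r + 1)^2, and n \<ge> 2^r turns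
  \<open>(4 * \<rho>) ^ r / n\<^sup>2\<close> into at most \<open>\<rho> ^ r\<close>.\<close>

lemma lln_polynomial:
  assumes g: "g \<in> F" and centred: "(\<integral>y. g y \<partial>\<mu>) = 0"
  shows "\<exists>D \<epsilon>. 0 < \<epsilon> \<and> (\<forall>n \<delta>. n \<ge> 1 \<longrightarrow> \<delta> > 0 \<longrightarrow>
    prob {\<omega> \<in> space M. \<delta> * real n < \<bar>\<Sum>i=1..n. g (X (Pi \<omega> i) \<omega>)\<bar>} \<le> D / \<delta>\<^sup>2 * real n powr (- \<epsilon>))"
proof -
  note gm = F_measD[OF g]
  obtain C1 where C1: "C1 \<ge> 0" "\<And>q. (\<Sum>i\<in>gen q. expectation (\<lambda>\<omega>. (g (X i \<omega>))\<^sup>2)) \<le> 2 ^ q * C1"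
    using first_moment(2)[OF F_sq[OF g]] by auto
  obtain C2 \<rho> where C2: "0 \<le> C2" "1 / 2 \<le> \<rho>" "\<rho> < 1"
    "\<And>q. expectation (\<lambda>\<omega>. (\<Sum>i\<in>gen q. g (X i \<omega>))\<^sup>2) \<le> C2 * (4 * \<rho>) ^ q"
    using second_moment_gen[OF g centred] by auto
  obtain D \<epsilon> where D: "0 \<le> D" "0 < \<epsilon>" "\<And>r n. n \<in> gen r \<Longrightarrow> (real r + 1)\<^sup>2 * \<rho> ^ r \<le> D * real n powr (- \<epsilon>)"
    using geometric_le_powr[of \<rho>] C2 by auto
  have "prob {\<omega> \<in> space M. \<delta> * real n < \<bar>\<Sum>i=1..n. g (X (Pi \<omega> i) \<omega>)\<bar>} \<le> ((C1 + C2) * D) / \<delta>\<^sup>2 * real n powr (- \<epsilon>)"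
    if n: "n \<ge> 1" and \<delta>: "\<delta> > 0" for n \<delta>
  proof -
    obtain r where r: "n \<in> gen r" using ex_gen[OF n] by blast
    define S where "S q \<omega> = (\<Sum>i\<in>gen q \<inter> {1..n}. g (X (Pi \<omega> i) \<omega>))" for q \<omega>
    have Sm: "S q \<in> borel_measurable M" for q
      unfolding S_def by (intro borel_measurable_sum permuted_X_measurable gm) auto
    have tot: "(\<Sum>i=1..n. g (X (Pi \<omega> i) \<omega>)) = (\<Sum>q\<le>r. S q \<omega>)" for \<omega>
      unfolding S_def by (rule sum_split_gen[OF r])
    have Sq: "(\<integral>\<^sup>+\<omega>. ennreal ((S q \<omega>)\<^sup>2) \<partial>M) \<le> ennreal ((C1 + C2) * (4 * \<rho>) ^ r)" if q: "q \<le> r" for q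
    proof -
      have "(\<integral>\<^sup>+\<omega>. ennreal ((S q \<omega>)\<^sup>2) \<partial>M) \<le>
          ennreal ((\<Sum>i\<in>gen q. expectation (\<lambda>\<omega>. (g (X i \<omega>))\<^sup>2)) + expectation (\<lambda>\<omega>. (\<Sum>i\<in>gen q. g (X i \<omega>))\<^sup>2))"
        unfolding S_def
        by (rule permuted_second_moment[OF gm q]) (auto intro: F_square_integrable[OF g] gen_ge_1)
      also have "\<dots> \<le> ennreal ((C1 + C2) * (4 * \<rho>) ^ r)"
      proof (rule ennreal_leI)
        have "2 ^ q \<le> (4 * \<rho>) ^ q" using C2 by (intro power_mono) auto
        also have pq: "(4 * \<rho>) ^ q \<le> (4 * \<rho>) ^ r" using C2 q by (intro power_increasing) auto
        finally have "2 ^ q * C1 \<le> (4 * \<rho>) ^ r * C1" by (rule mult_right_mono[OF _ C1(1)])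
        moreover have "C2 * (4 * \<rho>) ^ q \<le> C2 * (4 * \<rho>) ^ r" by (rule mult_left_mono[OF pq C2(1)])
        ultimately show "(\<Sum>i\<in>gen q. expectation (\<lambda>\<omega>. (g (X i \<omega>))\<^sup>2)) + expectation (\<lambda>\<omega>. (\<Sum>i\<in>gen q. g (X i \<omega>))\<^sup>2) \<le> (C1 + C2) * (4 * \<rho>) ^ r"
          using C1(2)[of q] C2(4)[of q] by (simp add: algebra_simps)
      qed
      finally show ?thesis .
    qed
    define c where "c = (real r + 1) / (\<delta> * real n)\<^sup>2"
    have c0: "c \<ge> 0" by (simp add: c_def)
    let ?A = "{\<omega> \<in> space M. \<delta> * real n < \<bar>\<Sum>i=1..n. g (X (Pi \<omega> i) \<omega>)\<bar>}"
    have Am: "?A \<in> sets M"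
      unfolding tot using Sm by measurable
    have "emeasure M ?A = (\<integral>\<^sup>+\<omega>. indicator ?A \<omega> \<partial>M)" using Am by simp
    also have "\<dots> \<le> (\<integral>\<^sup>+\<omega>. ennreal c * (\<Sum>q\<le>r. ennreal ((S q \<omega>)\<^sup>2)) \<partial>M)"
    proof (rule nn_integral_mono)
      fix \<omega>
      show "indicator ?A \<omega> \<le> ennreal c * (\<Sum>q\<le>r. ennreal ((S q \<omega>)\<^sup>2))"
      proof (cases "\<omega> \<in> ?A")
        case True
        then have "(\<delta> * real n)\<^sup>2 \<le> \<bar>\<Sum>q\<le>r. S q \<omega>\<bar>\<^sup>2"
          unfolding tot using \<delta> by (intro power_mono) auto
        also have "\<dots> = (\<Sum>q\<le>r. S q \<omega>)\<^sup>2" by simp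
        also have "\<dots> \<le> (\<Sum>q\<le>r. (S q \<omega>)\<^sup>2) * real (card {..r})" by (rule sum_squared_le_sum_of_squares)
        finally have "1 \<le> c * (\<Sum>q\<le>r. (S q \<omega>)\<^sup>2)"
          using \<delta> n by (simp add: c_def field_simps)
        then have "1 \<le> ennreal (c * (\<Sum>q\<le>r. (S q \<omega>)\<^sup>2))" by simp
        also have "\<dots> = ennreal c * (\<Sum>q\<le>r. ennreal ((S q \<omega>)\<^sup>2))"
          using c0 by (simp add: ennreal_mult sum_nonneg)
        finally show ?thesis using True by simp
      qed simp
    qed
    also have "\<dots> = ennreal c * (\<Sum>q\<le>r. \<integral>\<^sup>+\<omega>. ennreal ((S q \<omega>)\<^sup>2) \<partial>M)"
    proof -
      have m: "(\<lambda>\<omega>. ennreal ((S q \<omega>)\<^sup>2)) \<in> borel_measurable M" for q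
        by (rule measurable_compose[OF borel_measurable_power[OF Sm] measurable_ennreal])
      show ?thesis
        by (subst nn_integral_cmult, intro borel_measurable_sum m, subst nn_integral_sum) (simp_all add: m)
    qed
    also have "\<dots> \<le> ennreal c * (\<Sum>q\<le>r. ennreal ((C1 + C2) * (4 * \<rho>) ^ r))"
      by (intro mult_left_mono sum_mono Sq) auto
    also have "\<dots> = ennreal (c * ((real r + 1) * ((C1 + C2) * (4 * \<rho>) ^ r)))"
    proof -
      have "0 \<le> (C1 + C2) * (4 * \<rho>) ^ r" using C1 C2 by simp
      then show ?thesis
        using c0 by (simp add: ennreal_of_nat_eq_real_of_nat ennreal_mult''[symmetric] ennreal_mult'[symmetric] add.commute del: ennreal_plus)
    qed
    finally have "prob ?A \<le> c * ((real r + 1) * ((C1 + C2) * (4 * \<rho>) ^ r))"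
      using c0 C1 C2 by (simp add: emeasure_eq_measure)
    also have "\<dots> = (C1 + C2) / \<delta>\<^sup>2 * ((real r + 1)\<^sup>2 * \<rho> ^ r) * (4 ^ r / (real n)\<^sup>2)"
      by (simp add: c_def power_mult_distrib power2_eq_square mult_ac)
    also have "\<dots> \<le> (C1 + C2) / \<delta>\<^sup>2 * ((real r + 1)\<^sup>2 * \<rho> ^ r) * 1"
    proof (rule mult_left_mono)
      have "(2::nat) ^ r \<le> n" using r by (simp add: gen_def)
      then have "2 ^ r \<le> real n" by (metis of_nat_le_iff of_nat_numeral of_nat_power)
      then have "(2 ^ r)\<^sup>2 \<le> (real n)\<^sup>2" by (intro power_mono) auto
      then show "4 ^ r / (real n)\<^sup>2 \<le> 1" using n by (simp add: power_mult[symmetric] mult.commute[of r] power_mult)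
    qed (use C1 C2 in auto)
    also have "\<dots> \<le> (C1 + C2) / \<delta>\<^sup>2 * (D * real n powr (- \<epsilon>))"
      unfolding mult_1_right using C1(1) C2(1) by (intro mult_left_mono D(3)[OF r]) simp
    finally show ?thesis by simp
  qed
  then show ?thesis using D(2) by blast
qed

end

section \<open>Moderate deviations\<close>

locale bmc_moderate = permuted_ergodic_chain M X P \<nu> \<mu> F Pi
  for M :: "'b measure" and X :: "nat \<Rightarrow> 'b \<Rightarrow> 'a::metric_space" and P :: "'a \<Rightarrow> ('a \<times> 'a) measure"
    and \<nu> \<mu> :: "'a measure" and F :: "('a \<Rightarrow> real) set" and Pi :: "'b \<Rightarrow> nat \<Rightarrow> nat" +
  fixes f :: "'a \<times> 'a \<times> 'a \<Rightarrow> real" and b :: "nat \<Rightarrow> real"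
  assumes mu_prob: "prob_space \<mu>"
    and F_mu_int: "\<And>g. g \<in> F \<Longrightarrow> integrable \<mu> g"
    and f_meas: "f \<in> borel_measurable S3"
    and Pf2_int: "\<And>x. integrable (P x) (\<lambda>yz. (f (x, fst yz, snd yz))^2)"
    and Pf2_F: "Pop P (\<lambda>t. (f t)^2) \<in> F"
    and Pf4_int: "\<And>x. integrable (P x) (\<lambda>yz. (f (x, fst yz, snd yz))^4)"
    and Pf4_F: "Pop P (\<lambda>t. (f t)^4) \<in> F"
    and Pf0: "\<And>x. Pop P f x = 0"
    and b_pos: "\<And>n. b n > 0"
    and b_lower: "filterlim (\<lambda>n. b n / sqrt (real n)) at_top sequentially"
    and b_upper: "(\<lambda>n. b n / sqrt (real n * ln (real n))) \<longlonglongrightarrow> 0"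
begin

section \<open>Speed and scale\<close>

definition speed :: "nat \<Rightarrow> real" where "speed n = (b n)\<^sup>2 / real n"

text \<open>The factor that turns the sum into \<open>speed n\<close> times the sum divided by
  \<open>b n\<close>; its inverse is the truncation level.\<close>

definition tilt :: "nat \<Rightarrow> real" where "tilt n = b n / real n"

lemma tilt_pos: "n \<ge> 1 \<Longrightarrow> tilt n > 0"
  using b_pos[of n] by (simp add: tilt_def)

lemma tilt_square: "n \<ge> 1 \<Longrightarrow> (tilt n)\<^sup>2 * real n = speed n"
  by (simp add: tilt_def speed_def power2_eq_square)

lemma speed_at_top: "filterlim speed at_top sequentially"
proof -
  have "filterlim (\<lambda>n. (b n / sqrt (real n))\<^sup>2) at_top sequentially"
    by (rule filterlim_pow_at_top[OF _ b_lower]) simp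
  moreover have "(\<lambda>n. (b n / sqrt (real n))\<^sup>2) = speed"
    by (simp add: fun_eq_iff speed_def power_divide)
  ultimately show ?thesis by simp
qed

lemma speed_ln: "(\<lambda>n. speed n / ln (real n)) \<longlonglongrightarrow> 0"
proof -
  have "(\<lambda>n. (b n / sqrt (real n * ln (real n)))\<^sup>2) \<longlonglongrightarrow> 0\<^sup>2"
    by (rule tendsto_power[OF b_upper])
  moreover have "\<forall>\<^sub>F n in sequentially. (b n / sqrt (real n * ln (real n)))\<^sup>2 = speed n / ln (real n)"
    using eventually_ge_at_top[of 1] by eventually_elim (simp add: speed_def power_divide)
  ultimately show ?thesis by (simp add: tendsto_cong)
qed

lemma speed_le_ln: "\<forall>\<^sub>F n in sequentially. speed n \<le> ln (real n)"
proof -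
  have "\<forall>\<^sub>F n in sequentially. \<bar>speed n / ln (real n)\<bar> < 1"
    using tendstoD[OF speed_ln, of 1] by (simp add: dist_real_def)
  then show ?thesis using eventually_ge_at_top[of 2]
  proof eventually_elim
    case (elim n)
    have "ln (real n) > 0" using elim(2) by simp
    then show ?case using elim(1) by (simp add: abs_divide pos_divide_less_eq)
  qed
qed

text \<open>tilt^2 = speed / n, and the speed is at most ln n.\<close>

lemma tilt_tendsto: "tilt \<longlonglongrightarrow> 0"
proof -
  have "(\<lambda>n. ln (real n) / real n) \<longlonglongrightarrow> 0"
    by (rule lim_ln_over_n)
  then have "(\<lambda>n. sqrt (ln (real n) / real n)) \<longlonglongrightarrow> sqrt 0" by (rule tendsto_real_sqrt)
  then have l: "(\<lambda>n. sqrt (ln (real n) / real n)) \<longlonglongrightarrow> 0" by simp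
  show ?thesis
  proof (rule tendsto_sandwich[OF _ _ tendsto_const l])
    show "\<forall>\<^sub>F n in sequentially. 0 \<le> tilt n"
      using eventually_ge_at_top[of 1] by eventually_elim (use tilt_pos in \<open>simp add: less_imp_le\<close>)
    show "\<forall>\<^sub>F n in sequentially. tilt n \<le> sqrt (ln (real n) / real n)"
      using speed_le_ln eventually_ge_at_top[of 1]
    proof eventually_elim
      case (elim n)
      have "(tilt n)\<^sup>2 \<le> ln (real n) / real n"
        using elim tilt_square[of n] by (simp add: pos_le_divide_eq)
      then show ?case by (rule real_le_rsqrt)
    qed
  qed
qed

section \<open>Conditional moments and the stopped exponential\<close>

definition V2 :: "'a \<Rightarrow> real" where "V2 = Pop P (\<lambda>t. (f t)\<^sup>2)"
definition V4 :: "'a \<Rightarrow> real" where "V4 = Pop P (\<lambda>t. (f t) ^ 4)"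

text \<open>The square is included because it dominates the error of the expansion
  of \<open>ln\<close> in the logarithmic Laplace transform; it stays in \<open>F\<close> by condition (ii).\<close>

definition weight :: "'a \<Rightarrow> real" where "weight x = V2 x + V4 x + (V2 x + V4 x)\<^sup>2"

lemma V_nonneg: "V2 x \<ge> 0" "V4 x \<ge> 0"
  by (auto simp: V2_def V4_def Pop_def intro!: integral_nonneg_AE)

lemma V2_F: "V2 \<in> F" and V4_F: "V4 \<in> F"
  using Pf2_F Pf4_F by (simp_all add: V2_def V4_def)

lemma weight_F: "weight \<in> F"
  unfolding weight_def[abs_def] by (intro F_add F_sq V2_F V4_F)

lemma weight_nonneg: "weight x \<ge> 0" and V2_le_weight: "V2 x \<le> weight x"
  using V_nonneg[of x] by (auto simp: weight_def)

abbreviation limit_variance :: real where "limit_variance \<equiv> \<integral>x. V2 x \<partial>\<mu>"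

text \<open>One above the mean, so that reaching it is a deviation of size 1 in the law of large
  numbers for the weight.\<close>

definition threshold :: real where "threshold = (\<integral>x. weight x \<partial>\<mu>) + 1"

lemma threshold_pos: "threshold > 0"
proof -
  have "0 \<le> (\<integral>x. weight x \<partial>\<mu>)" by (intro integral_nonneg_AE) (simp add: weight_nonneg)
  then show ?thesis by (simp add: threshold_def)
qed

lemma weight_meas: "weight \<in> borel_measurable borel" and V2_meas: "V2 \<in> borel_measurable borel"
  using F_measD weight_F V2_F by auto

text \<open>A position stays active as long as the accumulated weight is at most \<open>threshold * n\<close>; this makes the
  compensator deterministically bounded while, for a given permutation, being decided by the history.\<close>

definition active :: "nat \<Rightarrow> (nat \<Rightarrow> nat) \<Rightarrow> nat \<Rightarrow> 'b \<Rightarrow> bool" where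
  "active n \<sigma> i \<omega> \<longleftrightarrow> i \<le> n \<and> (\<Sum>j=1..i. weight (X (\<sigma> j) \<omega>)) \<le> threshold * real n"

definition laplace :: "real \<Rightarrow> nat \<Rightarrow> 'a \<Rightarrow> real" where
  "laplace l n = Pop P (\<lambda>u. exp (l * tilt n * clip (tilt n) (f u)))"

definition active_sum :: "nat \<Rightarrow> 'b \<Rightarrow> real" where
  "active_sum n \<omega> = (\<Sum>i=1..n. if active n (Pi \<omega>) i \<omega> then tilt n * clip (tilt n) (f (Delta X (Pi \<omega> i) \<omega>)) else 0)"

text \<open>The exact conditional log-Laplace transforms, not their quadratic approximation: only
  these make the exponential density have mean one without error.\<close>

definition compensator :: "real \<Rightarrow> nat \<Rightarrow> 'b \<Rightarrow> real" where
  "compensator l n \<omega> = (\<Sum>i=1..n. if active n (Pi \<omega>) i \<omega> then ln (laplace l n (X (Pi \<omega> i) \<omega>)) else 0)"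

lemma exp_clip_meas: "(\<lambda>u. exp (l * tilt n * clip (tilt n) (f u))) \<in> borel_measurable S3"
  using measurable_compose[OF f_meas, of "\<lambda>z. exp (l * tilt n * clip (tilt n) z)" borel] by simp

lemma laplace_meas: "laplace l n \<in> borel_measurable borel"
  unfolding laplace_def by (rule Pop_meas[OF exp_clip_meas])

lemma laplace_bounds:
  assumes n: "n \<ge> 1" "tilt n \<le> 1"
  shows "\<bar>ln (laplace l n x) - l\<^sup>2 * (tilt n)\<^sup>2 / 2 * V2 x\<bar> \<le> laplace_const l * tilt n ^ 3 * weight x"
    and "exp (- \<bar>l\<bar>) \<le> laplace l n x"
proof -
  interpret Px: prob_space "P x" by (rule P_prob)
  have Z0: "Px.expectation (\<lambda>yz. f (x, fst yz, snd yz)) = 0" using Pf0[of x] by (simp add: Pop_def)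
  note * = Px.log_laplace_clip[OF section_meas[OF f_meas] Pf2_int Pf4_int Z0 tilt_pos[OF n(1)] n(2), of l]
  show "\<bar>ln (laplace l n x) - l\<^sup>2 * (tilt n)\<^sup>2 / 2 * V2 x\<bar> \<le> laplace_const l * tilt n ^ 3 * weight x"
    using *(1) by (simp only: laplace_def V2_def V4_def Pop_def weight_def)
  show "exp (- \<bar>l\<bar>) \<le> laplace l n x"
    using *(2) by (simp only: laplace_def Pop_def)
qed

text \<open>Coarser than \<open>laplace_bounds\<close>, but everything is put in terms of the
  weight, which is the quantity that stopping controls.\<close>

lemma ln_laplace_bound:
  assumes n: "n \<ge> 1" "tilt n \<le> 1"
  shows "\<bar>ln (laplace l n x)\<bar> \<le> (l\<^sup>2 + laplace_const l) * (tilt n)\<^sup>2 * weight x"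
proof -
  note t = tilt_pos[OF n(1)]
  have t3: "tilt n ^ 3 \<le> (tilt n)\<^sup>2" using t n(2) by (intro power_decreasing) auto
  have a0: "0 \<le> l\<^sup>2 * (tilt n)\<^sup>2 * V2 x" using V_nonneg by simp
  have "\<bar>ln (laplace l n x)\<bar> \<le> \<bar>l\<^sup>2 * (tilt n)\<^sup>2 / 2 * V2 x\<bar> + laplace_const l * tilt n ^ 3 * weight x"
    using laplace_bounds(1)[OF n, of l x] by linarith
  also have "\<bar>l\<^sup>2 * (tilt n)\<^sup>2 / 2 * V2 x\<bar> \<le> l\<^sup>2 * (tilt n)\<^sup>2 * V2 x"
  proof -
    have "l\<^sup>2 * (tilt n)\<^sup>2 / 2 * V2 x = (l\<^sup>2 * (tilt n)\<^sup>2 * V2 x) / 2" by simp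
    then show ?thesis using a0 by linarith
  qed
  also have "\<dots> \<le> l\<^sup>2 * (tilt n)\<^sup>2 * weight x" using V2_le_weight by (intro mult_left_mono) auto
  also have "laplace_const l * tilt n ^ 3 * weight x \<le> laplace_const l * (tilt n)\<^sup>2 * weight x"
    using t3 weight_nonneg laplace_const_nonneg by (intro mult_right_mono mult_left_mono) auto
  finally show ?thesis by (simp add: algebra_simps)
qed

lemma active_mono: "active n \<sigma> i \<omega> \<Longrightarrow> j \<le> i \<Longrightarrow> active n \<sigma> j \<omega>"
proof -
  assume a: "active n \<sigma> i \<omega>" "j \<le> i"
  have "(\<Sum>k=1..j. weight (X (\<sigma> k) \<omega>)) \<le> (\<Sum>k=1..i. weight (X (\<sigma> k) \<omega>))"
    using a(2) weight_nonneg by (intro sum_mono2) auto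
  then show ?thesis using a by (auto simp: active_def)
qed

text \<open>Active positions form an initial segment. The condition at a position already counts its
  own weight, so the last active one bounds the total without overshoot.\<close>

lemma sum_active_le: "(\<Sum>i=1..n. if active n \<sigma> i \<omega> then weight (X (\<sigma> i) \<omega>) else 0) \<le> threshold * real n"
proof (cases "\<exists>i\<in>{1..n}. active n \<sigma> i \<omega>")
  case False
  then have "(\<Sum>i=1..n. if active n \<sigma> i \<omega> then weight (X (\<sigma> i) \<omega>) else 0) = 0" by (intro sum.neutral) auto
  then show ?thesis using threshold_pos by simp
next
  case True
  define m where "m = Max {i \<in> {1..n}. active n \<sigma> i \<omega>}"
  have fin: "finite {i \<in> {1..n}. active n \<sigma> i \<omega>}" by simp
  have "{i \<in> {1..n}. active n \<sigma> i \<omega>} \<noteq> {}" using True by blast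
  then have "m \<in> {i \<in> {1..n}. active n \<sigma> i \<omega>}" unfolding m_def by (rule Max_in[OF fin])
  then have m: "m \<in> {1..n}" "active n \<sigma> m \<omega>" by auto
  have le: "i \<le> m" if "i \<in> {1..n}" "active n \<sigma> i \<omega>" for i
    using Max_ge[OF fin, of i] that by (simp add: m_def)
  have "(\<Sum>i=1..n. if active n \<sigma> i \<omega> then weight (X (\<sigma> i) \<omega>) else 0) \<le> (\<Sum>i=1..n. if i \<in> {1..m} then weight (X (\<sigma> i) \<omega>) else 0)"
  proof (rule sum_mono)
    fix i assume i: "i \<in> {1..n}"
    show "(if active n \<sigma> i \<omega> then weight (X (\<sigma> i) \<omega>) else 0) \<le> (if i \<in> {1..m} then weight (X (\<sigma> i) \<omega>) else 0)"
      using le[OF i] i weight_nonneg by simp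
  qed
  also have "\<dots> = (\<Sum>i\<in>{1..n} \<inter> {1..m}. weight (X (\<sigma> i) \<omega>))" by (rule sum.inter_restrict[symmetric]) simp
  also have "{1..n} \<inter> {1..m} = {1..m}" using m by auto
  also have "(\<Sum>i=1..m. weight (X (\<sigma> i) \<omega>)) \<le> threshold * real n" using m by (simp add: active_def)
  finally show ?thesis .
qed

lemma active_measurable: "Measurable.pred M (\<lambda>\<omega>. active n (Pi \<omega>) i \<omega>)"
proof -
  have "(\<lambda>\<omega>. \<Sum>j=1..i. weight (X (Pi \<omega> j) \<omega>)) \<in> borel_measurable M"
    by (intro borel_measurable_sum permuted_X_measurable weight_meas) simp
  then show ?thesis unfolding active_def by measurable
qed

lemma active_sum_meas: "active_sum n \<in> borel_measurable M"
  unfolding active_sum_def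
proof (intro borel_measurable_sum)
  fix i assume "i \<in> {1..n}"
  then have "(\<lambda>\<omega>. f (Delta X (Pi \<omega> i) \<omega>)) \<in> borel_measurable M"
    by (intro permuted_measurable[of i "\<lambda>v \<omega>. f (Delta X v \<omega>)"] measurable_compose[OF Delta_meas f_meas]) auto
  from measurable_compose[OF this clip_meas]
  show "(\<lambda>\<omega>. if active n (Pi \<omega>) i \<omega> then tilt n * clip (tilt n) (f (Delta X (Pi \<omega> i) \<omega>)) else 0) \<in> borel_measurable M"
    by (intro measurable_If borel_measurable_times active_measurable[unfolded pred_def]) simp_all
qed

lemma compensator_meas: "compensator l n \<in> borel_measurable M"
  unfolding compensator_def
proof (intro borel_measurable_sum)
  fix i assume "i \<in> {1..n}"
  then have "(\<lambda>\<omega>. laplace l n (X (Pi \<omega> i) \<omega>)) \<in> borel_measurable M"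
    by (intro permuted_X_measurable laplace_meas) simp
  then show "(\<lambda>\<omega>. if active n (Pi \<omega>) i \<omega> then ln (laplace l n (X (Pi \<omega> i) \<omega>)) else 0) \<in> borel_measurable M"
    by (intro measurable_If borel_measurable_ln active_measurable[unfolded pred_def]) simp_all
qed

lemma compensator_bound:
  assumes n: "n \<ge> 1" "tilt n \<le> 1"
  shows "\<bar>compensator l n \<omega>\<bar> \<le> (l\<^sup>2 + laplace_const l) * threshold * speed n"
proof -
  let ?c = "(l\<^sup>2 + laplace_const l) * (tilt n)\<^sup>2"
  have c0: "?c \<ge> 0" using laplace_const_nonneg by (simp add: add_nonneg_nonneg)
  have "\<bar>compensator l n \<omega>\<bar> \<le> (\<Sum>i=1..n. \<bar>if active n (Pi \<omega>) i \<omega> then ln (laplace l n (X (Pi \<omega> i) \<omega>)) else 0\<bar>)"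
    unfolding compensator_def by (rule sum_abs)
  also have "\<dots> \<le> (\<Sum>i=1..n. ?c * (if active n (Pi \<omega>) i \<omega> then weight (X (Pi \<omega> i) \<omega>) else 0))"
    using ln_laplace_bound[OF n] by (intro sum_mono) auto
  also have "\<dots> = ?c * (\<Sum>i=1..n. if active n (Pi \<omega>) i \<omega> then weight (X (Pi \<omega> i) \<omega>) else 0)"
    by (rule sum_distrib_left[symmetric])
  also have "\<dots> \<le> ?c * (threshold * real n)" by (rule mult_left_mono[OF sum_active_le c0])
  also have "\<dots> = (l\<^sup>2 + laplace_const l) * threshold * speed n"
    unfolding tilt_square[OF n(1), symmetric] by (simp only: mult_ac)
  finally show ?thesis .
qed

text \<open>For a frozen permutation this is \<open>tilted_mass\<close>; averaging over the
  permutations preserves the value one.\<close>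

lemma exp_martingale_mean:
  assumes n: "n \<ge> 1" "tilt n \<le> 1"
  shows "(\<integral>\<^sup>+\<omega>. ennreal (exp (l * active_sum n \<omega> - compensator l n \<omega>)) \<partial>M) = 1"
proof -
  obtain r where r: "n \<in> gen r" using ex_gen[OF n(1)] by blast
  \<comment> \<open>The density of the tilted kernel with respect to P, normalised by the Laplace
    transform at the root of the triangle, its first component.\<close>
  define e where "e u = exp (l * tilt n * clip (tilt n) (f u)) / laplace l n (fst u)" for u
  note t = tilt_pos[OF n(1)]
  have Lpos: "laplace l n x > 0" for x using laplace_bounds(2)[OF n, of l x] exp_gt_zero less_le_trans by blast
  have em: "e \<in> borel_measurable S3"
    unfolding e_def[abs_def]
    by (intro borel_measurable_divide exp_clip_meas measurable_compose[OF measurable_fst laplace_meas])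
  have e0: "0 \<le> e u" for u using Lpos[of "fst u"] by (simp add: e_def)
  have eB: "e u \<le> exp (2 * \<bar>l\<bar>)" for u
  proof -
    have "l * tilt n * clip (tilt n) (f u) \<le> \<bar>l\<bar>" using clip_bound[OF t, of l "f u"] by linarith
    then have "e u \<le> exp \<bar>l\<bar> / exp (- \<bar>l\<bar>)"
      unfolding e_def using laplace_bounds(2)[OF n, of l "fst u"] by (intro frac_le) auto
    also have "\<dots> = exp (2 * \<bar>l\<bar>)" by (simp add: exp_diff[symmetric])
    finally show ?thesis .
  qed
  have eP: "Pop P e x = 1" for x
  proof -
    have "Pop P e x = laplace l n x / laplace l n x" unfolding e_def Pop_def laplace_def by simp
    then show ?thesis using Lpos[of x] by simp
  qed
  define G where "G \<sigma> \<omega> = (\<Prod>i\<in>tree_upto r. ennreal (if active n \<sigma> i \<omega> then e (Delta X (\<sigma> i) \<omega>) else 1))" for \<sigma> \<omega>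
  have tree: "{1..n} \<subseteq> tree_upto r" using r unfolding tree_upto_eq by (auto simp: gen_def)
  \<comment> \<open>Positions before i belong to its generation or to earlier ones, and \<sigma>
    preserves generations; hence activity at i is decided by the history up to its
    generation.\<close>
  have low: "j \<in> tree_upto q" if "i \<in> tree_upto q" "j \<in> {1..i}" for i j q
    using that unfolding tree_upto_eq by auto
  have perm_tree: "\<sigma> i \<in> tree_upto q" if "\<sigma> \<in> perms r" "q \<le> r" "i \<in> tree_upto q" for \<sigma> i q
  proof -
    note h = that
    obtain p where p: "p \<le> q" "i \<in> gen p" using h(3) by (auto simp: tree_upto_def)
    then have "\<sigma> i \<in> gen p" using bij_betwE[OF perms_bij[OF h(1), of p]] h(2) by auto
    then show ?thesis using p by (auto simp: tree_upto_def)
  qed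
  have act: "{\<omega> \<in> space M. active n \<sigma> i \<omega>} \<in> sets (history q)"
    if \<sigma>: "\<sigma> \<in> perms r" and q: "q \<le> r" "i \<in> gen q" for \<sigma> q i
  proof -
    have i: "i \<in> tree_upto q" using q by (auto simp: tree_upto_def)
    have "(\<lambda>\<omega>. \<Sum>j=1..i. weight (X (\<sigma> j) \<omega>)) \<in> borel_measurable (history q)"
      using perm_tree[OF \<sigma> q(1) low[OF i]]
      by (intro borel_measurable_sum measurable_compose[OF X_history weight_meas])
    then have "{\<omega> \<in> space (history q). i \<le> n \<and> (\<Sum>j=1..i. weight (X (\<sigma> j) \<omega>)) \<le> threshold * real n} \<in> sets (history q)"
      by measurable
    then show ?thesis unfolding active_def space_history .
  qed
  have sub: "sets (history q) \<subseteq> sets sigma_X" for q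
  proof -
    have "(\<Union>U\<in>X ` tree_upto q. {U -` B \<inter> space M |B. B \<in> sets borel})
        \<subseteq> (\<Union>U\<in>X ` {1..}. {U -` B \<inter> space M |B. B \<in> sets borel})"
      using tree_upto_ge_1[of _ q] by auto
    moreover have "sets (sig_gen M (X ` I) borel) = sigma_sets (space M) (\<Union>U\<in>X ` I. {U -` B \<inter> space M |B. B \<in> sets borel})" for I
      unfolding sig_gen_def by (rule sets_measure_of) blast
    ultimately show ?thesis unfolding history_def sigma_X_def by (simp only: sigma_sets_mono')
  qed
  have spX: "space sigma_X = space M" unfolding sigma_X_def by (rule space_sig_gen)
  have Gm: "G \<sigma> \<in> borel_measurable sigma_X" if \<sigma>: "\<sigma> \<in> perms r" for \<sigma>
    unfolding G_def
  proof (rule borel_measurable_prod_ennreal, rule measurable_compose[OF _ measurable_ennreal], rule measurable_If)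
    fix i assume i: "i \<in> tree_upto r"
    then obtain q where q: "q \<le> r" "i \<in> gen q" by (auto simp: tree_upto_def)
    have "\<sigma> i \<ge> 1" using perm_tree[OF \<sigma> order_refl i] tree_upto_ge_1 by blast
    then have "Delta X (\<sigma> i) \<in> sigma_X \<rightarrow>\<^sub>M S3"
      unfolding Delta_def[abs_def] by (intro measurable_Pair X_sigma_X) auto
    then show "(\<lambda>\<omega>. e (Delta X (\<sigma> i) \<omega>)) \<in> borel_measurable sigma_X" by (rule measurable_compose[OF _ em])
    show "{\<omega> \<in> space sigma_X. active n \<sigma> i \<omega>} \<in> sets sigma_X"
      using act[OF \<sigma> q] sub[of q] by (auto simp: spX)
  qed simp
  have G1: "(\<integral>\<^sup>+\<omega>. G \<sigma> \<omega> \<partial>M) = 1" if \<sigma>: "\<sigma> \<in> perms r" for \<sigma>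
    unfolding G_def by (rule tilted_mass[OF perms_bij[OF \<sigma>] act[OF \<sigma>] em e0 eB eP])
  have "(\<integral>\<^sup>+\<omega>. ennreal (exp (l * active_sum n \<omega> - compensator l n \<omega>)) \<partial>M) = (\<integral>\<^sup>+\<omega>. G (permuted r \<omega>) \<omega> \<partial>M)"
  proof (rule nn_integral_cong)
    fix \<omega>
    have act_eq: "active n (permuted r \<omega>) i \<omega> \<longleftrightarrow> active n (Pi \<omega>) i \<omega>" if i: "i \<in> tree_upto r" for i
    proof -
      have "(\<Sum>j=1..i. weight (X (permuted r \<omega> j) \<omega>)) = (\<Sum>j=1..i. weight (X (Pi \<omega> j) \<omega>))"
        by (intro sum.cong refl) (simp add: permuted_eq[OF low[OF i]])
      then show ?thesis by (simp add: active_def)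
    qed
    let ?h = "\<lambda>i. if active n (Pi \<omega>) i \<omega> then e (Delta X (Pi \<omega> i) \<omega>) else 1"
    have "G (permuted r \<omega>) \<omega> = (\<Prod>i\<in>tree_upto r. ennreal (?h i))"
      unfolding G_def by (intro prod.cong refl) (simp add: act_eq permuted_eq)
    \<comment> \<open>Positions of the tree beyond n are inactive and contribute the factor 1, so
      whole generations can be used although n lies inside one.\<close>
    also have "\<dots> = (\<Prod>i=1..n. ennreal (?h i))"
      by (rule prod.mono_neutral_right[OF finite_tree_upto tree])
        (use tree_upto_ge_1 in \<open>auto simp: active_def\<close>)
    also have "\<dots> = ennreal (\<Prod>i=1..n. ?h i)"
      using e0 by (intro prod_ennreal) auto
    also have "(\<Prod>i=1..n. ?h i) = (\<Prod>i=1..n. exp ((if active n (Pi \<omega>) i \<omega> then l * (tilt n * clip (tilt n) (f (Delta X (Pi \<omega> i) \<omega>))) else 0)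
        - (if active n (Pi \<omega>) i \<omega> then ln (laplace l n (X (Pi \<omega> i) \<omega>)) else 0)))"
      using Lpos by (intro prod.cong refl) (simp add: e_def exp_diff Delta_def mult.assoc)
    also have "\<dots> = exp (l * active_sum n \<omega> - compensator l n \<omega>)"
      unfolding exp_sum[OF finite_atLeastAtMost, symmetric] active_sum_def compensator_def sum_subtractf sum_distrib_left
      by (simp only: if_distrib[of "\<lambda>x. l * x"] mult_zero_right)
    finally show "ennreal (exp (l * active_sum n \<omega> - compensator l n \<omega>)) = G (permuted r \<omega>) \<omega>" by simp
  qed
  also have "\<dots> = ennreal (1 / card (perms r)) * (\<Sum>\<sigma>\<in>perms r. \<integral>\<^sup>+\<omega>. G \<sigma> \<omega> \<partial>M)"
    by (rule nn_integral_permuted[OF Gm])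
  also have "(\<Sum>\<sigma>\<in>perms r. \<integral>\<^sup>+\<omega>. G \<sigma> \<omega> \<partial>M) = ennreal (card (perms r))"
    using G1 by (simp add: ennreal_of_nat_eq_real_of_nat)
  also have "ennreal (1 / card (perms r)) * ennreal (card (perms r)) = 1"
  proof -
    have "real (card (perms r)) > 0" unfolding card_perms by (simp add: prod_pos)
    then show ?thesis by (subst ennreal_mult[symmetric]) auto
  qed
  finally show ?thesis .
qed

section \<open>Concentration of the compensator\<close>

lemma lln_superexp:
  assumes g: "g \<in> F" and \<delta>: "\<delta> > 0"
  shows "superexp speed (\<lambda>n. prob {\<omega> \<in> space M. \<delta> * real n < \<bar>(\<Sum>i=1..n. g (X (Pi \<omega> i) \<omega>)) - real n * (\<integral>x. g x \<partial>\<mu>)\<bar>})"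
proof -
  interpret mu: prob_space \<mu> by (rule mu_prob)
  let ?m = "\<integral>x. g x \<partial>\<mu>"
  have gF: "(\<lambda>x. g x + - ?m) \<in> F" by (intro F_add g F_const)
  have "(\<integral>x. g x + - ?m \<partial>\<mu>) = 0" using F_mu_int[OF g] by (simp add: mu.prob_space)
  from lln_polynomial[OF gF this] obtain D \<epsilon> where D: "0 < \<epsilon>"
    "\<And>n \<delta>. n \<ge> 1 \<Longrightarrow> \<delta> > 0 \<Longrightarrow>
      prob {\<omega> \<in> space M. \<delta> * real n < \<bar>\<Sum>i=1..n. g (X (Pi \<omega> i) \<omega>) + - ?m\<bar>} \<le> D / \<delta>\<^sup>2 * real n powr (- \<epsilon>)"
    by blast
  have eq: "(\<Sum>i=1..n. g (X (Pi \<omega> i) \<omega>) + - ?m) = (\<Sum>i=1..n. g (X (Pi \<omega> i) \<omega>)) - real n * ?m" for n \<omega>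
    by (simp add: sum_subtractf)
  show ?thesis
  proof (rule superexp_polynomial[OF speed_ln D(1)])
    show "\<forall>\<^sub>F n in sequentially. prob {\<omega> \<in> space M. \<delta> * real n < \<bar>(\<Sum>i=1..n. g (X (Pi \<omega> i) \<omega>)) - real n * ?m\<bar>} \<le> D / \<delta>\<^sup>2 * real n powr (- \<epsilon>)"
      using eventually_ge_at_top[of 1] by eventually_elim (use D(2)[OF _ \<delta>] in \<open>simp only: eq\<close>)
  qed
qed

abbreviation heavy :: "nat \<Rightarrow> 'b set" where
  "heavy n \<equiv> {\<omega> \<in> space M. threshold * real n < (\<Sum>i=1..n. weight (X (Pi \<omega> i) \<omega>))}"

lemma sum_meas: "g \<in> F \<Longrightarrow> (\<lambda>\<omega>. \<Sum>i=1..n. g (X (Pi \<omega> i) \<omega>)) \<in> borel_measurable M"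
  by (intro borel_measurable_sum permuted_X_measurable F_measD) simp_all

lemma heavy_meas: "heavy n \<in> sets M"
  using sum_meas[OF weight_F, of n] by measurable

lemma heavy_superexp: "superexp speed (\<lambda>n. prob (heavy n))"
proof (rule superexp_mono[OF lln_superexp[OF weight_F zero_less_one]], rule always_eventually, rule allI)
  fix n
  have [measurable]: "(\<lambda>\<omega>. \<Sum>i=1..n. weight (X (Pi \<omega> i) \<omega>)) \<in> borel_measurable M" by (rule sum_meas[OF weight_F])
  show "prob (heavy n) \<le> prob {\<omega> \<in> space M. 1 * real n < \<bar>(\<Sum>i=1..n. weight (X (Pi \<omega> i) \<omega>)) - real n * (\<integral>x. weight x \<partial>\<mu>)\<bar>}"
  proof (rule finite_measure_mono)
    show "heavy n \<subseteq> {\<omega> \<in> space M. 1 * real n < \<bar>(\<Sum>i=1..n. weight (X (Pi \<omega> i) \<omega>)) - real n * (\<integral>x. weight x \<partial>\<mu>)\<bar>}"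
      by (auto simp: threshold_def algebra_simps)
  qed measurable
qed

lemma active_of_not_heavy:
  assumes "\<not> threshold * real n < (\<Sum>i=1..n. weight (X (Pi \<omega> i) \<omega>))" "i \<in> {1..n}"
  shows "active n (Pi \<omega>) i \<omega>"
proof -
  have "active n (Pi \<omega>) n \<omega>" using assms(1) by (simp add: active_def)
  then show ?thesis by (rule active_mono) (use assms(2) in simp)
qed

text \<open>Off \<open>heavy n\<close> every position is active, so the compensator is a full sum.
  Its distance to the quadratic term is at most
  \<open>laplace_const l * threshold * tilt n * speed n\<close>, which is o(speed); the quadratic
  term concentrates by the law of large numbers for V2.\<close>

lemma compensator_superexp:
  assumes d: "d > 0"
  shows "superexp speed (\<lambda>n. prob {\<omega> \<in> space M. \<bar>compensator l n \<omega> - l\<^sup>2 * limit_variance / 2 * speed n\<bar> > d * speed n})"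
proof -
  \<comment> \<open>Gives \<open>l\<^sup>2 * \<delta> \<le> d\<close> and remains positive and
    finite for l = 0.\<close>
  define \<delta> where "\<delta> = d / (l\<^sup>2 + 1)"
  have l1: "l\<^sup>2 + 1 > 0" by (simp add: add_nonneg_pos)
  have \<delta>: "\<delta> > 0" using d l1 by (simp add: \<delta>_def)
  have "l\<^sup>2 * \<delta> \<le> (l\<^sup>2 + 1) * \<delta>" using \<delta> by (intro mult_right_mono) auto
  also have "\<dots> = d" using l1 by (simp add: \<delta>_def)
  finally have ld: "l\<^sup>2 * \<delta> \<le> d" .
  let ?B = "\<lambda>n. {\<omega> \<in> space M. \<delta> * real n < \<bar>(\<Sum>i=1..n. V2 (X (Pi \<omega> i) \<omega>)) - real n * limit_variance\<bar>}"
  have "superexp speed (\<lambda>n. prob (heavy n) + prob (?B n))"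
    by (rule superexp_add[OF speed_at_top heavy_superexp lln_superexp[OF V2_F \<delta>]])
  then show ?thesis
  proof (rule superexp_mono)
    have "(\<lambda>n. laplace_const l * threshold * tilt n) \<longlonglongrightarrow> laplace_const l * threshold * 0"
      by (intro tendsto_mult tendsto_const tilt_tendsto)
    then have "\<forall>\<^sub>F n in sequentially. laplace_const l * threshold * tilt n < d / 2"
      by (rule order_tendstoD) (use d in simp)
    moreover have "\<forall>\<^sub>F n in sequentially. tilt n < 1"
      by (rule order_tendstoD[OF tilt_tendsto]) simp
    ultimately show "\<forall>\<^sub>F n in sequentially. prob {\<omega> \<in> space M. \<bar>compensator l n \<omega> - l\<^sup>2 * limit_variance / 2 * speed n\<bar> > d * speed n} \<le> prob (heavy n) + prob (?B n)"
      using eventually_ge_at_top[of 1]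
    proof eventually_elim
      case (elim n)
      have n: "n \<ge> 1" "tilt n \<le> 1" using elim by auto
      note t = tilt_pos[OF n(1)]
      have [measurable]: "(\<lambda>\<omega>. \<Sum>i=1..n. V2 (X (Pi \<omega> i) \<omega>)) \<in> borel_measurable M" by (rule sum_meas[OF V2_F])
      have Bm: "?B n \<in> sets M" by measurable
      have "{\<omega> \<in> space M. \<bar>compensator l n \<omega> - l\<^sup>2 * limit_variance / 2 * speed n\<bar> > d * speed n} \<subseteq> heavy n \<union> ?B n"
      proof (rule subsetI, rule ccontr)
        fix \<omega> assume w: "\<omega> \<in> {\<omega> \<in> space M. \<bar>compensator l n \<omega> - l\<^sup>2 * limit_variance / 2 * speed n\<bar> > d * speed n}"
          and nw: "\<omega> \<notin> heavy n \<union> ?B n"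
        have nh: "\<not> threshold * real n < (\<Sum>i=1..n. weight (X (Pi \<omega> i) \<omega>))" using w nw by auto
        let ?S = "\<Sum>i=1..n. V2 (X (Pi \<omega> i) \<omega>)"
        let ?a = "l\<^sup>2 * (tilt n)\<^sup>2 / 2"
        have "compensator l n \<omega> - ?a * ?S = (\<Sum>i=1..n. ln (laplace l n (X (Pi \<omega> i) \<omega>)) - ?a * V2 (X (Pi \<omega> i) \<omega>))"
          unfolding compensator_def sum_subtractf sum_distrib_left
          by (intro arg_cong2[where f = "(-)"] sum.cong refl) (simp add: active_of_not_heavy[OF nh])
        then have "\<bar>compensator l n \<omega> - ?a * ?S\<bar> \<le> (\<Sum>i=1..n. \<bar>ln (laplace l n (X (Pi \<omega> i) \<omega>)) - ?a * V2 (X (Pi \<omega> i) \<omega>)\<bar>)"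
          by (simp only: sum_abs)
        also have "\<dots> \<le> (\<Sum>i=1..n. laplace_const l * tilt n ^ 3 * weight (X (Pi \<omega> i) \<omega>))"
          by (intro sum_mono laplace_bounds(1)[OF n])
        also have "\<dots> = laplace_const l * tilt n ^ 3 * (\<Sum>i=1..n. weight (X (Pi \<omega> i) \<omega>))"
          by (rule sum_distrib_left[symmetric])
        also have "\<dots> \<le> laplace_const l * tilt n ^ 3 * (threshold * real n)"
          using nh t laplace_const_nonneg by (intro mult_left_mono) auto
        also have "\<dots> = laplace_const l * threshold * tilt n * speed n"
          unfolding tilt_square[OF n(1), symmetric] by (simp add: power2_eq_square power3_eq_cube)
        also have "\<dots> \<le> d / 2 * speed n"
          using elim(1) by (intro mult_right_mono) (auto simp: speed_def)
        finally have 1: "\<bar>compensator l n \<omega> - ?a * ?S\<bar> \<le> d / 2 * speed n" .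
        have "\<bar>?a * ?S - l\<^sup>2 * limit_variance / 2 * speed n\<bar> = \<bar>?a * (?S - real n * limit_variance)\<bar>"
          unfolding tilt_square[OF n(1), symmetric] by (simp add: algebra_simps)
        also have "\<dots> = ?a * \<bar>?S - real n * limit_variance\<bar>" by (simp add: abs_mult)
        also have "\<dots> \<le> ?a * (\<delta> * real n)"
        proof (rule mult_left_mono)
          show "\<bar>?S - real n * limit_variance\<bar> \<le> \<delta> * real n" using w nw by auto
        qed simp
        also have "\<dots> = (l\<^sup>2 * \<delta>) / 2 * speed n"
          unfolding tilt_square[OF n(1), symmetric] by simp
        also have "\<dots> \<le> d / 2 * speed n"
          using ld by (intro mult_right_mono) (auto simp: speed_def)
        finally have "\<bar>compensator l n \<omega> - l\<^sup>2 * limit_variance / 2 * speed n\<bar> \<le> d / 2 * speed n + d / 2 * speed n"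
          using 1 by linarith
        also have "\<dots> = d * speed n" by simp
        finally show False using w by simp
      qed
      then have "prob {\<omega> \<in> space M. \<bar>compensator l n \<omega> - l\<^sup>2 * limit_variance / 2 * speed n\<bar> > d * speed n} \<le> prob (heavy n \<union> ?B n)"
        by (intro finite_measure_mono sets.Un heavy_meas Bm)
      also have "\<dots> \<le> prob (heavy n) + prob (?B n)" by (rule measure_Un_le[OF heavy_meas Bm])
      finally show ?case .
    qed
  qed
qed

section \<open>Terms above the truncation level\<close>

definition jump :: "nat \<Rightarrow> nat \<Rightarrow> 'b set" where
  "jump n i = {\<omega> \<in> space M. 1 / tilt n < \<bar>f (Delta X i \<omega>)\<bar>}"

lemma fD_meas: "i \<ge> 1 \<Longrightarrow> (\<lambda>\<omega>. f (Delta X i \<omega>)) \<in> borel_measurable M"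
  by (rule measurable_compose[OF Delta_meas f_meas])

lemma jump_meas: "i \<ge> 1 \<Longrightarrow> jump n i \<in> sets M"
  unfolding jump_def using fD_meas[of i] by measurable

lemma jump_prob:
  assumes i: "i \<ge> 1" and n: "n \<ge> 1"
  shows "prob (jump n i) \<le> tilt n ^ 4 * expectation (\<lambda>\<omega>. V4 (X i \<omega>))"
proof -
  note t = tilt_pos[OF n]
  have f4: "(\<lambda>u. (f u) ^ 4) \<in> borel_measurable S3" by (intro borel_measurable_power f_meas)
  have fin: "integrable M (\<lambda>\<omega>. Pop P (\<lambda>u. (f u) ^ 4) (X i \<omega>))"
    using first_moment(1)[OF V4_F V_nonneg(2) i] by (simp add: V4_def)
  have i4: "integrable M (\<lambda>\<omega>. (f (Delta X i \<omega>)) ^ 4)"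
    by (rule Delta_nonneg(1)[OF i f4 _ Pf4_int fin]) simp
  have e4: "expectation (\<lambda>\<omega>. (f (Delta X i \<omega>)) ^ 4) = expectation (\<lambda>\<omega>. V4 (X i \<omega>))"
    unfolding V4_def by (rule Delta_nonneg(2)[OF i f4 _ Pf4_int fin]) simp
  have "prob (jump n i) = expectation (indicator (jump n i))" using jump_meas[OF i] by simp
  also have "\<dots> \<le> expectation (\<lambda>\<omega>. tilt n ^ 4 * (f (Delta X i \<omega>)) ^ 4)"
  proof (rule integral_mono)
    show "integrable M (indicator (jump n i) :: 'b \<Rightarrow> real)"
      using jump_meas[OF i] by (simp add: emeasure_eq_measure)
    show "integrable M (\<lambda>\<omega>. tilt n ^ 4 * (f (Delta X i \<omega>)) ^ 4)" by (intro integrable_mult_right i4)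
    fix \<omega> assume "\<omega> \<in> space M"
    show "indicator (jump n i) \<omega> \<le> tilt n ^ 4 * (f (Delta X i \<omega>)) ^ 4"
    proof (cases "\<omega> \<in> jump n i")
      case True
      then have "1 \<le> tilt n * \<bar>f (Delta X i \<omega>)\<bar>" using t by (simp add: jump_def field_simps)
      then have "1 \<le> (tilt n * \<bar>f (Delta X i \<omega>)\<bar>) ^ 4" by (rule one_le_power)
      then show ?thesis using True by (simp add: power_mult_distrib)
    qed simp
  qed
  also have "\<dots> = tilt n ^ 4 * expectation (\<lambda>\<omega>. V4 (X i \<omega>))" by (simp add: e4)
  finally show ?thesis .
qed

definition jumps :: "nat \<Rightarrow> 'b set" where
  "jumps n = {\<omega> \<in> space M. \<exists>i\<in>{1..n}. 1 / tilt n < \<bar>f (Delta X (Pi \<omega> i) \<omega>)\<bar>}"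

text \<open>The first n positions are mapped into the tree up to the generation of n, which has
  fewer than 2 n vertices, so a union bound over the whole tree disposes of the permutation. With
  fourth moments it has order n tilt^4 = speed^2 / n, about (ln n)^2 / n at most.\<close>

lemma jumps_superexp: "superexp speed (\<lambda>n. prob (jumps n))"
proof -
  obtain C where C: "C \<ge> 0" "\<And>q. (\<Sum>i\<in>gen q. expectation (\<lambda>\<omega>. V4 (X i \<omega>))) \<le> 2 ^ q * C"
    using first_moment(2)[OF V4_F V_nonneg(2)] by blast
  show ?thesis
  proof (rule superexp_polynomial[OF speed_ln])
    show "\<forall>\<^sub>F n in sequentially. prob (jumps n) \<le> 32 * C * real n powr (- (1 / 2))"
      using speed_le_ln eventually_ge_at_top[of 1]
    proof eventually_elim
      case (elim n)
      obtain r where r: "n \<in> gen r" using ex_gen[OF elim(2)] by blast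
      have n0: "real n > 0" using elim(2) by simp
      have "jumps n \<subseteq> (\<Union>v\<in>tree_upto r. jump n v)"
      proof
        fix \<omega> assume "\<omega> \<in> jumps n"
        then obtain i where i: "\<omega> \<in> space M" "i \<in> {1..n}" "1 / tilt n < \<bar>f (Delta X (Pi \<omega> i) \<omega>)\<bar>"
          by (auto simp: jumps_def)
        have "i \<in> tree_upto r" using r i(2) unfolding tree_upto_eq by (auto simp: gen_def)
        then obtain q where q: "q \<le> r" "i \<in> gen q" by (auto simp: tree_upto_def)
        then have "Pi \<omega> i \<in> gen q" using bij_betwE[OF Pi_perm[OF i(1)]] by blast
        then have "Pi \<omega> i \<in> tree_upto r" using q by (auto simp: tree_upto_def)
        then show "\<omega> \<in> (\<Union>v\<in>tree_upto r. jump n v)" using i by (auto simp: jump_def)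
      qed
      then have "prob (jumps n) \<le> prob (\<Union>v\<in>tree_upto r. jump n v)"
        by (rule finite_measure_mono) (intro sets.finite_UN finite_tree_upto jump_meas tree_upto_ge_1)
      also have "\<dots> \<le> (\<Sum>v\<in>tree_upto r. prob (jump n v))"
        by (rule finite_measure_subadditive_finite) (auto intro: jump_meas tree_upto_ge_1)
      also have "\<dots> \<le> (\<Sum>v\<in>tree_upto r. tilt n ^ 4 * expectation (\<lambda>\<omega>. V4 (X v \<omega>)))"
        by (intro sum_mono jump_prob elim(2)) (rule tree_upto_ge_1)
      also have "\<dots> = tilt n ^ 4 * (\<Sum>q\<le>r. \<Sum>v\<in>gen q. expectation (\<lambda>\<omega>. V4 (X v \<omega>)))"
        unfolding sum_distrib_left[symmetric] tree_upto_def
        by (subst sum.UNION_disjoint) (auto dest: gen_disjoint)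
      also have "\<dots> \<le> tilt n ^ 4 * (2 * real n * C)"
      proof (rule mult_left_mono)
        have "(\<Sum>q\<le>r. \<Sum>v\<in>gen q. expectation (\<lambda>\<omega>. V4 (X v \<omega>))) \<le> (\<Sum>q\<le>r. 2 ^ q * C)"
          by (intro sum_mono C)
        also have "\<dots> = (\<Sum>q\<le>r. 2 ^ q) * C" by (rule sum_distrib_right[symmetric])
        also have "(\<Sum>q\<le>r. 2 ^ q :: real) = 2 ^ Suc r - 1"
          using sum_gp_basic[of "2::real" r] by simp
        also have "(2 ^ Suc r - 1) * C \<le> 2 * real n * C"
        proof (rule mult_right_mono[OF _ C(1)])
          have "(2::nat) ^ r \<le> n" using r by (simp add: gen_def)
          then have "(2::real) ^ r \<le> real n" by (metis of_nat_le_iff of_nat_numeral of_nat_power)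
          then show "2 ^ Suc r - 1 \<le> 2 * real n" unfolding power_Suc by linarith
        qed
        finally show "(\<Sum>q\<le>r. \<Sum>v\<in>gen q. expectation (\<lambda>\<omega>. V4 (X v \<omega>))) \<le> 2 * real n * C" .
      qed simp
      also have "\<dots> = 2 * C * ((speed n)\<^sup>2 / real n)"
        using n0 by (simp add: tilt_def speed_def power2_eq_square eval_nat_numeral mult_ac)
      also have "\<dots> \<le> 2 * C * (16 * real n powr (- (1 / 2)))"
      proof (rule mult_left_mono)
        \<comment> \<open>ln n \<le> 4 n^(1/4); squaring gives the 16, and the size 2 n of the tree
          makes the constant 32.\<close>
        have "speed n \<le> real n powr (1 / 4) / (1 / 4)"
          using elim(1) ln_powr_bound[of "real n" "1 / 4"] elim(2) by simp
        then have "(speed n)\<^sup>2 \<le> (4 * real n powr (1 / 4))\<^sup>2"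
          by (intro power_mono) (auto simp: speed_def)
        also have "\<dots> = 16 * real n powr (1 / 2)"
          by (simp add: power_mult_distrib power2_eq_square powr_add[symmetric])
        finally have "(speed n)\<^sup>2 / real n \<le> 16 * real n powr (1 / 2) / real n"
          by (intro divide_right_mono) auto
        also have "\<dots> = 16 * (real n powr (1 / 2) / real n powr 1)" using n0 by simp
        also have "\<dots> = 16 * real n powr (- (1 / 2))" by (simp only: powr_diff[symmetric]) simp
        finally show "(speed n)\<^sup>2 / real n \<le> 16 * real n powr (- (1 / 2))" .
      qed (use C in simp)
      finally show ?case by simp
    qed
  qed simp
qed

section \<open>The normalised sum and its deviations\<close>

definition scaled :: "nat \<Rightarrow> 'b \<Rightarrow> real" where
  "scaled n \<omega> = (\<Sum>i=1..n. f (Delta X (Pi \<omega> i) \<omega>)) / b n"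

lemma fPi_meas: "i \<ge> 1 \<Longrightarrow> (\<lambda>\<omega>. f (Delta X (Pi \<omega> i) \<omega>)) \<in> borel_measurable M"
  by (rule permuted_measurable[of i "\<lambda>v \<omega>. f (Delta X v \<omega>)"]) (auto intro: fD_meas)

lemma scaled_meas: "scaled n \<in> borel_measurable M"
  unfolding scaled_def by (intro borel_measurable_divide borel_measurable_sum fPi_meas) auto

lemma jumps_meas: "jumps n \<in> sets M"
proof -
  have "jumps n = (\<Union>i\<in>{1..n}. {\<omega> \<in> space M. 1 / tilt n < \<bar>f (Delta X (Pi \<omega> i) \<omega>)\<bar>})"
    by (auto simp: jumps_def)
  also have "\<dots> \<in> sets M"
  proof (rule sets.finite_UN)
    fix i assume "i \<in> {1..n}"
    then have [measurable]: "(\<lambda>\<omega>. f (Delta X (Pi \<omega> i) \<omega>)) \<in> borel_measurable M" by (intro fPi_meas) simp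
    show "{\<omega> \<in> space M. 1 / tilt n < \<bar>f (Delta X (Pi \<omega> i) \<omega>)\<bar>} \<in> sets M" by measurable
  qed simp
  finally show ?thesis .
qed

text \<open>Stopping and truncation are the only differences between the two sides, and each acts on
  a negligible event: \<open>heavy n\<close> for the first, \<open>jumps n\<close> for the
  second.\<close>

lemma scaled_eq_superexp: "superexp speed (\<lambda>n. prob {\<omega> \<in> space M. speed n * scaled n \<omega> \<noteq> active_sum n \<omega>})"
proof (rule superexp_mono[OF superexp_add[OF speed_at_top heavy_superexp jumps_superexp]])
  show "\<forall>\<^sub>F n in sequentially. prob {\<omega> \<in> space M. speed n * scaled n \<omega> \<noteq> active_sum n \<omega>} \<le> prob (heavy n) + prob (jumps n)"
    using eventually_ge_at_top[of 1]
  proof eventually_elim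
    case (elim n)
    have "{\<omega> \<in> space M. speed n * scaled n \<omega> \<noteq> active_sum n \<omega>} \<subseteq> heavy n \<union> jumps n"
    proof (rule subsetI, rule ccontr)
      fix \<omega> assume w: "\<omega> \<in> {\<omega> \<in> space M. speed n * scaled n \<omega> \<noteq> active_sum n \<omega>}" and nw: "\<omega> \<notin> heavy n \<union> jumps n"
      have nh: "\<not> threshold * real n < (\<Sum>i=1..n. weight (X (Pi \<omega> i) \<omega>))" using w nw by auto
      have nj: "\<bar>f (Delta X (Pi \<omega> i) \<omega>)\<bar> \<le> 1 / tilt n" if "i \<in> {1..n}" for i
        using w nw that by (force simp: jumps_def)
      have "active_sum n \<omega> = (\<Sum>i=1..n. tilt n * f (Delta X (Pi \<omega> i) \<omega>))"
        unfolding active_sum_def by (intro sum.cong refl) (simp add: active_of_not_heavy[OF nh] clip_def nj)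
      also have "\<dots> = tilt n * (\<Sum>i=1..n. f (Delta X (Pi \<omega> i) \<omega>))" by (rule sum_distrib_left[symmetric])
      also have "\<dots> = speed n * scaled n \<omega>"
        using b_pos[of n] by (simp add: tilt_def speed_def scaled_def power2_eq_square)
      finally show False using w by simp
    qed
    then have "prob {\<omega> \<in> space M. speed n * scaled n \<omega> \<noteq> active_sum n \<omega>} \<le> prob (heavy n \<union> jumps n)"
      by (intro finite_measure_mono sets.Un heavy_meas jumps_meas)
    also have "\<dots> \<le> prob (heavy n) + prob (jumps n)" by (rule measure_Un_le[OF heavy_meas jumps_meas])
    finally show ?case .
  qed
qed

lemma log_laplace_active_sum: "quadratic_log_laplace speed limit_variance active_sum"
proof (rule log_laplace_asymptotics[where C = compensator, OF speed_at_top active_sum_meas compensator_meas _ _ compensator_superexp])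
  have t1: "\<forall>\<^sub>F n in sequentially. tilt n < 1"
    by (rule order_tendstoD[OF tilt_tendsto]) simp
  show "\<forall>\<^sub>F n in sequentially. (\<integral>\<^sup>+\<omega>. ennreal (exp (l * active_sum n \<omega> - compensator l n \<omega>)) \<partial>M) = 1" for l
    using t1 eventually_ge_at_top[of 1] by eventually_elim (rule exp_martingale_mean; simp)
  have "\<forall>\<^sub>F n in sequentially. \<forall>\<omega>\<in>space M. \<bar>compensator l n \<omega>\<bar> \<le> (l\<^sup>2 + laplace_const l) * threshold * speed n" for l
    using t1 eventually_ge_at_top[of 1] by eventually_elim (intro ballI compensator_bound; simp)
  then show "\<exists>K. \<forall>\<^sub>F n in sequentially. \<forall>\<omega>\<in>space M. \<bar>compensator l n \<omega>\<bar> \<le> K * speed n" for l by blast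
qed

lemma limit_variance_nonneg: "limit_variance \<ge> 0"
  by (intro integral_nonneg_AE) (simp add: V_nonneg)

lemma moderate_deviations:
  assumes A: "A \<in> sets borel"
  defines "L \<equiv> \<lambda>n. ereal (real n / (b n)^2) * ln_ereal (ereal (prob {\<omega> \<in> space M. scaled n \<omega> \<in> A}))"
  shows "- (INF x\<in>interior A. rate limit_variance x) \<le> liminf L"
    and "limsup L \<le> - (INF x\<in>closure A. rate limit_variance x)"
proof -
  have L: "\<forall>\<^sub>F n in sequentially. L n = ereal (1 / speed n) * ln_ereal (ereal (prob {\<omega> \<in> space M. scaled n \<omega> \<in> A}))"
    by (simp add: L_def speed_def)
  show "- (INF x\<in>interior A. rate limit_variance x) \<le> liminf L"
    by (rule moderate_deviations_of_quadratic_log_laplace(1)[OF speed_at_top limit_variance_nonneg active_sum_meas scaled_meas log_laplace_active_sum scaled_eq_superexp A L])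
  show "limsup L \<le> - (INF x\<in>closure A. rate limit_variance x)"
    by (rule moderate_deviations_of_quadratic_log_laplace(2)[OF speed_at_top limit_variance_nonneg active_sum_meas scaled_meas log_laplace_active_sum scaled_eq_superexp A L])
qed

end

theorem theorem2p14:
  fixes M :: "'b measure"
    and X :: "nat \<Rightarrow> 'b \<Rightarrow> 'a::metric_space"
    and P :: "'a \<Rightarrow> ('a \<times> 'a) measure"
    and \<nu> :: "'a measure"
    and \<mu> :: "'a measure"
    and Pi :: "'b \<Rightarrow> nat \<Rightarrow> nat"
    and F :: "('a \<Rightarrow> real) set"
    and f :: "'a \<times> 'a \<times> 'a \<Rightarrow> real"
    and b :: "nat \<Rightarrow> real"
  assumes M: "prob_space M"
    \<comment> \<open>P is a T-transition probability (Markov kernel from S to S^2)\<close>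
    and P_kernel: "P \<in> borel \<rightarrow>\<^sub>M prob_algebra S2"
    \<comment> \<open>X is a bifurcating Markov chain with initial law \<nu> and T-transition probability P\<close>
    and X_meas: "\<And>i. i \<ge> 1 \<Longrightarrow> X i \<in> M \<rightarrow>\<^sub>M borel"
    and nu: "prob_space \<nu>" "sets \<nu> = sets borel"
    and X1_law: "distr M borel (X 1) = \<nu>"
    and BMC: "\<And>r (fs :: nat \<Rightarrow> 'a \<times> 'a \<times> 'a \<Rightarrow> real) A.
        (\<And>n. n \<in> gen r \<Longrightarrow> fs n \<in> borel_measurable S3) \<Longrightarrow>
        (\<And>n. n \<in> gen r \<Longrightarrow> bounded (range (fs n))) \<Longrightarrow>
        A \<in> sets (sig_gen M (X ` tree_upto r) borel) \<Longrightarrow>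
        (LINT \<omega>:A|M. (\<Prod>n\<in>gen r. fs n (Delta X n \<omega>)))
          = (LINT \<omega>:A|M. (\<Prod>n\<in>gen r. Pop P (fs n) (X n \<omega>)))"
    \<comment> \<open>Pi: random permutation of N* leaving each generation invariant, uniform, independent of X\<close>
    and Pi_perm: "\<And>\<omega> r. \<omega> \<in> space M \<Longrightarrow> bij_betw (Pi \<omega>) (gen r) (gen r)"
    and Pi_meas: "\<And>i j. {\<omega> \<in> space M. Pi \<omega> i = j} \<in> sets M"
    and Pi_law: "\<And>r \<sigma> E. (\<And>q. q \<le> r \<Longrightarrow> bij_betw \<sigma> (gen q) (gen q)) \<Longrightarrow>
        E \<in> sets (sig_gen M (X ` {1..}) borel) \<Longrightarrow>
        measure M ({\<omega> \<in> space M. \<forall>i\<in>tree_upto r. Pi \<omega> i = \<sigma> i} \<inter> E)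
          = measure M E / (\<Prod>q\<le>r. fact (2^q))"
    \<comment> \<open>F is a vector subspace of B(S)\<close>
    and F_meas: "F \<subseteq> borel_measurable borel"
    and F_zero: "(\<lambda>_. 0) \<in> F"
    and F_add: "\<And>g h. g \<in> F \<Longrightarrow> h \<in> F \<Longrightarrow> (\<lambda>x. g x + h x) \<in> F"
    and F_scale: "\<And>c g. g \<in> F \<Longrightarrow> (\<lambda>x. c * g x) \<in> F"
    \<comment> \<open>(i)\<close>
    and F_const: "\<And>c. (\<lambda>_. c) \<in> F"
    \<comment> \<open>(ii)\<close>
    and F_sq: "\<And>g. g \<in> F \<Longrightarrow> (\<lambda>x. (g x)^2) \<in> F"
    \<comment> \<open>(iii)\<close>
    and F_tens_int: "\<And>x g h. g \<in> F \<Longrightarrow> h \<in> F \<Longrightarrow>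
        integrable (P x) (\<lambda>yz. g (fst yz) * h (snd yz))"
    and F_tens: "\<And>g h. g \<in> F \<Longrightarrow> h \<in> F \<Longrightarrow> Ptens P g h \<in> F"
    \<comment> \<open>(iv)\<close>
    and mu: "prob_space \<mu>" "sets \<mu> = sets borel"
    and F_mu_int: "\<And>g. g \<in> F \<Longrightarrow> integrable \<mu> g"
    and ergodic: "\<And>x g. g \<in> F \<Longrightarrow> (\<lambda>r. (Qop P ^^ r) g x) \<longlonglongrightarrow> (\<integral>y. g y \<partial>\<mu>)"
    \<comment> \<open>(v)\<close>
    and F_dom: "\<And>g. g \<in> F \<Longrightarrow> \<exists>h\<in>F. \<forall>r x. \<bar>(Qop P ^^ r) g x\<bar> \<le> h x"
    \<comment> \<open>(vi)\<close>
    and F_nu_int: "\<And>g. g \<in> F \<Longrightarrow> integrable \<nu> g"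
    \<comment> \<open>(H1)\<close>
    and H1: "\<exists>\<alpha>::real. 0 < \<alpha> \<and> \<alpha> < 1 \<and> (\<forall>g\<in>F. (\<integral>y. g y \<partial>\<mu>) = 0 \<longrightarrow>
        (\<exists>h\<in>F. \<forall>r x. \<bar>(Qop P ^^ r) g x\<bar> \<le> \<alpha>^r * h x))"
    \<comment> \<open>hypotheses on f\<close>
    and f_meas: "f \<in> borel_measurable S3"
    and Pf2_int: "\<And>x. integrable (P x) (\<lambda>yz. (f (x, fst yz, snd yz))^2)"
    and Pf2_F: "Pop P (\<lambda>t. (f t)^2) \<in> F"
    and Pf4_int: "\<And>x. integrable (P x) (\<lambda>yz. (f (x, fst yz, snd yz))^4)"
    and Pf4_F: "Pop P (\<lambda>t. (f t)^4) \<in> F"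
    and Pf0: "\<And>x. Pop P f x = 0"
    \<comment> \<open>hypotheses on (b_n)\<close>
    and b_pos: "\<And>n. b n > 0"
    and b_inc: "incseq b"
    and b_lower: "filterlim (\<lambda>n. b n / sqrt (real n)) at_top sequentially"
    and b_upper: "(\<lambda>n. b n / sqrt (real n * ln (real n))) \<longlonglongrightarrow> 0"
    \<comment> \<open>the exponential-negligibility condition; H k is the sigma-field H_k\<close>
    and tail: "let H = (\<lambda>k. if k = 0 then sig_gen M {X 1} borel
                        else sig_gen M ((\<lambda>i \<omega>. Delta X (Pi \<omega> i) \<omega>) ` {1..k}) S3)
      in limsup (\<lambda>n. ereal (real n / (b n)^2) *
           ln_ereal (ereal (real n) *
             esssup M (\<lambda>\<omega>. SUP k\<in>{1..cinv b (b (Suc n))}.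
               ereal (real_cond_exp M (H (k - 1))
                 (indicator {\<omega>' \<in> space M. \<bar>f (Delta X (Pi \<omega>' k) \<omega>')\<bar> > b n}) \<omega>))))
         = -\<infinity>"
  shows "\<And>A::real set. A \<in> sets borel \<Longrightarrow>
    (let Mn = (\<lambda>n \<omega>. \<Sum>i=1..n. f (Delta X (Pi \<omega> i) \<omega>));
         L = (\<lambda>n. ereal (real n / (b n)^2) *
                ln_ereal (ereal (measure M {\<omega> \<in> space M. Mn n \<omega> / b n \<in> A})));
         I = rate (\<integral>x. Pop P (\<lambda>t. (f t)^2) x \<partial>\<mu>)
     in - (INF x\<in>interior A. I x) \<le> liminf L
        \<and> liminf L \<le> limsup L
        \<and> limsup L \<le> - (INF x\<in>closure A. I x))"
proof -
  fix A :: "real set" assume A: "A \<in> sets borel"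
  interpret prob_space M by (rule M)
  interpret mu: prob_space \<mu> by (rule mu(1))
  interpret bmc_moderate M X P \<nu> \<mu> F Pi f b
    by unfold_locales (fact assms)+
  have v: "(\<integral>x. Pop P (\<lambda>t. (f t)^2) x \<partial>\<mu>) = limit_variance" by (simp add: V2_def)
  show "let Mn = (\<lambda>n \<omega>. \<Sum>i=1..n. f (Delta X (Pi \<omega> i) \<omega>));
         L = (\<lambda>n. ereal (real n / (b n)^2) *
                ln_ereal (ereal (measure M {\<omega> \<in> space M. Mn n \<omega> / b n \<in> A})));
         I = rate (\<integral>x. Pop P (\<lambda>t. (f t)^2) x \<partial>\<mu>)
     in - (INF x\<in>interior A. I x) \<le> liminf L
        \<and> liminf L \<le> limsup L
        \<and> limsup L \<le> - (INF x\<in>closure A. I x)"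
    unfolding Let_def v using moderate_deviations[OF A]
    by (auto simp: scaled_def intro: Liminf_le_Limsup)
qed

end
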